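(* Let $G$ be a finite group and let $H$ be a semisimple Hopf algebra over $\mathbb{C}$ fitting into an abelian extension $1 \to \mathbb{C}^G \to H \to \mathbb{C}\mathbb{Z}_2 \to 1$. Then Frobenius theorem holds for $H$: for every positive divisor $n$ of $\dim_{\mathbb{C}}H$, $\nu_n(H)$ is divisible by $n$ in the ring of algebraic integers.
   Context: An abelian extension $1\to\mathbb{C}^G\to A\to\mathbb{C}F\to1$ ($F,G$ finite groups, $\mathbb{C}^G$ the dual Hopf algebra of $\mathbb{C}G$) is a short exact sequence of finite-dimensional Hopf algebras. Equivalently, $A \cong \mathbb{C}^G\#_{\sigma,\tau}\mathbb{C}F$ for some matched pair $(F,G)$ with actions $\triangleleft: G\times F\to G$, $\triangleright:G\times F\to F$ and maps $\sigma:G\times F\times F\to\mathbb{C}^\times$, $\tau:G\times G\times F\to\mathbb{C}^\times$ satisfying suitable cocycle conditions: with $e_g\in\mathbb{C}^G$ the basis dual to $g\in G$, the algebra is generated by $\mathbb{C}^G$ and $u_x$ ($x\in F$) with $u_xu_y=\sum_g\sigma(g;x,y)e_gu_{xy}$, $u_xe_g=e_{g\triangleleft x^{-1}}u_x$, $\Delta(u_x)=\sum_{g,h}\tau(g,h;x)e_gu_{h\triangleright x}\otimes e_hu_x$, $\Delta(e_g)=\sum_he_{gh^{-1}}\otimes e_h$. For a finite-dimensional semisimple Hopf algebra $H$ over $\mathbb{C}$, $\nu_n(H) = \chi_H(\Lambda_{(1)}\cdots\Lambda_{(n)})$, where $\Lambda\in H$ is the integral with $\varepsilon(\Lambda)=1$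 (Sweedler notation) and $\chi_H$ is the character of the regular representation. *)

theory Defs
  imports
    Complex_Main
    "HOL-Library.Multiset"
    "HOL-Library.Function_Algebras"
    "HOL-Library.Poly_Mapping"
    "HOL-Library.Z2"
    "HOL-Computational_Algebra.Polynomial"
begin

section \<open>Tensors over the complex numbers\<close>

text \<open>
  An element of \<open>V \<otimes> W\<close> is represented by a finite formal sum of pure tensors, i.e. by a multiset of
  pairs: \<open>{#(a1,b1), (a2,b2), \<dots>#}\<close> stands for \<open>a1 \<otimes> b1 + a2 \<otimes> b2 + \<dots>\<close>. Two formal sums represent the
  same tensor iff all bilinear forms agree on them. (Over a field, complex-valued bilinear forms suffice;
  lemma \<open>tensor_eq_lift\<close> below gives the universal property for maps into an arbitrary space.)
  The same is done for \<open>V \<otimes> V \<otimes> V\<close> with triples.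
\<close>

definition bilinear_map ::
    "(complex \<Rightarrow> 'a::ab_group_add \<Rightarrow> 'a) \<Rightarrow> (complex \<Rightarrow> 'b::ab_group_add \<Rightarrow> 'b) \<Rightarrow>
     (complex \<Rightarrow> 'c::ab_group_add \<Rightarrow> 'c) \<Rightarrow> ('a \<Rightarrow> 'b \<Rightarrow> 'c) \<Rightarrow> bool" where
  "bilinear_map sV sW sU \<beta> \<longleftrightarrow>
     (\<forall>b. Vector_Spaces.linear sV sU (\<lambda>a. \<beta> a b)) \<and>
     (\<forall>a. Vector_Spaces.linear sW sU (\<lambda>b. \<beta> a b))"

definition tensor_eq ::
    "(complex \<Rightarrow> 'a::ab_group_add \<Rightarrow> 'a) \<Rightarrow> (complex \<Rightarrow> 'b::ab_group_add \<Rightarrow> 'b) \<Rightarrow>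
     ('a \<times> 'b) multiset \<Rightarrow> ('a \<times> 'b) multiset \<Rightarrow> bool" where
  "tensor_eq sV sW s t \<longleftrightarrow>
     (\<forall>\<beta>. bilinear_map sV sW (*) \<beta> \<longrightarrow> (\<Sum>(a,b)\<in>#s. \<beta> a b) = (\<Sum>(a,b)\<in>#t. \<beta> a b))"

definition trilinear_form ::
    "(complex \<Rightarrow> 'a::ab_group_add \<Rightarrow> 'a) \<Rightarrow> ('a \<Rightarrow> 'a \<Rightarrow> 'a \<Rightarrow> complex) \<Rightarrow> bool" where
  "trilinear_form sV \<gamma> \<longleftrightarrow>
     (\<forall>b c. Vector_Spaces.linear sV (*) (\<lambda>a. \<gamma> a b c)) \<and>
     (\<forall>a c. Vector_Spaces.linear sV (*) (\<lambda>b. \<gamma> a b c)) \<and>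
     (\<forall>a b. Vector_Spaces.linear sV (*) (\<lambda>c. \<gamma> a b c))"

definition tensor3_eq ::
    "(complex \<Rightarrow> 'a::ab_group_add \<Rightarrow> 'a) \<Rightarrow>
     ('a \<times> 'a \<times> 'a) multiset \<Rightarrow> ('a \<times> 'a \<times> 'a) multiset \<Rightarrow> bool" where
  "tensor3_eq sV s t \<longleftrightarrow>
     (\<forall>\<gamma>. trilinear_form sV \<gamma> \<longrightarrow> (\<Sum>(a,b,c)\<in>#s. \<gamma> a b c) = (\<Sum>(a,b,c)\<in>#t. \<gamma> a b c))"

lemma linear_compose_form:
  assumes "Vector_Spaces.linear s1 s2 f" "Vector_Spaces.linear s2 s3 g"
  shows "Vector_Spaces.linear s1 s3 (\<lambda>x. g (f x))"
  using Vector_Spaces.linear_compose[OF assms] by (simp add: o_def)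

lemma tensor_eq_lift:
  fixes sU :: "complex \<Rightarrow> 'c::ab_group_add \<Rightarrow> 'c"
  assumes eq: "tensor_eq sV sW s t" and bil: "bilinear_map sV sW sU \<beta>"
  shows "(\<Sum>(a,b)\<in>#s. \<beta> a b) = (\<Sum>(a,b)\<in>#t. \<beta> a b)"
proof -
  have "Vector_Spaces.linear sV sU (\<lambda>a. \<beta> a 0)" using bil by (simp add: bilinear_map_def)
  then interpret U: vector_space sU by (simp add: Vector_Spaces.linear_def)
  define B where "B = U.extend_basis {}"
  have ind: "U.independent B" and sp: "U.span B = UNIV"
    unfolding B_def using U.independent_extend_basis[OF U.independent_empty]
      U.span_extend_basis[OF U.independent_empty] by auto
  have lin: "Vector_Spaces.linear sU (*) (\<lambda>v. U.representation B v b)" for b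
    by (rule U.linear_representation[OF ind sp])
  have rep: "U.representation B (\<Sum>(x,y)\<in>#m. \<beta> x y) b = (\<Sum>(x,y)\<in>#m. U.representation B (\<beta> x y) b)"
    for m b
    by (induction m)
      (auto simp: U.representation_zero U.representation_add[OF ind] sp)
  have "bilinear_map sV sW (*) (\<lambda>x y. U.representation B (\<beta> x y) b)" for b
    unfolding bilinear_map_def
  proof (intro conjI allI)
    show "Vector_Spaces.linear sV (*) (\<lambda>x. U.representation B (\<beta> x y) b)" for y
      by (rule linear_compose_form[OF _ lin]) (use bil in \<open>simp add: bilinear_map_def\<close>)
    show "Vector_Spaces.linear sW (*) (\<lambda>y. U.representation B (\<beta> x y) b)" for x
      by (rule linear_compose_form[OF _ lin]) (use bil in \<open>simp add: bilinear_map_def\<close>)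
  qed
  then have form: "(\<Sum>(x,y)\<in>#s. U.representation B (\<beta> x y) b) = (\<Sum>(x,y)\<in>#t. U.representation B (\<beta> x y) b)" for b
    using eq unfolding tensor_eq_def by blast
  have e: "U.representation B (\<Sum>(a,b)\<in>#s. \<beta> a b) = U.representation B (\<Sum>(a,b)\<in>#t. \<beta> a b)"
    by (rule ext) (simp only: rep form)
  have recover: "v = (\<Sum>b | U.representation B v b \<noteq> 0. sU (U.representation B v b) b)" for v
    by (rule U.sum_nonzero_representation_eq[OF ind, symmetric]) (simp add: sp)
  show ?thesis
    by (subst (1 2) recover) (simp only: e)
qed

section \<open>Finite-dimensional Hopf algebras\<close>

text \<open>
  The multiplication and unit are those of the class \<^class>\<open>ring_1\<close>; the record carries the remaining
  structure. The value \<open>comul H x\<close> is a chosen formal sum representing \<open>\<Delta>(x)\<close>, so a sum over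
  \<open>(a,b) \<in># comul H x\<close> is a Sweedler sum over \<open>x\<^sub>(\<^sub>1\<^sub>) \<otimes> x\<^sub>(\<^sub>2\<^sub>)\<close>.
\<close>

record 'a hopf =
  hscale :: "complex \<Rightarrow> 'a \<Rightarrow> 'a"
  comul :: "'a \<Rightarrow> ('a \<times> 'a) multiset"
  counit :: "'a \<Rightarrow> complex"
  antipode :: "'a \<Rightarrow> 'a"

locale hopf_algebra = vector_space "hscale H" for H :: "'a::ring_1 hopf" +
  assumes finite_dimensional: "\<exists>B. finite B \<and> module.span (hscale H) B = UNIV"
    and scale_mult_left: "hscale H c x * y = hscale H c (x * y)"
    and scale_mult_right: "x * hscale H c y = hscale H c (x * y)"
    and comul_add: "tensor_eq (hscale H) (hscale H) (comul H (x + y)) (comul H x + comul H y)"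
    and comul_scale: "tensor_eq (hscale H) (hscale H) (comul H (hscale H c x))
          (image_mset (\<lambda>(a,b). (hscale H c a, b)) (comul H x))"
    and coassoc: "tensor3_eq (hscale H)
          (\<Sum>(a,b)\<in>#comul H x. image_mset (\<lambda>(a1,a2). (a1, a2, b)) (comul H a))
          (\<Sum>(a,b)\<in>#comul H x. image_mset (\<lambda>(b1,b2). (a, b1, b2)) (comul H b))"
    and counit_linear: "Vector_Spaces.linear (hscale H) (*) (counit H)"
    and counit_left: "(\<Sum>(a,b)\<in>#comul H x. hscale H (counit H a) b) = x"
    and counit_right: "(\<Sum>(a,b)\<in>#comul H x. hscale H (counit H b) a) = x"
    and comul_mult: "tensor_eq (hscale H) (hscale H) (comul H (x * y))
          (\<Sum>(a,b)\<in>#comul H x. image_mset (\<lambda>(c,d). (a * c, b * d)) (comul H y))"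
    and comul_one: "tensor_eq (hscale H) (hscale H) (comul H 1) {#(1, 1)#}"
    and counit_mult: "counit H (x * y) = counit H x * counit H y"
    and counit_one: "counit H 1 = 1"
    and antipode_linear: "Vector_Spaces.linear (hscale H) (hscale H) (antipode H)"
    and antipode_left: "(\<Sum>(a,b)\<in>#comul H x. antipode H a * b) = hscale H (counit H x) 1"
    and antipode_right: "(\<Sum>(a,b)\<in>#comul H x. a * antipode H b) = hscale H (counit H x) 1"

definition hopf_hom :: "'a::ring_1 hopf \<Rightarrow> 'b::ring_1 hopf \<Rightarrow> ('a \<Rightarrow> 'b) \<Rightarrow> bool" where
  "hopf_hom A B f \<longleftrightarrow>
     Vector_Spaces.linear (hscale A) (hscale B) f \<and>
     (\<forall>x y. f (x * y) = f x * f y) \<and> f 1 = 1 \<and>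
     (\<forall>x. tensor_eq (hscale B) (hscale B) (comul B (f x)) (image_mset (map_prod f f) (comul A x))) \<and>
     (\<forall>x. counit B (f x) = counit A x) \<and>
     (\<forall>x. f (antipode A x) = antipode B (f x))"

text \<open>
  Short exact sequence \<open>1 \<rightarrow> K \<rightarrow> A \<rightarrow> B \<rightarrow> 1\<close> via \<open>\<iota>\<close> and \<open>\<pi>\<close>: \<open>\<iota>\<close> injective, \<open>\<pi>\<close> surjective,
  \<open>ker \<pi> = A \<iota>(K)\<^sup>+\<close> with \<open>K\<^sup>+ = ker \<epsilon>\<close>, and \<open>\<iota>(K)\<close> is the space of \<open>\<pi>\<close>-coinvariants, i.e. of
  all \<open>a\<close> with \<open>(id \<otimes> \<pi>)(\<Delta> a) = a \<otimes> 1\<close>.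
\<close>

definition exact_hopf_sequence ::
    "'k::ring_1 hopf \<Rightarrow> ('k \<Rightarrow> 'a) \<Rightarrow> 'a::ring_1 hopf \<Rightarrow> ('a \<Rightarrow> 'b) \<Rightarrow> 'b::ring_1 hopf \<Rightarrow> bool" where
  "exact_hopf_sequence K \<iota> A \<pi> B \<longleftrightarrow>
     hopf_algebra K \<and> hopf_algebra A \<and> hopf_algebra B \<and>
     hopf_hom K A \<iota> \<and> hopf_hom A B \<pi> \<and> inj \<iota> \<and> surj \<pi> \<and>
     {a. \<pi> a = 0} = module.span (hscale A) {a * \<iota> k |a k. counit K k = 0} \<and>
     range \<iota> = {a. tensor_eq (hscale A) (hscale B)
                       (image_mset (map_prod id \<pi>) (comul A a)) {#(a, 1)#}}"

section \<open>Group algebras and their duals\<close>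

text \<open>
  A group is a type of class \<^class>\<open>group_add\<close>, which does not assume commutativity: \<open>g + h\<close>, \<open>0\<close> and
  \<open>- g\<close> are the group multiplication, unit and inverse. The algebra \<open>\<complex>\<^sup>G\<close> is \<^typ>\<open>'g \<Rightarrow> complex\<close> with pointwise
  operations; the group algebra \<open>\<complex>F\<close> is \<^typ>\<open>'f \<Rightarrow>\<^sub>0 complex\<close> with convolution.
\<close>

definition point_mass :: "'g \<Rightarrow> 'g \<Rightarrow> complex" where
  "point_mass g = (\<lambda>h. if h = g then 1 else 0)"

text \<open>\<open>\<Delta>(f) = \<Sum>\<^sub>g\<^sub>,\<^sub>h f(gh) e\<^sub>g \<otimes> e\<^sub>h\<close>, equivalently \<open>\<Delta>(e\<^sub>g) = \<Sum>\<^sub>h e\<^bsub>gh\<^sup>-\<^sup>1\<^esub> \<otimes> e\<^sub>h\<close>.\<close>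

definition dual_group_algebra :: "('g::{group_add,finite} \<Rightarrow> complex) hopf" where
  "dual_group_algebra = \<lparr>
     hscale = (\<lambda>c f g. c * f g),
     comul = (\<lambda>f. image_mset (\<lambda>(g,h). ((\<lambda>k. f (g + h) * point_mass g k), point_mass h)) (mset_set UNIV)),
     counit = (\<lambda>f. f 0),
     antipode = (\<lambda>f g. f (- g)) \<rparr>"

definition group_algebra :: "('f::{group_add,finite} \<Rightarrow>\<^sub>0 complex) hopf" where
  "group_algebra = \<lparr>
     hscale = (\<lambda>c p. Poly_Mapping.single 0 c * p),
     comul = (\<lambda>p. image_mset (\<lambda>x. (Poly_Mapping.single x (Poly_Mapping.lookup p x),
                                     Poly_Mapping.single x 1)) (mset_set UNIV)),
     counit = (\<lambda>p. \<Sum>x\<in>UNIV. Poly_Mapping.lookup p x),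
     antipode = (\<lambda>p. \<Sum>x\<in>UNIV. Poly_Mapping.single (- x) (Poly_Mapping.lookup p x)) \<rparr>"

instance bit :: finite
proof
  have "(UNIV :: bit set) = {0, 1}" by auto
  then show "finite (UNIV :: bit set)" by (metis finite.emptyI finite.insertI)
qed

subsection \<open>The two standard examples are Hopf algebras\<close>

lemma linear_iff':
  "Vector_Spaces.linear s1 s2 f \<longleftrightarrow> vector_space s1 \<and> vector_space s2 \<and>
     (\<forall>x y. f (x + y) = f x + f y) \<and> (\<forall>c x. f (s1 c x) = s2 c (f x))"
  by (auto simp: Vector_Spaces.linear_def module_hom_iff vector_space_def module_def)

lemma vector_space_complex: "vector_space ((*) :: complex \<Rightarrow> complex \<Rightarrow> complex)"
  by unfold_locales (auto simp: algebra_simps)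

lemma bilinear_mapD:
  assumes "bilinear_map sV sW sU \<beta>"
  shows "\<beta> (a + a') b = \<beta> a b + \<beta> a' b" "\<beta> (sV c a) b = sU c (\<beta> a b)"
    "\<beta> a (b + b') = \<beta> a b + \<beta> a b'" "\<beta> a (sW c b) = sU c (\<beta> a b)"
    "\<beta> 0 b = 0" "\<beta> a 0 = 0"
proof -
  have l: "Vector_Spaces.linear sV sU (\<lambda>a. \<beta> a b)" "Vector_Spaces.linear sW sU (\<beta> a)" for a b
    using assms by (auto simp: bilinear_map_def)
  show "\<beta> (a + a') b = \<beta> a b + \<beta> a' b" "\<beta> (sV c a) b = sU c (\<beta> a b)"
    "\<beta> a (b + b') = \<beta> a b + \<beta> a b'" "\<beta> a (sW c b) = sU c (\<beta> a b)"
    using l(1)[of b] l(2)[of a] unfolding linear_iff' by blast+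
  show "\<beta> 0 b = 0" "\<beta> a 0 = 0"
    using l(1)[of b] l(2)[of a] unfolding linear_iff' by (metis add_cancel_right_left)+
qed

lemma trilinear_formD:
  assumes "trilinear_form sV \<gamma>"
  shows "\<gamma> (sV k a) b c = k * \<gamma> a b c" "\<gamma> a (sV k b) c = k * \<gamma> a b c" "\<gamma> a b (sV k c) = k * \<gamma> a b c"
  using assms by (auto simp: trilinear_form_def linear_iff')

lemma bilinear_map_sum:
  assumes "bilinear_map sV sW sU \<beta>"
  shows "\<beta> (\<Sum>i\<in>I. f i) b = (\<Sum>i\<in>I. \<beta> (f i) b)" "\<beta> a (\<Sum>i\<in>I. g i) = (\<Sum>i\<in>I. \<beta> a (g i))"
  by (induction I rule: infinite_finite_induct; simp add: bilinear_mapD[OF assms])+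

lemma sum_mset_nested:
  "(\<Sum>z\<in>#(\<Sum>p\<in>#M. image_mset (G p) (N p)). F z) = (\<Sum>p\<in>#M. \<Sum>w\<in>#N p. F (G p w))"
  by (induction M) (auto simp: image_mset.compositionality o_def)

lemma comul_dual_group_algebra_sum:
  "(\<Sum>(a,b)\<in>#comul dual_group_algebra f. F a b) =
   (\<Sum>g\<in>UNIV. \<Sum>h\<in>UNIV. F (hscale dual_group_algebra (f (g + h)) (point_mass g)) (point_mass h))"
  by (simp add: dual_group_algebra_def image_mset.compositionality o_def case_prod_unfold
      sum_unfold_sum_mset[symmetric] sum.cartesian_product)

lemma point_mass_simps:
  "point_mass g * point_mass h = (if g = h then point_mass g else 0)"
  by (auto simp: point_mass_def fun_eq_iff)

lemma vector_space_dual_group_algebra: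
  "vector_space (hscale (dual_group_algebra :: ('g::{group_add,finite} \<Rightarrow> complex) hopf))"
  by unfold_locales (auto simp: dual_group_algebra_def fun_eq_iff algebra_simps)

lemma sum_fun_apply: "(\<Sum>i\<in>I. f i) x = (\<Sum>i\<in>I. f i x)" for f :: "'i \<Rightarrow> 'a \<Rightarrow> complex"
  by (induction I rule: infinite_finite_induct) auto

lemma sum_times_point_mass:
  "(\<Sum>g\<in>UNIV. A g * point_mass g (c::'g::finite)) = A c" (is ?A)
  "(\<Sum>g\<in>UNIV. point_mass g c * A g) = A c" (is ?B)
  "(\<Sum>g\<in>UNIV. A g * point_mass g c * B g) = A c * B c" (is ?C)
  "(\<Sum>g\<in>UNIV. point_mass g c * A g * B g) = A c * B c" (is ?D)
proof -
  have *: "A g * point_mass g c = (if g = c then A g else 0)" for g and A :: "'g \<Rightarrow> complex"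
    by (auto simp: point_mass_def)
  show ?A unfolding * by simp
  show ?B unfolding mult.commute[of "point_mass _ _"] * by simp
  have "A g * point_mass g c * B g = (if g = c then A g * B g else 0)" for g
    by (auto simp: point_mass_def)
  then show ?C and ?D by (simp_all add: mult.commute[of "point_mass _ _"])
qed

lemma fun_expand:
  "f = (\<Sum>g\<in>UNIV. hscale dual_group_algebra (f g) (point_mass (g::'g::{group_add,finite})))"
  by (auto simp: fun_eq_iff sum_fun_apply dual_group_algebra_def sum_times_point_mass)

lemma sum_expand_single:
  "p = (\<Sum>x\<in>UNIV. Poly_Mapping.single x (Poly_Mapping.lookup p (x::'f::finite)))"
  by (rule poly_mapping_eqI) (simp add: lookup_sum lookup_single when_def)

lemma hopf_algebra_dual_group_algebra:
  "hopf_algebra (dual_group_algebra :: ('g::{group_add,finite} \<Rightarrow> complex) hopf)"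
proof -
  define D where "D = (dual_group_algebra :: ('g \<Rightarrow> complex) hopf)"
  interpret vector_space "hscale D" unfolding D_def by (rule vector_space_dual_group_algebra)
  have S: "hscale D c f k = c * f k" for c f k by (simp add: D_def dual_group_algebra_def)
  have S': "hscale D c f = (\<lambda>k. c * f k)" for c f by (simp add: D_def dual_group_algebra_def)
  have cou: "counit D f = f 0" for f by (simp add: D_def dual_group_algebra_def)
  have ant: "antipode D f = (\<lambda>g. f (- g))" for f by (simp add: D_def dual_group_algebra_def)
  have C: "(\<Sum>(a,b)\<in>#comul D f. F a b) =
      (\<Sum>g\<in>UNIV. \<Sum>h\<in>UNIV. F (hscale D (f (g + h)) (point_mass g)) (point_mass h))" for f and F :: "_ \<Rightarrow> _ \<Rightarrow> 'x::comm_monoid_add"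
    unfolding D_def by (rule comul_dual_group_algebra_sum)
  have C': "(\<Sum>z\<in>#comul D f. F z) =
      (\<Sum>g\<in>UNIV. \<Sum>h\<in>UNIV. F (hscale D (f (g + h)) (point_mass g), point_mass h))" for f and F :: "_ \<Rightarrow> 'x::comm_monoid_add"
    using C[of "\<lambda>a b. F (a, b)" f] by simp
  have E: "f = (\<Sum>g\<in>UNIV. hscale D (f g) (point_mass g))" for f
    unfolding D_def by (rule fun_expand)
  have "(\<Sum>g\<in>UNIV. hscale D (f g) (point_mass g)) \<in> span (range point_mass)" for f
    by (intro span_sum span_scale span_base) auto
  then have sp: "span (range point_mass) = UNIV" using E by (metis UNIV_eq_I)
  show ?thesis unfolding D_def[symmetric]
  proof (intro hopf_algebra.intro hopf_algebra_axioms.intro, goal_cases)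
    case 1 show ?case by (rule vector_space_axioms)
  next case 2 show ?case using sp by (intro exI[of _ "range point_mass"]) auto
  next case 3 show ?case by (simp add: fun_eq_iff S)
  next case 4 show ?case by (simp add: fun_eq_iff S)
  next case (5 x y) show ?case unfolding tensor_eq_def
      by (auto simp: C bilinear_mapD algebra_simps sum.distrib)
  next case (6 c x) show ?case unfolding tensor_eq_def
      by (auto simp: C' S bilinear_mapD image_mset.compositionality o_def
        case_prod_unfold sum_distrib_left mult_ac)
  next case (7 x)
    show ?case unfolding tensor3_eq_def
    proof (intro allI impI)
      fix \<gamma> assume t: "trilinear_form (hscale D) \<gamma>"
      note [simp] = trilinear_formD[OF t]
      have "(\<Sum>(a,b,c)\<in>#(\<Sum>(a,b)\<in>#comul D x. image_mset (\<lambda>(a1,a2). (a1, a2, b)) (comul D a)). \<gamma> a b c)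
          = (\<Sum>(a,b)\<in>#comul D x. \<Sum>(a1,a2)\<in>#comul D a. \<gamma> a1 a2 b)"
        by (simp add: case_prod_unfold sum_mset_nested)
      also have "\<dots> = (\<Sum>g\<in>UNIV. \<Sum>h\<in>UNIV. \<Sum>g'\<in>UNIV. \<Sum>h'\<in>UNIV.
             x (g + h) * point_mass g (g' + h') * \<gamma> (point_mass g') (point_mass h') (point_mass h))"
        by (simp add: C S mult_ac)
      also have "\<dots> = (\<Sum>h\<in>UNIV. \<Sum>g\<in>UNIV. \<Sum>g'\<in>UNIV. \<Sum>h'\<in>UNIV.
             x (g + h) * point_mass g (g' + h') * \<gamma> (point_mass g') (point_mass h') (point_mass h))"
        by (rule sum.swap)
      also have "\<dots> = (\<Sum>h\<in>UNIV. \<Sum>g'\<in>UNIV. \<Sum>g\<in>UNIV. \<Sum>h'\<in>UNIV.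
             x (g + h) * point_mass g (g' + h') * \<gamma> (point_mass g') (point_mass h') (point_mass h))"
        by (rule sum.cong[OF refl], rule sum.swap)
      also have "\<dots> = (\<Sum>h\<in>UNIV. \<Sum>g'\<in>UNIV. \<Sum>h'\<in>UNIV. \<Sum>g\<in>UNIV.
             x (g + h) * point_mass g (g' + h') * \<gamma> (point_mass g') (point_mass h') (point_mass h))"
        by (rule sum.cong[OF refl], rule sum.cong[OF refl], rule sum.swap)
      also have "\<dots> = (\<Sum>h\<in>UNIV. \<Sum>g'\<in>UNIV. \<Sum>h'\<in>UNIV.
             x (g' + h' + h) * \<gamma> (point_mass g') (point_mass h') (point_mass h))"
        by (simp add: sum_times_point_mass)
      also have "\<dots> = (\<Sum>g\<in>UNIV. \<Sum>h\<in>UNIV. \<Sum>h'\<in>UNIV.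
             x (g + h' + h) * \<gamma> (point_mass g) (point_mass h') (point_mass h))"
        by (rule sum.swap)
      also have "\<dots> = (\<Sum>g\<in>UNIV. \<Sum>h'\<in>UNIV. \<Sum>h\<in>UNIV.
             x (g + h' + h) * \<gamma> (point_mass g) (point_mass h') (point_mass h))"
        by (rule sum.cong[OF refl], rule sum.swap)
      also have "\<dots> = (\<Sum>g\<in>UNIV. \<Sum>g'\<in>UNIV. \<Sum>h'\<in>UNIV. \<Sum>h\<in>UNIV.
             x (g + h) * point_mass h (g' + h') * \<gamma> (point_mass g) (point_mass g') (point_mass h'))"
        by (simp add: sum_times_point_mass add.assoc)
      also have "\<dots> = (\<Sum>g\<in>UNIV. \<Sum>g'\<in>UNIV. \<Sum>h\<in>UNIV. \<Sum>h'\<in>UNIV.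
             x (g + h) * point_mass h (g' + h') * \<gamma> (point_mass g) (point_mass g') (point_mass h'))"
        by (rule sum.cong[OF refl], rule sum.cong[OF refl], rule sum.swap)
      also have "\<dots> = (\<Sum>g\<in>UNIV. \<Sum>h\<in>UNIV. \<Sum>g'\<in>UNIV. \<Sum>h'\<in>UNIV.
             x (g + h) * point_mass h (g' + h') * \<gamma> (point_mass g) (point_mass g') (point_mass h'))"
        by (rule sum.cong[OF refl], rule sum.swap)
      also have "\<dots> = (\<Sum>(a,b)\<in>#comul D x. \<Sum>(b1,b2)\<in>#comul D b. \<gamma> a b1 b2)"
        by (simp add: C S sum_distrib_left mult_ac)
      also have "\<dots> = (\<Sum>(a,b,c)\<in>#(\<Sum>(a,b)\<in>#comul D x. image_mset (\<lambda>(b1,b2). (a, b1, b2)) (comul D b)). \<gamma> a b c)"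
        by (simp add: case_prod_unfold sum_mset_nested)
      finally show "(\<Sum>(a,b,c)\<in>#(\<Sum>(a,b)\<in>#comul D x. image_mset (\<lambda>(a1,a2). (a1, a2, b)) (comul D a)). \<gamma> a b c) =
        (\<Sum>(a,b,c)\<in>#(\<Sum>(a,b)\<in>#comul D x. image_mset (\<lambda>(b1,b2). (a, b1, b2)) (comul D b)). \<gamma> a b c)" .
    qed
  next case 8 show ?case
      by (auto simp: linear_iff' cou S vector_space_axioms vector_space_complex)
  next case (9 x)
    show ?case by (simp add: fun_eq_iff C cou S' sum_fun_apply sum_times_point_mass)
  next case (10 x)
    show ?case by (simp add: fun_eq_iff C cou S' sum_fun_apply sum_times_point_mass)
  next case (11 x y)
    show ?case unfolding tensor_eq_def
    proof (intro allI impI)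
      fix \<beta> :: "('g \<Rightarrow> complex) \<Rightarrow> ('g \<Rightarrow> complex) \<Rightarrow> complex"
      assume b: "bilinear_map (hscale D) (hscale D) (*) \<beta>"
      note [simp] = bilinear_mapD[OF b]
      have bp: "\<beta> (hscale D c (point_mass g) * hscale D d (point_mass g')) (point_mass h * point_mass h') =
         (if h' = h then if g' = g then c * d * \<beta> (point_mass g) (point_mass h) else 0 else 0)" for c d g g' h h'
      proof -
        have "hscale D c (point_mass g) * hscale D d (point_mass g') =
              hscale D (c * d) (point_mass g * point_mass g')"
          by (simp add: fun_eq_iff S)
        then show ?thesis by (simp add: point_mass_simps)
      qed
      show "(\<Sum>(a,b)\<in>#comul D (x * y). \<beta> a b) =
        (\<Sum>(a,b)\<in>#(\<Sum>(a,b)\<in>#comul D x. image_mset (\<lambda>(c,d). (a * c, b * d)) (comul D y)). \<beta> a b)"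
        by (simp add: case_prod_unfold sum_mset_nested) (simp add: C' bp)
    qed
  next case 12
    show ?case unfolding tensor_eq_def
    proof (intro allI impI)
      fix \<beta> :: "('g \<Rightarrow> complex) \<Rightarrow> ('g \<Rightarrow> complex) \<Rightarrow> complex"
      assume b: "bilinear_map (hscale D) (hscale D) (*) \<beta>"
      have one: "(1::'g \<Rightarrow> complex) = (\<Sum>g\<in>UNIV. point_mass g)"
        by (simp add: fun_eq_iff sum_fun_apply point_mass_def)
      show "(\<Sum>(a,b)\<in>#comul D 1. \<beta> a b) = (\<Sum>(a,b)\<in>#{#(1, 1)#}. \<beta> a b)"
      proof -
        have "\<beta> 1 1 = (\<Sum>g\<in>UNIV. \<Sum>h\<in>UNIV. \<beta> (point_mass g) (point_mass h))"
          unfolding one bilinear_map_sum[OF b] by (rule sum.swap)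
        then show ?thesis by (simp add: C bilinear_mapD[OF b])
      qed
    qed
  next case 13 show ?case by (simp add: cou)
  next case 14 show ?case by (simp add: cou)
  next case 15 show ?case
      by (auto simp: linear_iff' ant S fun_eq_iff vector_space_axioms)
  next case (16 x)
    show ?case by (simp add: fun_eq_iff C cou ant S' sum_fun_apply sum_times_point_mass)
  next case (17 x)
    show ?case by (simp add: fun_eq_iff C cou ant S' sum_fun_apply sum_times_point_mass)
  qed
qed

lemma lookup_scale_single:
  "Poly_Mapping.lookup (Poly_Mapping.single 0 c * p) x = c * Poly_Mapping.lookup p (x::'f::{group_add,finite})"
  for c :: complex
proof -
  have "Poly_Mapping.single 0 c * p = (\<Sum>y\<in>UNIV. Poly_Mapping.single y (c * Poly_Mapping.lookup p y))"
    by (subst sum_expand_single[of p]) (simp add: sum_distrib_left mult_single)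
  then show ?thesis by (simp add: lookup_sum lookup_single when_def)
qed

lemma hopf_algebra_group_algebra:
  "hopf_algebra (group_algebra :: ('f::{group_add,finite} \<Rightarrow>\<^sub>0 complex) hopf)"
proof -
  define A where "A = (group_algebra :: ('f \<Rightarrow>\<^sub>0 complex) hopf)"
  define e :: "'f \<Rightarrow> 'f \<Rightarrow>\<^sub>0 complex" where "e x = Poly_Mapping.single x 1" for x
  let ?l = "Poly_Mapping.lookup :: ('f \<Rightarrow>\<^sub>0 complex) \<Rightarrow> _"
  have S: "hscale A c p = Poly_Mapping.single 0 c * p" for c p by (simp add: A_def group_algebra_def)
  have l: "?l (hscale A c p) x = c * ?l p x" for c p x by (simp add: S lookup_scale_single)
  have le: "?l (e x) y = point_mass y x" for x y by (simp add: e_def point_mass_def lookup_single when_def)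
  have ee: "e x * e y = e (x + y)" for x y by (simp add: e_def mult_single)
  have e0: "e 0 = 1" by (simp add: e_def)
  have sgl: "Poly_Mapping.single x c = hscale A c (e x)" for x c by (simp add: S e_def mult_single)
  have E: "p = (\<Sum>x\<in>UNIV. hscale A (?l p x) (e x))" for p
    unfolding sgl[symmetric] by (rule sum_expand_single)
  interpret vector_space "hscale A"
    by unfold_locales (auto simp: l lookup_add algebra_simps intro!: poly_mapping_eqI)
  have lr: "hscale A c p * q = hscale A c (p * q)" for c p q by (simp add: S mult.assoc)
  have rr: "q * hscale A c p = hscale A c (q * p)" for c p q
  proof -
    have "q * Poly_Mapping.single 0 c = Poly_Mapping.single 0 c * q"
      by (subst (1 2) sum_expand_single[of q]) (simp add: sum_distrib_left sum_distrib_right mult_single mult.commute)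
    then show ?thesis by (simp add: S mult.assoc[symmetric])
  qed
  have cou: "counit A p = (\<Sum>x\<in>UNIV. ?l p x)" for p by (simp add: A_def group_algebra_def)
  have ce: "counit A (e x) = 1" for x
    using sum_times_point_mass(1)[of "\<lambda>_. 1" x] by (simp add: cou le)
  have cs: "counit A (hscale A c (e x)) = c" for c x
    by (simp add: cou l le sum_times_point_mass)
  have ant: "antipode A p = (\<Sum>x\<in>UNIV. hscale A (?l p x) (e (- x)))" for p
    unfolding sgl[symmetric] by (simp add: A_def group_algebra_def)
  have C: "(\<Sum>z\<in>#comul A p. F z) = (\<Sum>x\<in>UNIV. F (hscale A (?l p x) (e x), e x))"
    for p and F :: "_ \<Rightarrow> 'x::comm_monoid_add"
    by (simp add: sgl[symmetric] e_def) (simp add: A_def group_algebra_def mult_single image_mset.compositionality o_def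
      sum_unfold_sum_mset[symmetric])
  have lm: "(\<Sum>z\<in>UNIV. ?l (p * q) z * b z) = (\<Sum>x\<in>UNIV. \<Sum>y\<in>UNIV. ?l p x * ?l q y * b (x + y))" for p q b
  proof -
    have "p * q = (\<Sum>x\<in>UNIV. \<Sum>y\<in>UNIV. hscale A (?l p x * ?l q y) (e (x + y)))"
      by (subst E[of p], subst E[of q]) (simp add: sum_product lr rr ee mult.commute)
    then have "(\<Sum>z\<in>UNIV. ?l (p * q) z * b z) =
      (\<Sum>z\<in>UNIV. \<Sum>x\<in>UNIV. \<Sum>y\<in>UNIV. ?l p x * ?l q y * point_mass z (x + y) * b z)"
      by (simp add: lookup_sum l le sum_distrib_right)
    also have "\<dots> = (\<Sum>x\<in>UNIV. \<Sum>z\<in>UNIV. \<Sum>y\<in>UNIV. ?l p x * ?l q y * point_mass z (x + y) * b z)"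
      by (rule sum.swap)
    also have "\<dots> = (\<Sum>x\<in>UNIV. \<Sum>y\<in>UNIV. \<Sum>z\<in>UNIV. ?l p x * ?l q y * point_mass z (x + y) * b z)"
      by (rule sum.cong[OF refl], rule sum.swap)
    also have "\<dots> = (\<Sum>x\<in>UNIV. \<Sum>y\<in>UNIV. ?l p x * ?l q y * b (x + y))"
      by (simp add: sum_times_point_mass)
    finally show ?thesis .
  qed
  have "(\<Sum>x\<in>UNIV. hscale A (?l p x) (e x)) \<in> span (range e)" for p
    by (intro span_sum span_scale span_base) auto
  then have sp: "span (range e) = UNIV" using E by (metis UNIV_eq_I)
  show ?thesis unfolding A_def[symmetric]
  proof (intro hopf_algebra.intro hopf_algebra_axioms.intro, goal_cases)
    case 1 show ?case by (rule vector_space_axioms)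
  next case 2 show ?case using sp by (intro exI[of _ "range e"]) auto
  next case 3 show ?case by (rule lr)
  next case 4 show ?case by (rule rr)
  next case (5 x y) show ?case unfolding tensor_eq_def
      by (auto simp: case_prod_unfold C lookup_add bilinear_mapD algebra_simps sum.distrib)
  next case (6 c x) show ?case unfolding tensor_eq_def
      by (auto simp: C l bilinear_mapD image_mset.compositionality o_def case_prod_unfold
        sum_distrib_left mult_ac)
  next case (7 x) show ?case unfolding tensor3_eq_def
      by (simp add: case_prod_unfold sum_mset_nested)
        (auto simp: C l le trilinear_formD mult.assoc[symmetric] sum_times_point_mass)
  next case 8 show ?case
      by (auto simp: linear_iff' cou l lookup_add sum.distrib sum_distrib_left vector_space_axioms vector_space_complex)
  next case (9 x)
    show ?case by (rule trans[OF _ E[symmetric]]) (simp add: case_prod_unfold C cs ce)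
  next case (10 x)
    show ?case by (rule trans[OF _ E[symmetric]]) (simp add: case_prod_unfold C cs ce)
  next case (11 x y)
    show ?case unfolding tensor_eq_def
      apply (simp add: case_prod_unfold sum_mset_nested)
      apply (auto simp: C lr rr ee bilinear_mapD lm)
      apply (simp add: mult_ac)
      done
  next case 12
    have "?l 1 z = point_mass z 0" for z by (simp add: e0[symmetric] le)
    then show ?case unfolding tensor_eq_def
      by (auto simp: case_prod_unfold C bilinear_mapD sum_times_point_mass e0)
  next case (13 x y) show ?case using lm[of x y "\<lambda>_. 1"] by (simp add: cou sum_product)
  next case 14 show ?case
      by (simp add: cou e0[symmetric] le) (simp add: point_mass_def)
  next case 15 show ?case
      by (auto simp: linear_iff' ant l lookup_add scale_left_distrib scale_sum_right sum.distrib vector_space_axioms)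
  next
    have ae: "antipode A (hscale A c (e x)) = hscale A c (e (- x))" for c x
    proof -
      have "antipode A (hscale A c (e x)) = (\<Sum>y\<in>UNIV. if y = x then hscale A c (e (- x)) else 0)"
        unfolding ant by (intro sum.cong) (auto simp: l le point_mass_def)
      then show ?thesis by simp
    qed
    have ae': "antipode A (e x) = e (- x)" for x using ae[of 1 x] by simp
    {
      case (16 x)
      show ?case by (simp add: case_prod_unfold C ae lr ee e0 cou scale_sum_left)
    next
      case (17 x)
      show ?case by (simp add: case_prod_unfold C ae' lr ee e0 cou scale_sum_left)
    }
  qed
qed

section \<open>Semisimplicity, integrals and higher Frobenius--Schur indicators\<close>

definition left_ideal :: "'a::ring_1 set \<Rightarrow> bool" where
  "left_ideal I \<longleftrightarrow> 0 \<in> I \<and> (\<forall>x\<in>I. \<forall>y\<in>I. x + y \<in> I) \<and> (\<forall>r. \<forall>x\<in>I. r * x \<in> I)"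

text \<open>The regular left module is semisimple: every submodule is a direct summand.\<close>

definition semisimple_ring :: "'a::ring_1 itself \<Rightarrow> bool" where
  "semisimple_ring _ \<longleftrightarrow>
     (\<forall>I :: 'a set. left_ideal I \<longrightarrow>
        (\<exists>J. left_ideal J \<and> I \<inter> J = {0} \<and> (\<forall>x. \<exists>a\<in>I. \<exists>b\<in>J. x = a + b)))"

definition is_normalized_integral :: "'a::ring_1 hopf \<Rightarrow> 'a \<Rightarrow> bool" where
  "is_normalized_integral H L \<longleftrightarrow>
     (\<forall>h. h * L = hscale H (counit H h) L) \<and>
     (\<forall>h. L * h = hscale H (counit H h) L) \<and>
     counit H L = 1"

definition normalized_integral :: "'a::ring_1 hopf \<Rightarrow> 'a" where
  "normalized_integral H = (THE L. is_normalized_integral H L)"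

definition linear_trace :: "(complex \<Rightarrow> 'a::ab_group_add \<Rightarrow> 'a) \<Rightarrow> ('a \<Rightarrow> 'a) \<Rightarrow> complex" where
  "linear_trace s f =
     (let B = (SOME B. \<not> module.dependent s B \<and> module.span s B = UNIV)
      in \<Sum>b\<in>B. module.representation s B (f b) b)"

definition regular_character :: "'a::ring_1 hopf \<Rightarrow> 'a \<Rightarrow> complex" where
  "regular_character H a = linear_trace (hscale H) (\<lambda>x. a * x)"

text \<open>
  \<open>iterated_comul H n x\<close> represents the \<open>n\<close>-fold iterated coproduct
  \<open>x\<^sub>(\<^sub>1\<^sub>) \<otimes> \<dots> \<otimes> x\<^bsub>(n+1)\<^esub>\<close>; a list is a pure tensor, with \<^term>\<open>Suc n\<close> factors here.
\<close>

primrec iterated_comul :: "'a hopf \<Rightarrow> nat \<Rightarrow> 'a \<Rightarrow> 'a list multiset" where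
  "iterated_comul H 0 x = {#[x]#}"
| "iterated_comul H (Suc n) x =
     (\<Sum>(a,b)\<in>#comul H x. image_mset (\<lambda>l. a # l) (iterated_comul H n b))"

text \<open>\<open>x\<^sub>(\<^sub>1\<^sub>) \<cdots> x\<^bsub>(n)\<^esub>\<close>; meaningful for \<open>n \<ge> 1\<close> only.\<close>

definition sweedler_product :: "'a::ring_1 hopf \<Rightarrow> nat \<Rightarrow> 'a \<Rightarrow> 'a" where
  "sweedler_product H n x = (\<Sum>l\<in>#iterated_comul H (n - 1) x. prod_list l)"

definition fs_indicator :: "nat \<Rightarrow> 'a::ring_1 hopf \<Rightarrow> complex" where
  "fs_indicator n H = regular_character H (sweedler_product H n (normalized_integral H))"

end

theory Submission
  imports Defs "HOL-Algebra.Sylow" "HOL-Algebra.Multiplicative_Group" "HOL-Number_Theory.Totient"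
begin

text \<open>
  Write \<open>u\<close> for the nontrivial element of the group of order two. Then \<open>H\<close> has a basis \<open>E a\<close>, \<open>c a\<close>
  indexed by \<open>G\<close>, where \<open>c a\<close> plays the role of \<open>e\<^sub>a u\<close>, with \<open>c a * c (\<theta> a) = \<sigma> a E a\<close> for an involutive
  automorphism \<open>\<theta>\<close> of \<open>G\<close>, and \<open>\<Delta> (c g) = \<Sum> \<tau> a b (c a \<otimes> c b)\<close> over \<open>a b = g\<close> for a 2-cocycle \<open>\<tau>\<close>.
  The integral is \<open>(E 1 + c 1) / 2\<close>, and \<open>\<nu>\<^sub>n(H)\<close> is the number of \<open>a\<close> with \<open>a\<^sup>n = 1\<close> plus, for even \<open>n\<close>, the
  sum of scalars \<open>\<kappa> n a\<close> over the \<open>a\<close> with \<open>(a \<theta>)\<^sup>n = 1\<close> in the semidirect product of \<open>G\<close> with \<open>\<theta>\<close>.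

  The pair \<open>(\<sigma>, \<tau>)\<close> is a 2-cocycle of this semidirect product with values in the nonzero complex numbers,
  on which \<open>\<theta>\<close> acts by inversion, and \<open>\<kappa> n a\<close> is the \<open>n\<close>-th power of any lift of \<open>a \<theta>\<close> to the corresponding
  group extension. That power commutes with the lift but is also inverted by it, so \<open>\<kappa> n a\<close> is \<open>1\<close> or \<open>-1\<close>.
  Hence \<open>\<nu>\<^sub>n(H)\<close> is the number of solutions of \<open>x\<^sup>n = 1\<close> in the semidirect product, divisible by \<open>n\<close> by
  the theorem of Frobenius, minus twice the number of elements with sign \<open>-1\<close>. The latter number is divisible by
  \<open>n / 2\<close>: if \<open>2\<^sup>b\<close> is the exact power of two in \<open>n\<close>, these elements have order divisible by \<open>2\<^sup>b\<close> and occur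
  together with all generators of the cyclic subgroups they generate, while for the odd part of \<open>n\<close> the
  sign depends only on the 2-part of the element, so that the theorem of Frobenius for centralizers applies.
\<close>

section \<open>The theorem of Frobenius\<close>

text \<open>The classes \<open>cl x\<close> partition \<open>T\<close>, so a common divisor of the
  class sums divides the total. It serves both for conjugacy classes and for sets of generators of
  cyclic subgroups.\<close>

lemma dvd_sum_classes:
  fixes F :: "'x \<Rightarrow> nat"
  assumes fin: "finite T"
    and self: "\<And>x. x \<in> T \<Longrightarrow> x \<in> cl x" and sub: "\<And>x. x \<in> T \<Longrightarrow> cl x \<subseteq> T"
    and eq: "\<And>x y. x \<in> T \<Longrightarrow> y \<in> cl x \<Longrightarrow> cl y = cl x"
    and d: "\<And>x. x \<in> T \<Longrightarrow> d dvd sum F (cl x)"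
  shows "d dvd sum F T"
proof -
  have T: "T = \<Union>(cl ` T)" using self sub by blast
  have "sum F (\<Union>(cl ` T)) = (sum \<circ> sum) F (cl ` T)"
  proof (rule sum.Union_disjoint)
    show "\<forall>A\<in>cl ` T. finite A" using fin sub finite_subset by blast
    show "\<forall>A\<in>cl ` T. \<forall>B\<in>cl ` T. A \<noteq> B \<longrightarrow> A \<inter> B = {}" using eq by blast
  qed
  moreover have "d dvd (\<Sum>A\<in>cl ` T. sum F A)" by (rule dvd_sum) (use d in auto)
  ultimately show ?thesis using T by simp
qed

section \<open>Centralizers, roots of the identity and conjugacy classes\<close>

context group begin

lemma inv_cancel:
  assumes "x \<in> carrier G" "y \<in> carrier G"
  shows "inv x \<otimes> (x \<otimes> y) = y" "x \<otimes> (inv x \<otimes> y) = y"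
  using assms by (simp_all add: m_assoc[symmetric])

definition centralizer :: "'a \<Rightarrow> 'a set" where
  "centralizer x = {y \<in> carrier G. x \<otimes> y = y \<otimes> x}"

lemma subgroup_centralizer:
  assumes x: "x \<in> carrier G"
  shows "subgroup (centralizer x) G"
proof (rule subgroupI)
  show "centralizer x \<subseteq> carrier G" by (auto simp: centralizer_def)
  show "centralizer x \<noteq> {}" using x by (auto simp: centralizer_def)
next
  fix a assume "a \<in> centralizer x"
  then have a: "a \<in> carrier G" and c: "x \<otimes> a = a \<otimes> x" by (auto simp: centralizer_def)
  have "inv a \<otimes> (x \<otimes> a) \<otimes> inv a = inv a \<otimes> x" using a x by (simp add: m_assoc)
  then have "inv a \<otimes> x = x \<otimes> inv a" unfolding c using a x by (simp add: m_assoc inv_cancel)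
  then show "inv a \<in> centralizer x" using a by (simp add: centralizer_def)
next
  fix a b assume "a \<in> centralizer x" "b \<in> centralizer x"
  then have a: "a \<in> carrier G" "x \<otimes> a = a \<otimes> x" and b: "b \<in> carrier G" "x \<otimes> b = b \<otimes> x"
    by (auto simp: centralizer_def)
  have "x \<otimes> (a \<otimes> b) = a \<otimes> (x \<otimes> b)" using a b(1) x by (simp add: m_assoc[symmetric])
  also have "\<dots> = (a \<otimes> b) \<otimes> x" using a(1) b x by (simp add: m_assoc)
  finally show "a \<otimes> b \<in> centralizer x" using a b by (simp add: centralizer_def)
qed

definition roots :: "nat \<Rightarrow> 'a set" where
  "roots n = {x \<in> carrier G. x [^] n = \<one>}"

lemma roots_subgroup:
  assumes "subgroup C G"
  shows "group.roots (G\<lparr>carrier := C\<rparr>) n = C \<inter> roots n"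
proof -
  interpret C: group "G\<lparr>carrier := C\<rparr>" by (rule subgroup_imp_group[OF assms])
  show ?thesis using subgroup.subset[OF assms]
    by (auto simp: C.roots_def roots_def nat_pow_consistent[symmetric])
qed

text \<open>Being a root only constrains \<open>ord x\<close>, which divides the group order anyway.
  This lets an exponent be used in a centralizer whose order it need not divide.\<close>

lemma roots_gcd:
  assumes "finite (carrier G)"
  shows "roots n = roots (gcd n (order G))"
  using ord_dvd_group_order by (auto simp: roots_def pow_eq_id)

definition conj_class :: "'a \<Rightarrow> 'a set" where
  "conj_class x = (\<lambda>g. g \<otimes> x \<otimes> inv g) ` carrier G"

text \<open>Orbit-stabilizer by counting fibres: the elements conjugating \<open>x\<close> to a
  fixed \<open>y\<close> form a coset of the centralizer.\<close>

lemma card_conj_class: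
  assumes fin: "finite (carrier G)" and x: "x \<in> carrier G"
  shows "card (conj_class x) * card (centralizer x) = order G"
proof -
  let ?f = "\<lambda>g. g \<otimes> x \<otimes> inv g"
  have "card {g \<in> carrier G. ?f g = y} = card (centralizer x)" if y: "y \<in> conj_class x" for y
  proof -
    obtain k where k: "k \<in> carrier G" "y = ?f k" using y by (auto simp: conj_class_def)
    have "bij_betw (\<lambda>c. k \<otimes> c) (centralizer x) {g \<in> carrier G. ?f g = y}"
    proof (rule bij_betwI[where g = "\<lambda>g. inv k \<otimes> g"])
      show "(\<lambda>c. k \<otimes> c) \<in> centralizer x \<rightarrow> {g \<in> carrier G. ?f g = y}"
      proof safe
        fix c assume c: "c \<in> centralizer x"
        then show "k \<otimes> c \<in> carrier G" using k by (simp add: centralizer_def)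
        have cc: "c \<in> carrier G" "x \<otimes> c = c \<otimes> x" using c by (auto simp: centralizer_def)
        have "?f (k \<otimes> c) = k \<otimes> (c \<otimes> x) \<otimes> inv c \<otimes> inv k"
          using k cc(1) x by (simp add: inv_mult_group m_assoc)
        also have "\<dots> = k \<otimes> x \<otimes> inv k"
          unfolding cc(2)[symmetric] using k cc(1) x by (simp add: m_assoc)
        finally show "?f (k \<otimes> c) = y" using k by simp
      qed
      show "(\<lambda>g. inv k \<otimes> g) \<in> {g \<in> carrier G. ?f g = y} \<rightarrow> centralizer x"
      proof safe
        fix g assume g: "g \<in> carrier G" "y = ?f g"
        have "inv k \<otimes> (g \<otimes> x \<otimes> inv g) \<otimes> g = inv k \<otimes> (k \<otimes> x \<otimes> inv k) \<otimes> g" using g k by simp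
        then have "inv k \<otimes> g \<otimes> x = x \<otimes> (inv k \<otimes> g)"
          using g k x by (simp add: m_assoc) (simp add: m_assoc[symmetric])
        then show "inv k \<otimes> g \<in> centralizer x" using g k by (simp add: centralizer_def)
      qed
    qed (use k in \<open>auto simp: inv_cancel centralizer_def\<close>)
    then show ?thesis by (rule bij_betw_same_card[symmetric])
  qed
  then have "(\<Sum>y\<in>conj_class x. card {g \<in> carrier G. ?f g = y}) = card (conj_class x) * card (centralizer x)"
    by simp
  moreover have "(\<Sum>y\<in>conj_class x. card {g \<in> carrier G. ?f g = y}) = card (carrier G)"
    using fin unfolding conj_class_def card_eq_sum by (rule sum.image_gen[symmetric])
  ultimately show ?thesis by (simp add: order_def)
qed

lemma conj_class_eq:
  assumes x: "x \<in> carrier G" and "y \<in> conj_class x"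
  shows "conj_class y = conj_class x"
proof -
  obtain k where k: "k \<in> carrier G" "y = k \<otimes> x \<otimes> inv k" using assms by (auto simp: conj_class_def)
  have 1: "g \<otimes> y \<otimes> inv g = (g \<otimes> k) \<otimes> x \<otimes> inv (g \<otimes> k)" if "g \<in> carrier G" for g
    using that k x by (simp add: inv_mult_group m_assoc)
  have 2: "g \<otimes> x \<otimes> inv g = (g \<otimes> inv k) \<otimes> y \<otimes> inv (g \<otimes> inv k)" if "g \<in> carrier G" for g
    using that k x by (simp add: inv_mult_group m_assoc inv_cancel)
  show ?thesis unfolding conj_class_def
  proof (intro equalityI image_subsetI)
    fix g assume g: "g \<in> carrier G"
    show "g \<otimes> y \<otimes> inv g \<in> (\<lambda>g. g \<otimes> x \<otimes> inv g) ` carrier G"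
      using g k by (intro image_eqI[of _ _ "g \<otimes> k"] 1) auto
    show "g \<otimes> x \<otimes> inv g \<in> (\<lambda>g. g \<otimes> y \<otimes> inv g) ` carrier G"
      using g k by (intro image_eqI[of _ _ "g \<otimes> inv k"] 2) auto
  qed
qed

lemma conj_pow:
  assumes "g \<in> carrier G" "x \<in> carrier G"
  shows "(g \<otimes> x \<otimes> inv g) [^] (n::nat) = g \<otimes> x [^] n \<otimes> inv g"
  using assms by (induction n) (simp_all add: m_assoc inv_cancel)

text \<open>A function constant on conjugacy classes contributes class size times value on each
  class.\<close>

lemma dvd_sum_conj_invariant:
  fixes F :: "'a \<Rightarrow> nat"
  assumes fin: "finite (carrier G)" and T: "T \<subseteq> carrier G"
    and inv_T: "\<And>g x. g \<in> carrier G \<Longrightarrow> x \<in> T \<Longrightarrow> g \<otimes> x \<otimes> inv g \<in> T"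
    and inv_F: "\<And>g x. g \<in> carrier G \<Longrightarrow> x \<in> T \<Longrightarrow> F (g \<otimes> x \<otimes> inv g) = F x"
    and d: "\<And>x. x \<in> T \<Longrightarrow> d dvd card (conj_class x) * F x"
  shows "d dvd sum F T"
proof (rule dvd_sum_classes[where cl = conj_class])
  show "finite T" using fin T finite_subset by blast
  show "x \<in> conj_class x" if "x \<in> T" for x
    using that T unfolding conj_class_def by (intro image_eqI[of _ _ \<one>]) auto
  show "conj_class x \<subseteq> T" if "x \<in> T" for x using that inv_T by (auto simp: conj_class_def)
  show "conj_class y = conj_class x" if "x \<in> T" "y \<in> conj_class x" for x y
    using that T conj_class_eq by blast
  show "d dvd sum F (conj_class x)" if "x \<in> T" for x
  proof -
    have "sum F (conj_class x) = (\<Sum>y\<in>conj_class x. F x)"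
      using that inv_F by (intro sum.cong) (auto simp: conj_class_def)
    then show ?thesis using d[OF that] by simp
  qed
qed

lemma card_centralizer_roots_conj:
  assumes g: "g \<in> carrier G" and x: "x \<in> carrier G"
  shows "card (centralizer (g \<otimes> x \<otimes> inv g) \<inter> roots n) = card (centralizer x \<inter> roots n)"
proof -
  have cancel: "inv g \<otimes> (g \<otimes> a \<otimes> inv g) \<otimes> g = a" "g \<otimes> (inv g \<otimes> a \<otimes> g) \<otimes> inv g = a" if "a \<in> carrier G" for a
    using g that by (simp_all add: m_assoc inv_cancel)
  have mult: "k \<otimes> a \<otimes> inv k \<otimes> (k \<otimes> b \<otimes> inv k) = k \<otimes> (a \<otimes> b) \<otimes> inv k"
    if "k \<in> carrier G" "a \<in> carrier G" "b \<in> carrier G" for a b k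
    using that by (simp add: m_assoc inv_cancel)
  have maps: "k \<otimes> a \<otimes> inv k \<in> centralizer (k \<otimes> b \<otimes> inv k) \<inter> roots n"
    if "k \<in> carrier G" "b \<in> carrier G" "a \<in> centralizer b \<inter> roots n" for a b k
    using that by (auto simp: centralizer_def roots_def conj_pow mult)
  have "bij_betw (\<lambda>a. g \<otimes> a \<otimes> inv g) (centralizer x \<inter> roots n) (centralizer (g \<otimes> x \<otimes> inv g) \<inter> roots n)"
  proof (rule bij_betwI[where g = "\<lambda>a. inv g \<otimes> a \<otimes> g"])
    show "(\<lambda>a. inv g \<otimes> a \<otimes> g) \<in> centralizer (g \<otimes> x \<otimes> inv g) \<inter> roots n \<rightarrow> centralizer x \<inter> roots n"
      using maps[of "inv g" "g \<otimes> x \<otimes> inv g"] g x by (auto simp: cancel)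
  qed (use maps g x in \<open>auto simp: cancel centralizer_def\<close>)
  then show ?thesis by (rule bij_betw_same_card[symmetric])
qed

text \<open>
  An element with \<open>x\<^bsup>st\<^esup> = 1\<close> is uniquely a product of commuting \<open>y\<close> and \<open>z\<close> with \<open>y\<^sup>s = z\<^sup>t = 1\<close>, both
  powers of \<open>x\<close>.
\<close>

lemma card_coprime_split:
  assumes fin: "finite (carrier G)" and cop: "coprime s t"
    and T: "T \<subseteq> roots (s * t)" and S: "S \<subseteq> roots s"
    and TS: "\<And>y z. y \<in> roots s \<Longrightarrow> z \<in> centralizer y \<inter> roots t \<Longrightarrow> y \<otimes> z \<in> T \<longleftrightarrow> y \<in> S"
  shows "card T = (\<Sum>y\<in>S. card (centralizer y \<inter> roots t))"
proof -
  \<comment> \<open>By the Chinese remainder theorem, \<open>v * t\<close> is 1 modulo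
    \<open>s\<close> and 0 modulo \<open>t\<close>, and \<open>u * s\<close> the reverse. The
    corresponding powers of \<open>x\<close> are its two coprime parts.\<close>
  obtain u v :: nat where uv: "[u * s = 1] (mod t)" "[v * t = 1] (mod s)"
    using cop cong_solve_coprime_nat[of s t] cong_solve_coprime_nat[of t s]
    by (auto simp: coprime_commute mult.commute)
  have pw: "x [^] a = x [^] b" if "x \<in> carrier G" "x [^] m = \<one>" "[a = b] (mod m)" for x and a b m :: nat
  proof -
    have "ord x dvd m" using that by (simp add: pow_eq_id)
    then have "[int a = int b] (mod int (ord x))"
      using cong_dvd_modulus_nat[OF that(3)] by (simp add: cong_int_iff)
    then have "int (ord x) dvd int b - int a" by (metis cong_iff_dvd_diff cong_sym)
    then have "x [^] int a = x [^] int b" using that(1) by (simp add: int_pow_eq)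
    then show ?thesis by (simp add: int_pow_int)
  qed
  have "[v * t + u * s = 1] (mod s)" "[v * t + u * s = 1] (mod t)"
    using uv by (simp_all add: cong_def)
  then have uvc: "[v * t + u * s = 1] (mod (s * t))" by (rule coprime_cong_mult_nat[OF _ _ cop])
  define P where "P = (SIGMA y:S. centralizer y \<inter> roots t)"
  have "bij_betw (\<lambda>(y,z). y \<otimes> z) P T"
  proof (rule bij_betwI[where g = "\<lambda>x. (x [^] (v * t), x [^] (u * s))"])
    show "(\<lambda>(y,z). y \<otimes> z) \<in> P \<rightarrow> T" using TS S by (auto simp: P_def)
  next
    show "(\<lambda>x. (x [^] (v * t), x [^] (u * s))) \<in> T \<rightarrow> P"
    proof
      fix x assume xT: "x \<in> T"
      then have x: "x \<in> carrier G" "x [^] (s * t) = \<one>" using T by (auto simp: roots_def)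
      let ?y = "x [^] (v * t)" and ?z = "x [^] (u * s)"
      have "?y [^] s = (x [^] (s * t)) [^] v" "?z [^] t = (x [^] (s * t)) [^] u"
        using x(1) by (simp_all only: nat_pow_pow mult_ac)
      then have y: "?y \<in> roots s" and z: "?z \<in> roots t" using x by (auto simp: roots_def)
      have zc: "?z \<in> centralizer ?y" using x by (simp add: centralizer_def nat_pow_mult add.commute)
      have "x [^] (v * t + u * s) = x" using pw[OF x uvc] x(1) by simp
      then have "?y \<otimes> ?z = x" using x(1) by (simp add: nat_pow_mult)
      then have "?y \<in> S" using TS[OF y, of ?z] z zc xT by simp
      then show "(?y, ?z) \<in> P" using z zc by (simp add: P_def)
    qed
  next
    fix p assume "p \<in> P"
    then obtain y z where p: "p = (y, z)" "y \<in> S" "z \<in> centralizer y" "z \<in> roots t" by (auto simp: P_def)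
    then have y: "y \<in> carrier G" "y [^] s = \<one>" and z: "z \<in> carrier G" "z [^] t = \<one>" and c: "y \<otimes> z = z \<otimes> y"
      using S by (auto simp: roots_def centralizer_def)
    have m: "(y \<otimes> z) [^] (n::nat) = y [^] n \<otimes> z [^] n" for n using pow_mult_distrib[OF c] y z by simp
    have a: "y [^] (v * t) = y" using pw[OF y uv(2)] y by simp
    have b: "z [^] (u * s) = z" using pw[OF z uv(1)] z by simp
    have a': "z [^] (v * t) = \<one>" using z nat_pow_pow[of z t v] by (simp add: mult.commute)
    have b': "y [^] (u * s) = \<one>" using y nat_pow_pow[of y s u] by (simp add: mult.commute)
    show "(\<lambda>x. (x [^] (v * t), x [^] (u * s))) ((\<lambda>(y,z). y \<otimes> z) p) = p"
      using p(1) y z by (simp add: m a b a' b')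
  next
    fix x assume xT: "x \<in> T"
    then have x: "x \<in> carrier G" "x [^] (s * t) = \<one>" using T by (auto simp: roots_def)
    have "x [^] (v * t + u * s) = x" using pw[OF x uvc] x(1) by simp
    then show "(\<lambda>(y,z). y \<otimes> z) (x [^] (v * t), x [^] (u * s)) = x" using x(1) by (simp add: nat_pow_mult)
  qed
  then have "card T = card P" by (rule bij_betw_same_card[symmetric])
  also have "\<dots> = (\<Sum>y\<in>S. card (centralizer y \<inter> roots t))"
  proof -
    have "finite S" using S fin finite_subset[of S "carrier G"] by (auto simp: roots_def)
    then show ?thesis unfolding P_def by (rule card_SigmaI)
      (use fin finite_subset[of _ "carrier G"] in \<open>auto simp: centralizer_def\<close>)
  qed
  finally show ?thesis .
qed

text \<open>The elements generating a given cyclic subgroup form the blocks of a partition.\<close>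

lemma dvd_card_generator_closed:
  assumes fin: "finite (carrier G)" and T: "T \<subseteq> carrier G"
    and closed: "\<And>x j. x \<in> T \<Longrightarrow> coprime j (ord x) \<Longrightarrow> x [^] (j::nat) \<in> T"
    and d: "\<And>x. x \<in> T \<Longrightarrow> d dvd totient (ord x)"
  shows "d dvd card T"
proof -
  define cl where "cl x = (\<lambda>j. x [^] j) ` totatives (ord x)" for x
  have pos: "ord x > 0" if "x \<in> carrier G" for x using ord_ge_1[OF fin that] by simp
  \<comment> \<open>Totatives lie between 1 and \<open>ord x\<close>, so an exponent can be reduced
    modulo \<open>ord x\<close>, except for \<open>ord x = 1\<close>, where the residue 0 has to be
    replaced by 1.\<close>
  have memb: "x [^] j \<in> cl x" if x: "x \<in> carrier G" and j: "coprime j (ord x)" for x and j :: nat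
  proof (cases "ord x = 1")
    case True
    then have "x = \<one>" using x ord_eq_1 by simp
    then show ?thesis by (auto simp: cl_def)
  next
    case False
    have "j mod ord x \<in> totatives (ord x)"
      using False pos[OF x] j by (auto simp: totatives_def coprime_mod_left_iff intro!: Nat.gr0I)
    moreover have "x [^] j = x [^] (j mod ord x)"
    proof -
      have "x [^] j = x [^] (ord x * (j div ord x) + j mod ord x)" by simp
      also have "\<dots> = (x [^] ord x) [^] (j div ord x) \<otimes> x [^] (j mod ord x)"
        using x by (simp only: nat_pow_mult[symmetric] nat_pow_pow nat_pow_closed)
      finally show ?thesis using x by simp
    qed
    ultimately show ?thesis by (auto simp: cl_def)
  qed
  have "d dvd sum (\<lambda>_. 1) T"
  proof (rule dvd_sum_classes[where cl = cl])
    show "finite T" using fin T finite_subset by blast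
    show "x \<in> cl x" if "x \<in> T" for x using memb[of x 1] that T by auto
    show "cl x \<subseteq> T" if "x \<in> T" for x using closed[OF that] by (auto simp: cl_def totatives_def)
  next
    fix x y assume x: "x \<in> T" and y: "y \<in> cl x"
    then obtain j where j: "coprime j (ord x)" "y = x [^] j" by (auto simp: cl_def totatives_def)
    have xG: "x \<in> carrier G" and yG: "y \<in> carrier G" using x T j by auto
    have oy: "ord y = ord x" using pow_ord_eq_ord_iff[OF fin xG] j by simp
    \<comment> \<open>Inverting the exponent gives \<open>x = y [^] k\<close>, so \<open>x\<close>
      and \<open>y\<close> generate the same cyclic subgroup.\<close>
    obtain k where k: "[j * k = 1] (mod ord x)" using cong_solve_coprime_nat[OF j(1)] by auto
    have kc: "coprime k (ord x)" using cong_imp_coprime[OF cong_sym[OF k]] by simp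
    have "x = y [^] k"
    proof -
      have "int (ord x) dvd int (j * k) - 1" using k by (metis cong_int_iff cong_iff_dvd_diff of_nat_1)
      then have "x [^] (1::int) = x [^] int (j * k)" using xG int_pow_eq[OF xG, of 1 "int (j * k)"] by simp
      then show ?thesis using xG j by (simp only: int_pow_int int_pow_1 nat_pow_pow)
    qed
    note kx = this
    show "cl y = cl x"
    proof
      show "cl y \<subseteq> cl x"
      proof
        fix z assume "z \<in> cl y"
        then obtain i where "coprime i (ord y)" "z = y [^] i" by (auto simp: cl_def totatives_def)
        then show "z \<in> cl x" using memb[OF xG, of "j * i"] j oy xG by (simp add: nat_pow_pow)
      qed
      show "cl x \<subseteq> cl y"
      proof
        fix z assume "z \<in> cl x"
        then obtain i where i: "coprime i (ord x)" "z = x [^] i" by (auto simp: cl_def totatives_def)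
        have "z = y [^] (k * i)" using i(2) kx yG by (metis nat_pow_pow)
        then show "z \<in> cl y" using memb[OF yG, of "k * i"] i kc oy by simp
      qed
    qed
  next
    fix x assume x: "x \<in> T"
    then have xG: "x \<in> carrier G" using T by auto
    have "inj_on (\<lambda>j. x [^] j) (totatives (ord x))"
      by (rule inj_on_subset[OF ord_inj'[OF xG]]) (auto simp: totatives_def)
    then have "card (cl x) = totient (ord x)" by (simp add: cl_def totient_def card_image)
    then show "d dvd sum (\<lambda>_. 1) (cl x)" using d[OF x] by simp
  qed
  then show ?thesis by simp
qed

end

text \<open>\<open>d\<close> divides \<open>m * d\<close> and \<open>m * c\<close>, hence
  \<open>m * gcd d c\<close>. With \<open>m\<close> the size of a conjugacy class and
  \<open>c\<close> the order of the centralizer, this turns a divisibility inside the centralizer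
  into one for the whole class.\<close>

lemma dvd_mult_of_gcd_dvd:
  fixes d m c f :: nat
  assumes "d dvd m * c" "gcd d c dvd f"
  shows "d dvd m * f"
proof -
  have "d dvd gcd (m * d) (m * c)" using assms(1) by simp
  then have "d dvd m * gcd d c" by (simp add: gcd_mult_distrib_nat)
  then show ?thesis using assms(2) by (meson dvd_trans mult_dvd_mono dvd_refl)
qed

text \<open>The complementary factor of \<open>d\<close> must contain \<open>p\<close>; otherwise
  all of \<open>p ^ Suc b\<close> would have to divide \<open>d\<close>.\<close>

lemma dvd_prime_power_mult:
  fixes d p r :: nat
  assumes "prime p" "d dvd p ^ Suc b * r" "\<not> p ^ Suc b dvd d"
  shows "d dvd p ^ b * r"
proof -
  obtain k where k: "p ^ Suc b * r = d * k" using assms(2) by auto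
  have "p dvd k"
  proof (rule ccontr)
    assume "\<not> p dvd k"
    then have "coprime (p ^ Suc b) k" using assms(1) by (simp add: prime_imp_coprime)
    moreover have "p ^ Suc b dvd d * k" using k by (metis dvd_triv_left)
    ultimately show False using assms(3) coprime_dvd_mult_left_iff by blast
  qed
  then obtain l where "k = p * l" by auto
  then have "p * (p ^ b * r) = p * (d * l)" using k by (simp add: mult_ac)
  then have "p ^ b * r = d * l" using prime_gt_0_nat[OF assms(1)] by simp
  then show ?thesis by simp
qed

section \<open>The theorem of Frobenius for the full prime power in the group order\<close>

context group begin

lemma card_centralizer_conj:
  assumes fin: "finite (carrier G)" and "g \<in> carrier G" "x \<in> carrier G"
  shows "card (centralizer (g \<otimes> x \<otimes> inv g)) = card (centralizer x)"
proof -
  have "centralizer y \<inter> roots (order G) = centralizer y" for y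
    by (auto simp: centralizer_def roots_def pow_order_eq_1)
  then show ?thesis using card_centralizer_roots_conj[OF assms(2,3), of "order G"] by simp
qed

lemma roots_conj:
  assumes "g \<in> carrier G" "x \<in> roots n"
  shows "g \<otimes> x \<otimes> inv g \<in> roots n"
  using assms by (auto simp: roots_def conj_pow)

text \<open>The central \<open>t\<close>-th roots form a subgroup. If \<open>q\<close> divided its
  order, Sylow's theorem would give a subgroup of order \<open>q\<close>, whose nontrivial elements
  would have order dividing both \<open>q\<close> and \<open>t\<close>.\<close>

lemma prime_not_dvd_card_central_roots:
  assumes fin: "finite (carrier G)" and q: "prime q" "\<not> q dvd t"
  shows "\<not> q dvd card {y \<in> roots t. centralizer y = carrier G}"
proof
  let ?Z = "{y \<in> roots t. centralizer y = carrier G}"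
  have comm: "y \<otimes> x = x \<otimes> y" if "y \<in> ?Z" "x \<in> carrier G" for x y
    using that by (auto simp: centralizer_def)
  have memb: "y \<in> ?Z" if "y \<in> carrier G" "y [^] t = \<one>" "\<And>x. x \<in> carrier G \<Longrightarrow> y \<otimes> x = x \<otimes> y" for y
    using that by (auto simp: centralizer_def roots_def)
  have Z: "subgroup ?Z G"
  proof (rule subgroupI)
    show "?Z \<subseteq> carrier G" by (auto simp: roots_def)
    have "\<one> \<in> ?Z" by (rule memb) auto
    then show "?Z \<noteq> {}" by blast
  next
    fix a assume a: "a \<in> ?Z"
    then have ac: "a \<in> carrier G" "a [^] t = \<one>" by (auto simp: roots_def)
    show "inv a \<in> ?Z"
    proof (rule memb)
      show "inv a [^] t = \<one>" using ac by (simp add: nat_pow_inv)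
      fix x assume x: "x \<in> carrier G"
      have "inv a \<otimes> (a \<otimes> x) \<otimes> inv a = inv a \<otimes> (x \<otimes> a) \<otimes> inv a" using comm[OF a x] by simp
      then show "inv a \<otimes> x = x \<otimes> inv a" using ac x by (simp add: m_assoc inv_cancel)
    qed (use ac in simp)
  next
    fix a b assume a: "a \<in> ?Z" and b: "b \<in> ?Z"
    then have ac: "a \<in> carrier G" "a [^] t = \<one>" and bc: "b \<in> carrier G" "b [^] t = \<one>"
      by (auto simp: roots_def)
    show "a \<otimes> b \<in> ?Z"
    proof (rule memb)
      show "(a \<otimes> b) [^] t = \<one>" using pow_mult_distrib[OF comm[OF a bc(1)]] ac bc by simp
      fix x assume x: "x \<in> carrier G"
      have "a \<otimes> b \<otimes> x = a \<otimes> (x \<otimes> b)" using comm[OF b x] ac bc x by (simp add: m_assoc)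
      also have "\<dots> = x \<otimes> (a \<otimes> b)" using comm[OF a x] ac bc x by (simp add: m_assoc[symmetric])
      finally show "a \<otimes> b \<otimes> x = x \<otimes> (a \<otimes> b)" .
    qed (use ac bc in simp)
  qed
  let ?ZG = "G\<lparr>carrier := ?Z\<rparr>"
  assume "q dvd card ?Z"
  then obtain m where m: "order ?ZG = q ^ 1 * m" by (auto simp: order_def)
  have finZ: "finite (carrier ?ZG)" using fin subgroup.subset[OF Z] finite_subset by auto
  obtain Q where Q: "subgroup Q ?ZG" "card Q = q"
    using sylow_thm[OF q(1) subgroup_imp_group[OF Z] m finZ] by auto
  have QG: "subgroup Q G" using Q(1) Z incl_subgroup by blast
  interpret QG: group "G\<lparr>carrier := Q\<rparr>" by (rule subgroup_imp_group[OF QG])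
  have "\<not> Q \<subseteq> {\<one>}"
    using Q(2) prime_gt_1_nat[OF q(1)] card_mono[of "{\<one>}" Q] by auto
  then obtain x where x: "x \<in> Q" "x \<noteq> \<one>" by blast
  have "x [^] q = \<one>"
    using QG.pow_order_eq_1[of x] x Q(2) by (simp add: order_def nat_pow_consistent[symmetric])
  moreover have xZ: "x \<in> ?Z" using x Q(1) subgroup.subset by fastforce
  then have "x \<in> carrier G" "x [^] t = \<one>" by (auto simp: roots_def)
  ultimately have "ord x dvd q" "ord x dvd t" "x \<in> carrier G" by (auto simp: pow_eq_id)
  moreover have "coprime q t" using q by (simp add: prime_imp_coprime)
  ultimately have "ord x = 1" by (metis coprime_common_divisor_nat)
  then show False using x(2) \<open>x \<in> carrier G\<close> ord_eq_1 by simp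
qed

end

text \<open>Induction on the group order; it passes to centralizers, so the group is a variable of
  the statement. Sorting all elements by their \<open>q\<close>-free part \<open>y\<close> writes
  the order as a sum of numbers of \<open>q\<close>-power roots in centralizers of \<open>y\<close>.
  Noncentral \<open>y\<close> contribute a multiple of the \<open>q\<close>-part by induction. The
  central ones contribute the number sought, multiplied by a count prime to
  \<open>q\<close>.\<close>

lemma dvd_card_roots_full_prime_power:
  assumes "finite (carrier G)" "prime q" "multiplicity q (order G) \<le> a" "group G"
  shows "gcd (q ^ a) (order G) dvd card (group.roots G (q ^ a))"
  using assms
proof (induction "order G" arbitrary: G a rule: less_induct)
  case less
  interpret group G by (rule less.prems(4))
  note fin = less.prems(1) and q = less.prems(2)
  define m where "m = multiplicity q (order G)"
  have pos: "order G > 0" using fin order_gt_0_iff_finite by simp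
  obtain t where t: "order G = q ^ m * t" "\<not> q dvd t"
    unfolding m_def by (rule multiplicity_decompose'[of "order G" q]) (use pos q in auto)
  have cop: "coprime t (q ^ a)" for a
    using prime_imp_coprime[OF q t(2)] by (simp add: coprime_commute)
  have gcd_a: "gcd (q ^ a) (order G) = q ^ m"
  proof -
    have "m \<le> a" using less.prems(3) by (simp add: m_def)
    then have "gcd (q ^ a) (order G) = gcd (q ^ m * q ^ (a - m)) (q ^ m * t)"
      unfolding t(1) by (simp flip: power_add)
    also have "\<dots> = q ^ m * gcd (q ^ (a - m)) t" by (simp add: gcd_mult_distrib_nat)
    finally show ?thesis using cop[of "a - m"] by (simp add: coprime_iff_gcd_eq_1 gcd.commute)
  qed
  let ?F = "\<lambda>y. card (centralizer y \<inter> roots (q ^ m))"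
  \<comment> \<open>Central and noncentral \<open>y\<close>. The strict inequality of orders in
    \<open>?N\<close> is the form that the induction hypothesis asks for.\<close>
  let ?Z = "{y \<in> roots t. centralizer y = carrier G}"
  let ?N = "{y \<in> roots t. card (centralizer y) < order G}"
  have rootsG: "roots t \<subseteq> carrier G" for t by (auto simp: roots_def)
  have fin_roots: "finite (roots t)" for t using fin rootsG finite_subset by blast
  have cent: "centralizer y \<subseteq> carrier G" for y by (auto simp: centralizer_def)
  have "card (carrier G) = sum ?F (roots t)"
  proof (rule card_coprime_split[OF fin cop])
    show "carrier G \<subseteq> roots (t * q ^ m)"
      using pow_order_eq_1 by (auto simp: roots_def t(1) mult.commute)
  qed (auto simp: roots_def centralizer_def)
  also have "roots t = ?Z \<union> ?N"
  proof -
    have "card (centralizer y) < order G" if "centralizer y \<noteq> carrier G" for y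
      using that cent[of y] fin unfolding order_def by (intro psubset_card_mono) auto
    then show ?thesis by auto
  qed
  also have "sum ?F (?Z \<union> ?N) = sum ?F ?Z + sum ?F ?N"
    using fin_roots by (intro sum.union_disjoint) (auto simp: order_def)
  also have "sum ?F ?Z = card ?Z * card (roots (q ^ m))"
    using rootsG by (simp add: Int_absorb1)
  finally have eq: "q ^ m * t = card ?Z * card (roots (q ^ m)) + sum ?F ?N"
    using t(1) by (simp add: order_def)
  have "q ^ m dvd sum ?F ?N"
  proof (rule dvd_sum_conj_invariant[OF fin])
    show "?N \<subseteq> carrier G" using rootsG by auto
    show "g \<otimes>\<^bsub>G\<^esub> x \<otimes>\<^bsub>G\<^esub> inv\<^bsub>G\<^esub> g \<in> ?N" if "g \<in> carrier G" "x \<in> ?N" for g x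
      using that card_centralizer_conj[OF fin that(1), of x] roots_conj[OF that(1), of x t]
        subsetD[OF rootsG, of x t] by auto
    show "?F (g \<otimes>\<^bsub>G\<^esub> x \<otimes>\<^bsub>G\<^esub> inv\<^bsub>G\<^esub> g) = ?F x" if "g \<in> carrier G" "x \<in> ?N" for g x
      using that rootsG by (intro card_centralizer_roots_conj) auto
    show "q ^ m dvd card (conj_class x) * ?F x" if "x \<in> ?N" for x
    proof -
      have x: "x \<in> carrier G" "card (centralizer x) < order G" using that rootsG by auto
      let ?C = "G\<lparr>carrier := centralizer x\<rparr>"
      have C: "subgroup (centralizer x) G" by (rule subgroup_centralizer[OF x(1)])
      have idx: "card (conj_class x) * card (centralizer x) = order G" by (rule card_conj_class[OF fin x(1)])
      have finC: "finite (centralizer x)" using fin by (simp add: centralizer_def)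
      have "order ?C dvd order G" unfolding idx[symmetric] by (simp add: order_def)
      then have "multiplicity q (order ?C) \<le> m"
        unfolding m_def using pos by (intro dvd_imp_multiplicity_le) auto
      then have "gcd (q ^ m) (order ?C) dvd card (group.roots ?C (q ^ m))"
        using less.hyps[OF _ _ q _ subgroup_imp_group[OF C]] x(2) finC by (simp add: order_def)
      then have "gcd (q ^ m) (card (centralizer x)) dvd ?F x"
        unfolding roots_subgroup[OF C] by (simp add: order_def)
      moreover have "q ^ m dvd card (conj_class x) * card (centralizer x)" unfolding idx t(1) by simp
      ultimately show ?thesis by (rule dvd_mult_of_gcd_dvd[rotated])
    qed
  qed
  moreover have "q ^ m dvd card ?Z * card (roots (q ^ m)) + sum ?F ?N"
    unfolding eq[symmetric] by simp
  ultimately have "q ^ m dvd card ?Z * card (roots (q ^ m))" by (simp only: dvd_add_left_iff)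
  moreover have "coprime (q ^ m) (card ?Z)"
    using prime_not_dvd_card_central_roots[OF fin q t(2)] q by (simp add: prime_imp_coprime)
  ultimately have "q ^ m dvd card (roots (q ^ m))" by (simp add: coprime_dvd_mult_right_iff)
  moreover have "roots (q ^ a) = roots (q ^ m)" using roots_gcd[OF fin, of "q ^ a"] by (simp only: gcd_a)
  ultimately show ?case by (simp only: gcd_a)
qed

section \<open>Smaller prime powers and arbitrary divisors of the group order\<close>

context group begin

text \<open>Descends from the full power \<open>q ^ m\<close>. The roots for
  \<open>q ^ Suc b\<close> that are not roots for \<open>q ^ b\<close> have order exactly
  \<open>q ^ Suc b\<close>, so they come in blocks of size \<open>totient (q ^ Suc b)\<close>, a
  multiple of \<open>q ^ b\<close>, and can be removed.\<close>

lemma dvd_card_roots_prime_power: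
  assumes fin: "finite (carrier G)" and q: "prime q"
  shows "gcd (q ^ a) (order G) dvd card (roots (q ^ a))"
proof -
  define m where "m = multiplicity q (order G)"
  have pos: "order G > 0" using fin order_gt_0_iff_finite by simp
  have dvd: "q ^ m dvd order G" by (simp add: m_def multiplicity_dvd)
  have "q ^ b dvd card (roots (q ^ b))" if "b \<le> m" for b
    using that
  proof (induction b rule: inc_induct)
    case base
    have "gcd (q ^ m) (order G) = q ^ m" by (rule gcd_nat.absorb1[OF dvd])
    moreover have "gcd (q ^ m) (order G) dvd card (roots (q ^ m))"
      by (rule dvd_card_roots_full_prime_power[OF fin q _ group_axioms]) (simp add: m_def)
    ultimately show ?case by (simp only:)
  next
    case (step b)
    let ?D = "{x \<in> carrier G. ord x = q ^ Suc b}"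
    have mem: "x \<in> roots n \<longleftrightarrow> x \<in> carrier G \<and> ord x dvd n" for x n
      by (auto simp: roots_def pow_eq_id)
    have nd: "\<not> q ^ Suc b dvd q ^ b"
      using power_dvd_imp_le[of q "Suc b" b] prime_gt_1_nat[OF q] by auto
    have oS: "ord x = q ^ Suc b" if "ord x dvd q ^ Suc b" "\<not> ord x dvd q ^ b" for x
    proof -
      from iffD1[OF divides_primepow_nat[OF q] that(1)]
      obtain i where i: "i \<le> Suc b" "ord x = q ^ i" by (elim exE conjE)
      have "\<not> q ^ i dvd q ^ b" using that(2) unfolding i(2) .
      then have "\<not> i \<le> b" using le_imp_power_dvd by blast
      then show ?thesis using i by (simp add: le_Suc_eq)
    qed
    have "q ^ b dvd q ^ Suc b" by simp
    then have "roots (q ^ Suc b) = roots (q ^ b) \<union> ?D"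
      unfolding set_eq_iff Un_iff mem mem_Collect_eq using oS by (metis dvd_refl dvd_trans)
    moreover have "roots (q ^ b) \<inter> ?D = {}"
      using nd by (auto simp: mem simp del: power_Suc)
    moreover have "finite (roots (q ^ b))" "finite ?D" using fin by (auto simp: roots_def)
    ultimately have "card (roots (q ^ Suc b)) = card (roots (q ^ b)) + card ?D"
      by (metis card_Un_disjoint)
    moreover have "q ^ b dvd card ?D"
    proof (rule dvd_card_generator_closed[OF fin])
      show "x [^] j \<in> ?D" if "x \<in> ?D" "coprime j (ord x)" for x and j :: nat
        using that pow_ord_eq_ord_iff[OF fin, of x j] by auto
      show "q ^ b dvd totient (ord x)" if "x \<in> ?D" for x
        using that totient_prime_power_Suc[OF q, of b] by (simp del: power_Suc)
    qed auto
    moreover have "q ^ b dvd card (roots (q ^ Suc b))"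
      using step.IH dvd_mult_right[of q "q ^ b"] by simp
    ultimately show ?case by (simp add: dvd_add_left_iff)
  qed
  moreover obtain b where b: "gcd (q ^ a) (order G) = q ^ b"
    using q divides_primepow_nat[OF q, of "gcd (q ^ a) (order G)" a] by auto
  moreover have "b \<le> m"
    unfolding m_def using pos q b by (intro multiplicity_geI) (auto simp: b[symmetric] not_prime_unit)
  moreover have "roots (q ^ a) = roots (q ^ b)" using roots_gcd[OF fin, of "q ^ a"] by (simp only: b)
  ultimately show ?thesis by (simp only: b)
qed

text \<open>Sort the roots by their \<open>r\<close>-part \<open>y\<close>. The number over
  \<open>y\<close> counts \<open>q ^ b\<close>-th roots in its centralizer, where the prime power
  case applies; the size of the class of \<open>y\<close> supplies the missing factor.\<close>

lemma prime_power_dvd_card_roots: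
  assumes fin: "finite (carrier G)" and q: "prime q" and n: "q ^ b * r dvd order G" "\<not> q dvd r"
  shows "q ^ b dvd card (roots (q ^ b * r))"
proof -
  have cop: "coprime r (q ^ b)" using prime_imp_coprime[OF q n(2)] by (simp add: coprime_commute)
  have "card (roots (q ^ b * r)) = (\<Sum>y\<in>roots r. card (centralizer y \<inter> roots (q ^ b)))"
  proof (rule card_coprime_split[OF fin cop])
    fix y z assume y: "y \<in> roots r" and z: "z \<in> centralizer y \<inter> roots (q ^ b)"
    have c: "y \<in> carrier G" "z \<in> carrier G" "y \<otimes> z = z \<otimes> y" "y [^] r = \<one>" "z [^] (q ^ b) = \<one>"
      using y z by (auto simp: roots_def centralizer_def)
    have "(y \<otimes> z) [^] (q ^ b * r) = (y [^] r) [^] (q ^ b) \<otimes> (z [^] (q ^ b)) [^] r"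
      using pow_mult_distrib[OF c(3,1,2)] c(1,2) by (simp add: nat_pow_pow mult.commute)
    then show "(y \<otimes> z \<in> roots (q ^ b * r)) = (y \<in> roots r)" using c by (simp add: roots_def)
  qed (auto simp: mult.commute)
  also have "q ^ b dvd \<dots>"
  proof (rule dvd_sum_conj_invariant[OF fin])
    show "roots r \<subseteq> carrier G" by (auto simp: roots_def)
    show "g \<otimes> x \<otimes> inv g \<in> roots r" if "g \<in> carrier G" "x \<in> roots r" for g x
      using that by (rule roots_conj)
    show "card (centralizer (g \<otimes> x \<otimes> inv g) \<inter> roots (q ^ b)) = card (centralizer x \<inter> roots (q ^ b))"
      if "g \<in> carrier G" "x \<in> roots r" for g x
      using that by (intro card_centralizer_roots_conj) (auto simp: roots_def)
    show "q ^ b dvd card (conj_class x) * card (centralizer x \<inter> roots (q ^ b))" if "x \<in> roots r" for x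
    proof -
      have x: "x \<in> carrier G" using that by (auto simp: roots_def)
      have C: "subgroup (centralizer x) G" by (rule subgroup_centralizer[OF x])
      interpret C: group "G\<lparr>carrier := centralizer x\<rparr>" by (rule subgroup_imp_group[OF C])
      have finC: "finite (centralizer x)" using fin by (simp add: centralizer_def)
      have "gcd (q ^ b) (card (centralizer x)) dvd card (centralizer x \<inter> roots (q ^ b))"
        using C.dvd_card_roots_prime_power[of q b] finC q unfolding roots_subgroup[OF C] by (simp add: order_def)
      moreover have "q ^ b dvd card (conj_class x) * card (centralizer x)"
        unfolding card_conj_class[OF fin x] using n(1) by (rule dvd_mult_left)
      ultimately show ?thesis by (rule dvd_mult_of_gcd_dvd[rotated])
    qed
  qed
  finally show ?thesis .
qed

theorem frobenius:
  assumes fin: "finite (carrier G)" and n: "n dvd order G"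
  shows "n dvd card (roots n)"
proof (rule multiplicity_le_imp_dvd)
  have pos: "order G > 0" using fin order_gt_0_iff_finite by simp
  then show n0: "n \<noteq> 0" using n by auto
  fix q :: nat assume q: "prime q"
  \<comment> \<open>The identity is a root, so the count is nonzero and its multiplicities are
    informative.\<close>
  have "finite (roots n)" "\<one> \<in> roots n" using fin by (auto simp: roots_def)
  then have "card (roots n) \<noteq> 0" by auto
  moreover obtain r where r: "n = q ^ multiplicity q n * r" "\<not> q dvd r"
    by (rule multiplicity_decompose'[of n q]) (use n0 q in auto)
  moreover have "q ^ multiplicity q n dvd card (roots n)"
    using prime_power_dvd_card_roots[OF fin q, of "multiplicity q n" r] r n by simp
  ultimately show "multiplicity q n \<le> multiplicity q (card (roots n))"
    using q by (intro multiplicity_geI) (auto simp: not_prime_unit)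
qed

text \<open>The theorem of Frobenius in the centralizer of \<open>x\<close>, for the gcd of
  \<open>n\<close> with its order; the index of the centralizer makes up for the rest of
  \<open>n\<close>.\<close>

lemma dvd_card_conj_class_mult_roots:
  assumes fin: "finite (carrier G)" and n: "n dvd order G" and x: "x \<in> carrier G"
  shows "n dvd card (conj_class x) * card (centralizer x \<inter> roots n)"
proof -
  have C: "subgroup (centralizer x) G" by (rule subgroup_centralizer[OF x])
  interpret C: group "G\<lparr>carrier := centralizer x\<rparr>" by (rule subgroup_imp_group[OF C])
  have finC: "finite (centralizer x)" using fin by (simp add: centralizer_def)
  have "gcd n (card (centralizer x)) dvd card (C.roots (gcd n (card (centralizer x))))"
    using finC by (intro C.frobenius) (auto simp: order_def)
  then have "gcd n (card (centralizer x)) dvd card (centralizer x \<inter> roots n)"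
    using C.roots_gcd[of n] finC by (simp add: order_def roots_subgroup[OF C])
  moreover have "n dvd card (conj_class x) * card (centralizer x)"
    unfolding card_conj_class[OF fin x] by (rule n)
  ultimately show ?thesis by (rule dvd_mult_of_gcd_dvd[rotated])
qed

end

section \<open>Extensions inverted by a coset\<close>

text \<open>
  An extension \<open>K \<rightarrow> G \<rightarrow> L\<close> in which the elements over the index-two coset \<open>S\<close> invert the abelian
  kernel and the other elements centralise it. Since \<open>y\<^sup>n\<close> commutes with \<open>y\<close>, it is its own inverse
  when it lies in \<open>K\<close> and \<open>y\<close> lies over \<open>S\<close>.
\<close>

locale inverting_extension = G: group G + L: group L
  for G :: "'a monoid" (structure) and L :: "'b monoid" +
  fixes \<phi> :: "'a \<Rightarrow> 'b" and S :: "'b set" and \<zeta> :: 'a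
  assumes fin: "finite (carrier L)"
    and hom: "\<phi> \<in> hom G L" and surj: "\<phi> ` carrier G = carrier L"
    and S: "S \<subseteq> carrier L"
    and S_mult: "\<And>x y. \<lbrakk>x \<in> carrier L; y \<in> carrier L\<rbrakk> \<Longrightarrow> x \<otimes>\<^bsub>L\<^esub> y \<in> S \<longleftrightarrow> (x \<in> S) \<noteq> (y \<in> S)"
    and inverts: "\<And>y z. \<lbrakk>y \<in> carrier G; \<phi> y \<in> S; z \<in> kernel G L \<phi>\<rbrakk> \<Longrightarrow> y \<otimes> z = inv z \<otimes> y"
    and centralises: "\<And>y z. \<lbrakk>y \<in> carrier G; \<phi> y \<notin> S; z \<in> kernel G L \<phi>\<rbrakk> \<Longrightarrow> y \<otimes> z = z \<otimes> y"
    and square: "\<And>z. z \<in> kernel G L \<phi> \<Longrightarrow> \<exists>s\<in>kernel G L \<phi>. s \<otimes> s = z"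
    and zeta: "\<zeta> \<in> kernel G L \<phi>" "\<zeta> \<otimes> \<zeta> = \<one>" "\<zeta> \<noteq> \<one>"
    and involution: "\<And>z. \<lbrakk>z \<in> kernel G L \<phi>; z \<otimes> z = \<one>\<rbrakk> \<Longrightarrow> z = \<one> \<or> z = \<zeta>"
begin

abbreviation K where "K \<equiv> kernel G L \<phi>"

sublocale group_hom G L \<phi>
  using hom by unfold_locales

lemma K_carrier: "z \<in> K \<Longrightarrow> z \<in> carrier G" by (simp add: kernel_def)

lemma one_notin_S: "\<one>\<^bsub>L\<^esub> \<notin> S"
  using S_mult[of "\<one>\<^bsub>L\<^esub>" "\<one>\<^bsub>L\<^esub>"] by auto

lemma S_pow: "x \<in> carrier L \<Longrightarrow> x [^]\<^bsub>L\<^esub> (n::nat) \<in> S \<longleftrightarrow> x \<in> S \<and> odd n"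
  by (induction n) (auto simp: one_notin_S S_mult)

lemma commuting_kernel_element:
  assumes "y \<in> carrier G" "\<phi> y \<in> S" "z \<in> K" "y \<otimes> z = z \<otimes> y"
  shows "z = \<one> \<or> z = \<zeta>"
proof -
  have zc: "z \<in> carrier G" using assms(3) by (rule K_carrier)
  have "z \<otimes> y = inv z \<otimes> y" using inverts[OF assms(1-3)] assms(4) by simp
  then have "z = inv z" using zc assms(1) by simp
  then have "z \<otimes> z = \<one>" using zc G.r_inv by fastforce
  then show ?thesis by (rule involution[OF assms(3)])
qed

lemma zeta_pow: "\<zeta> [^] (n::nat) = (if odd n then \<zeta> else \<one>)"
  using zeta K_carrier[OF zeta(1)] by (induction n) auto

lemma kernel_pow:
  assumes "z = \<one> \<or> z = \<zeta>"
  shows "z [^] (n::nat) = (if odd n then z else \<one>)"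
  using assms zeta_pow by auto

lemma pow_in_kernel:
  assumes "y \<in> carrier G" "\<phi> y \<in> S" "\<phi> y [^]\<^bsub>L\<^esub> (n::nat) = \<one>\<^bsub>L\<^esub>"
  shows "y [^] n = \<one> \<or> y [^] n = \<zeta>"
proof (rule commuting_kernel_element[OF assms(1,2)])
  show "y [^] n \<in> K" using assms by (simp add: kernel_def hom_nat_pow)
  show "y \<otimes> y [^] n = y [^] n \<otimes> y" using assms(1) by (metis G.nat_pow_Suc G.nat_pow_Suc2)
qed

text \<open>For even \<open>n\<close> every lift of \<open>x\<close> gives the same answer, by
  \<open>neg_lift\<close>. In the application these are the elements whose scalar is -1.\<close>

definition neg :: "nat \<Rightarrow> 'b set" where
  "neg n = {x \<in> S. \<exists>y\<in>carrier G. \<phi> y = x \<and> y [^] n = \<zeta>}"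

text \<open>Two lifts differ by a kernel element \<open>z\<close>, and \<open>y\<close> inverts
  \<open>z\<close>, so \<open>(z y)(z y) = z (inv z) y y = y y\<close>. Thus lifts over
  \<open>S\<close> have equal squares, hence equal even powers.\<close>

lemma neg_lift:
  assumes n: "even n" and y: "y \<in> carrier G" "\<phi> y \<in> S"
  shows "\<phi> y \<in> neg n \<longleftrightarrow> y [^] n = \<zeta>"
proof
  assume "\<phi> y \<in> neg n"
  then obtain v where v: "v \<in> carrier G" "\<phi> v = \<phi> y" "v [^] n = \<zeta>" by (auto simp: neg_def)
  define z where "z = v \<otimes> inv y"
  have z: "z \<in> K" using v y by (simp add: z_def kernel_def)
  note zc = K_carrier[OF z]
  have vz: "v = z \<otimes> y" using v y by (simp add: z_def G.m_assoc)
  have "v \<otimes> v = z \<otimes> (y \<otimes> z) \<otimes> y" using zc y by (simp add: vz G.m_assoc)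
  also have "\<dots> = y \<otimes> y" unfolding inverts[OF y z] using zc y by (simp add: G.m_assoc G.inv_cancel)
  finally have sq: "v [^] (2::nat) = y [^] (2::nat)" using v y by (simp add: numeral_2_eq_2)
  obtain m where "n = 2 * m" using n by auto
  then show "y [^] n = \<zeta>" using v y sq by (metis G.nat_pow_pow)
qed (use assms in \<open>auto simp: neg_def\<close>)

lemma lift:
  assumes "x \<in> carrier L"
  obtains y where "y \<in> carrier G" "\<phi> y = x"
  using assms surj that by (metis imageE)

lemma neg_roots: "neg n \<subseteq> L.roots n"
proof
  fix x assume "x \<in> neg n"
  then obtain y where y: "x \<in> S" "y \<in> carrier G" "\<phi> y = x" "y [^] n = \<zeta>" by (auto simp: neg_def)
  have "\<phi> (y [^] n) = \<one>\<^bsub>L\<^esub>" using y(4) zeta(1) by (simp add: kernel_def)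
  then show "x \<in> L.roots n" using y S by (auto simp: L.roots_def hom_nat_pow)
qed

text \<open>\<open>\<zeta>\<close> is its own inverse, so elements that invert the kernel and
  elements that centralise it both commute with \<open>\<zeta>\<close>. Conjugating a lift therefore
  preserves its power \<open>\<zeta>\<close>.\<close>

lemma neg_conj:
  assumes g: "g \<in> carrier L" and x: "x \<in> neg n"
  shows "g \<otimes>\<^bsub>L\<^esub> x \<otimes>\<^bsub>L\<^esub> inv\<^bsub>L\<^esub> g \<in> neg n"
proof -
  obtain y where y: "x \<in> S" "y \<in> carrier G" "\<phi> y = x" "y [^] n = \<zeta>" using x by (auto simp: neg_def)
  obtain h where h: "h \<in> carrier G" "\<phi> h = g" using lift[OF g] .
  have xc: "x \<in> carrier L" using y S by auto
  have "inv\<^bsub>L\<^esub> g \<in> S \<longleftrightarrow> g \<in> S"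
    using S_mult[OF g L.inv_closed[OF g]] g one_notin_S by simp
  then have "g \<otimes>\<^bsub>L\<^esub> x \<otimes>\<^bsub>L\<^esub> inv\<^bsub>L\<^esub> g \<in> S" using g xc y(1) by (simp add: S_mult)
  moreover have "\<phi> (h \<otimes> y \<otimes> inv h) = g \<otimes>\<^bsub>L\<^esub> x \<otimes>\<^bsub>L\<^esub> inv\<^bsub>L\<^esub> g" using h y by simp
  moreover have "(h \<otimes> y \<otimes> inv h) [^] n = \<zeta>"
  proof -
    have zc: "\<zeta> \<in> carrier G" using zeta(1) by (rule K_carrier)
    have "inv \<zeta> = \<zeta>" using zeta(2) zc by (simp add: G.inv_equality)
    then have "h \<otimes> \<zeta> = \<zeta> \<otimes> h" using inverts[OF h(1) _ zeta(1)] centralises[OF h(1) _ zeta(1)] by (cases "\<phi> h \<in> S") auto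
    then have "h \<otimes> \<zeta> \<otimes> inv h = \<zeta>" using h zc by (simp add: G.m_assoc)
    then show ?thesis using h y by (simp add: G.conj_pow)
  qed
  ultimately show ?thesis using h y unfolding neg_def by blast
qed

text \<open>
  Commuting \<open>y\<close> and \<open>z\<close>, with \<open>y \<in> S\<close>, have commuting lifts: multiplying the lift of \<open>z\<close> by a kernel
  element changes the commutator by the square of that element.
\<close>

lemma neg_mult_odd_part:
  assumes r: "odd r" and y: "y \<in> L.roots (2 ^ Suc b)" and z: "z \<in> L.centralizer y \<inter> L.roots r"
  shows "y \<otimes>\<^bsub>L\<^esub> z \<in> neg (2 ^ Suc b * r) \<longleftrightarrow> y \<in> neg (2 ^ Suc b)"
proof (cases "y \<in> S")
  case False
  have c: "y \<in> carrier L" "z \<in> carrier L" "z [^]\<^bsub>L\<^esub> r = \<one>\<^bsub>L\<^esub>"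
    using y z by (auto simp: L.roots_def)
  then have "z \<notin> S" using S_pow[of z r] r one_notin_S by auto
  then show ?thesis using False c by (auto simp: neg_def S_mult)
next
  case True
  have c: "y \<in> carrier L" "z \<in> carrier L" "z [^]\<^bsub>L\<^esub> r = \<one>\<^bsub>L\<^esub>" "y [^]\<^bsub>L\<^esub> ((2::nat) ^ Suc b) = \<one>\<^bsub>L\<^esub>"
      "y \<otimes>\<^bsub>L\<^esub> z = z \<otimes>\<^bsub>L\<^esub> y"
    using y z by (auto simp: L.roots_def L.centralizer_def)
  have zS: "z \<notin> S" using c S_pow[of z r] r one_notin_S by auto
  obtain u where u: "u \<in> carrier G" "\<phi> u = y" using lift[OF c(1)] .
  obtain v where v: "v \<in> carrier G" "\<phi> v = z" using lift[OF c(2)] .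
  \<comment> \<open>The commutator \<open>k\<close> of the lifts is in the kernel. Replacing
    \<open>v\<close> by \<open>w = s \<otimes> v\<close> with \<open>s \<otimes> s = k\<close>
    removes it: moving \<open>u\<close> past \<open>s\<close> inverts \<open>s\<close>, and
    \<open>inv s \<otimes> k = s\<close>.\<close>
  define k where "k = (u \<otimes> v) \<otimes> inv (v \<otimes> u)"
  have k: "k \<in> K" using u v c by (simp add: k_def kernel_def)
  have uv: "u \<otimes> v = k \<otimes> (v \<otimes> u)" using u v by (simp add: k_def G.m_assoc)
  obtain s where s: "s \<in> K" "s \<otimes> s = k" using square[OF k] by blast
  note sc = K_carrier[OF s(1)]
  define w where "w = s \<otimes> v"
  have w: "w \<in> carrier G" "\<phi> w = z" using sc s(1) v by (auto simp: w_def kernel_def)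
  have "u \<otimes> w = (u \<otimes> s) \<otimes> v" using u v sc by (simp add: w_def G.m_assoc)
  also have "\<dots> = inv s \<otimes> (u \<otimes> v)" using inverts[OF u(1) _ s(1)] u v sc True by (simp add: G.m_assoc)
  also have "\<dots> = inv s \<otimes> (s \<otimes> s \<otimes> (v \<otimes> u))" using uv s(2) by simp
  also have "\<dots> = w \<otimes> u" using u v sc by (simp add: w_def G.m_assoc G.inv_cancel)
  finally have uw: "u \<otimes> w = w \<otimes> u" .
  have comm: "u \<otimes> w [^] (i::nat) = w [^] i \<otimes> u" for i
  proof (induction i)
    case (Suc i)
    have "u \<otimes> w [^] Suc i = (u \<otimes> w [^] i) \<otimes> w" using u w by (simp add: G.m_assoc)
    also have "\<dots> = w [^] Suc i \<otimes> u" unfolding Suc using u w uw by (simp add: G.m_assoc)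
    finally show ?case .
  qed (use u in simp)
  \<comment> \<open>As \<open>w [^] r\<close> lies in the kernel and commutes with \<open>u\<close>,
    it is \<open>\<one>\<close> or \<open>\<zeta>\<close>, and a further even power kills it. The
    odd exponent \<open>r\<close> leaves the power of \<open>u\<close>, also \<open>\<one>\<close>
    or \<open>\<zeta>\<close>, unchanged.\<close>
  have "w [^] r \<in> K" using w c by (simp add: kernel_def hom_nat_pow)
  then have "w [^] r = \<one> \<or> w [^] r = \<zeta>"
    using commuting_kernel_element[OF u(1)] u True comm by simp
  then have "(w [^] r) [^] ((2::nat) ^ Suc b) = \<one>" by (simp only: kernel_pow) simp
  then have wn: "w [^] ((2::nat) ^ Suc b * r) = \<one>" using w by (simp add: G.nat_pow_pow mult.commute)
  have "(u [^] ((2::nat) ^ Suc b)) [^] r = u [^] ((2::nat) ^ Suc b)"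
    using kernel_pow[OF pow_in_kernel[OF u(1)], of "2 ^ Suc b" r] u True c r by simp
  then have un: "u [^] ((2::nat) ^ Suc b * r) = u [^] ((2::nat) ^ Suc b)" using u by (simp add: G.nat_pow_pow)
  have "(u \<otimes> w) [^] ((2::nat) ^ Suc b * r) = u [^] ((2::nat) ^ Suc b)"
    using G.pow_mult_distrib[OF uw u(1) w(1), of "2 ^ Suc b * r"] un wn u by simp
  moreover have "\<phi> (u \<otimes> w) = y \<otimes>\<^bsub>L\<^esub> z" "u \<otimes> w \<in> carrier G" using u w by auto
  moreover have "y \<otimes>\<^bsub>L\<^esub> z \<in> S" using c True zS by (simp add: S_mult)
  ultimately show ?thesis
    using neg_lift[of "2 ^ Suc b * r" "u \<otimes> w"] neg_lift[of "2 ^ Suc b" u] u True by simp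
qed

text \<open>The sign is decided by the 2-part, so the count is a sum over 2-parts \<open>y\<close>
  of the number of \<open>r\<close>-th roots commuting with \<open>y\<close>. Each conjugacy class
  of such \<open>y\<close> contributes a multiple of \<open>r\<close>.\<close>

lemma odd_part_dvd_card_neg:
  assumes r: "odd r" and n: "2 ^ Suc b * r dvd order L"
  shows "r dvd card (neg (2 ^ Suc b * r))"
proof -
  have cop: "coprime (2 ^ Suc b) r" using r by simp
  have sub: "neg n \<subseteq> carrier L" for n using S by (auto simp: neg_def)
  have "card (neg (2 ^ Suc b * r)) = (\<Sum>y\<in>neg (2 ^ Suc b). card (L.centralizer y \<inter> L.roots r))"
    by (rule L.card_coprime_split[OF fin cop neg_roots neg_roots neg_mult_odd_part[OF r]])
  also have "r dvd \<dots>"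
  proof (rule L.dvd_sum_conj_invariant[OF fin sub neg_conj])
    show "card (L.centralizer (g \<otimes>\<^bsub>L\<^esub> x \<otimes>\<^bsub>L\<^esub> inv\<^bsub>L\<^esub> g) \<inter> L.roots r) = card (L.centralizer x \<inter> L.roots r)"
      if "g \<in> carrier L" "x \<in> neg (2 ^ Suc b)" for g x
      using that sub by (intro L.card_centralizer_roots_conj) auto
    show "r dvd card (L.conj_class x) * card (L.centralizer x \<inter> L.roots r)" if "x \<in> neg (2 ^ Suc b)" for x
      using that sub n by (intro L.dvd_card_conj_class_mult_roots[OF fin]) (auto dest: dvd_mult_right)
  qed
  finally show ?thesis .
qed

text \<open>If \<open>2 ^ Suc b\<close> did not divide the order of \<open>x\<close>, then
  \<open>2 ^ b * r\<close> would already bring a lift to \<open>\<one>\<close> or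
  \<open>\<zeta>\<close>, and squaring would give \<open>\<one>\<close> instead of
  \<open>\<zeta>\<close>. So \<open>2 ^ b\<close> divides the totient of the order, that is, the
  size of each block of generators.\<close>

lemma two_part_dvd_card_neg:
  assumes r: "odd r"
  shows "2 ^ b dvd card (neg (2 ^ Suc b * r))"
proof (rule L.dvd_card_generator_closed[OF fin])
  let ?n = "2 ^ Suc b * r"
  show "neg ?n \<subseteq> carrier L" using S by (auto simp: neg_def)
  have ord_even: "even (L.ord x)" if "x \<in> neg ?n" for x
  proof -
    have "x \<in> S" "x \<in> carrier L" using that S by (auto simp: neg_def)
    then show ?thesis using S_pow[of x "L.ord x"] one_notin_S by auto
  qed
  show "x [^]\<^bsub>L\<^esub> j \<in> neg ?n" if x: "x \<in> neg ?n" and j: "coprime j (L.ord x)" for x and j :: nat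
  proof -
    \<comment> \<open>Elements of \<open>S\<close> have even order, so an exponent coprime to the
      order is odd and keeps \<open>\<zeta>\<close> fixed.\<close>
    have "odd j" using ord_even[OF x] j by (metis coprime_common_divisor_nat odd_one even_Suc_div_two dvd_refl One_nat_def even_numeral numeral_One)
    obtain y where y: "x \<in> S" "y \<in> carrier G" "\<phi> y = x" "y [^] ?n = \<zeta>" using x by (auto simp: neg_def)
    have "(y [^] j) [^] ?n = (y [^] ?n) [^] j" using y(2) by (simp add: G.nat_pow_pow mult.commute)
    then have "(y [^] j) [^] ?n = \<zeta>" using y(4) zeta_pow \<open>odd j\<close> by simp
    moreover have "x [^]\<^bsub>L\<^esub> j \<in> S" using y S S_pow[of x j] \<open>odd j\<close> by auto
    ultimately show ?thesis using y unfolding neg_def by (auto simp: hom_nat_pow intro!: bexI[of _ "y [^] j"])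
  qed
  show "2 ^ b dvd totient (L.ord x)" if x: "x \<in> neg ?n" for x
  proof -
    obtain y where y: "x \<in> S" "y \<in> carrier G" "\<phi> y = x" "y [^] ?n = \<zeta>" using x by (auto simp: neg_def)
    have xc: "x \<in> carrier L" using y S by auto
    have dvd: "L.ord x dvd ?n" using subsetD[OF neg_roots x] xc
      by (simp add: L.roots_def L.pow_eq_id del: power_Suc)
    have "2 ^ Suc b dvd L.ord x"
    proof (rule ccontr)
      assume not: "\<not> 2 ^ Suc b dvd L.ord x"
      then have half: "L.ord x dvd 2 ^ b * r" by (rule dvd_prime_power_mult[OF two_is_prime_nat dvd])
      have "b \<noteq> 0" using ord_even[OF x] not by (cases b) auto
      have "\<phi> y [^]\<^bsub>L\<^esub> (2 ^ b * r) = \<one>\<^bsub>L\<^esub>" using half xc y by (simp add: L.pow_eq_id)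
      then have "y [^] (2 ^ b * r) = \<one> \<or> y [^] (2 ^ b * r) = \<zeta>" using pow_in_kernel y by simp
      then have "(y [^] (2 ^ b * r)) [^] (2::nat) = \<one>" using kernel_pow by simp
      then have "y [^] ?n = \<one>" using y(2) by (simp add: G.nat_pow_pow mult_ac)
      then show False using y(4) zeta(3) by simp
    qed
    then have "totient (2 ^ Suc b) dvd totient (L.ord x)" by (rule totient_dvd)
    then show ?thesis using totient_prime_power_Suc[OF two_is_prime_nat, of b] by simp
  qed
qed

text \<open>For \<open>n = 2 ^ Suc b * r\<close> with \<open>r\<close> odd, the coprime divisors
  \<open>2 ^ b\<close> and \<open>r\<close> of the count combine, and doubling restores the lost
  factor two.\<close>

theorem half_dvd_card_neg:
  assumes "even n" "n dvd order L"
  shows "n dvd 2 * card (neg n)"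
proof -
  have "order L \<noteq> 0" using fin L.order_gt_0_iff_finite by simp
  then have n0: "n \<noteq> 0" using assms(2) by auto
  obtain r where r: "n = 2 ^ multiplicity 2 n * r" "\<not> 2 dvd r"
    by (rule multiplicity_decompose'[of n 2]) (use n0 in auto)
  have "multiplicity 2 n \<noteq> 0" using assms(1) n0 by (simp add: multiplicity_eq_zero_iff)
  then obtain b where b: "n = 2 ^ Suc b * r" using r by (metis not0_implies_Suc)
  have "2 ^ b * r dvd card (neg n)"
    using r(2) assms(2) unfolding b
    by (intro divides_mult two_part_dvd_card_neg odd_part_dvd_card_neg) auto
  then have "2 * (2 ^ b * r) dvd 2 * card (neg n)" by (rule mult_dvd_mono[OF dvd_refl])
  then show ?thesis by (simp add: b mult.assoc)
qed

end

section \<open>Sweedler calculus\<close>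

text \<open>The coordinate functionals of a basis determine a vector. This carries identities tested
  by complex-valued forms over to vector-valued maps.\<close>

lemma functionals_separate:
  fixes s :: "complex \<Rightarrow> 'c::ab_group_add \<Rightarrow> 'c"
  assumes vs: "vector_space s" and eq: "\<And>\<phi>. Vector_Spaces.linear s (*) \<phi> \<Longrightarrow> \<phi> x = \<phi> y"
  shows "x = y"
proof -
  interpret vector_space s by (rule vs)
  define B where "B = extend_basis {}"
  have ind: "independent B" and sp: "span B = UNIV"
    unfolding B_def using independent_extend_basis[OF independent_empty]
      span_extend_basis[OF independent_empty] by auto
  have "representation B x b = representation B y b" for b
    by (rule eq[OF linear_representation[OF ind sp]])
  then have "representation B x = representation B y" by (rule ext)
  moreover have "v = (\<Sum>b | representation B v b \<noteq> 0. s (representation B v b) b)" for v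
    by (rule sum_nonzero_representation_eq[OF ind, symmetric]) (simp add: sp)
  ultimately show ?thesis by metis
qed

lemma sum_mset_additive:
  fixes f :: "'b::comm_monoid_add \<Rightarrow> 'c::comm_monoid_add"
  assumes "f 0 = 0" "\<And>x y. f (x + y) = f x + f y"
  shows "f (\<Sum>p\<in>#M. g p) = (\<Sum>p\<in>#M. f (g p))"
  using assms by (induction M) auto

lemma linear_vec:
  fixes f :: "'b::ab_group_add \<Rightarrow> 'c::ab_group_add"
  assumes "Vector_Spaces.linear s1 s2 f"
  shows "f (x + y) = f x + f y" "f (s1 c x) = s2 c (f x)" "f 0 = 0"
    "f (\<Sum>i\<in>I. h i) = (\<Sum>i\<in>I. f (h i))"
proof -
  interpret Vector_Spaces.linear s1 s2 f by (rule assms)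
  show "f (x + y) = f x + f y" "f (s1 c x) = s2 c (f x)" "f 0 = 0"
    "f (\<Sum>i\<in>I. h i) = (\<Sum>i\<in>I. f (h i))" by (simp_all add: add scale sum)
qed

section \<open>Sweedler sums and the actions of the dual algebra\<close>

context hopf_algebra begin

abbreviation sc where "sc \<equiv> hscale H"
abbreviation lf where "lf \<equiv> Vector_Spaces.linear (hscale H) ((*) :: complex \<Rightarrow> _)"
abbreviation lm where "lm \<equiv> Vector_Spaces.linear (hscale H) (hscale H)"

text \<open>Only for bilinear \<open>\<beta>\<close> is the value independent of the formal sum
  chosen for the coproduct; hence the bilinearity premises of the rules that use the Hopf
  axioms.\<close>

definition sweedler :: "('a \<Rightarrow> 'a \<Rightarrow> 'c::comm_monoid_add) \<Rightarrow> 'a \<Rightarrow> 'c" where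
  "sweedler \<beta> x = (\<Sum>(a,b)\<in>#comul H x. \<beta> a b)"

lemma vs: "vector_space (hscale H)" by (rule vector_space_axioms)

lemma bilI:
  fixes sU :: "complex \<Rightarrow> 'c::ab_group_add \<Rightarrow> 'c"
  assumes "vector_space sU"
    "\<And>a a' b. \<beta> (a + a') b = \<beta> a b + \<beta> a' b" "\<And>c a b. \<beta> (hscale H c a) b = sU c (\<beta> a b)"
    "\<And>a b b'. \<beta> a (b + b') = \<beta> a b + \<beta> a b'" "\<And>c a b. \<beta> a (hscale H c b) = sU c (\<beta> a b)"
  shows "bilinear_map (hscale H) (hscale H) sU \<beta>"
  using assms vs by (simp add: bilinear_map_def linear_iff')

lemma lmI:
  assumes "\<And>x y. f (x + y) = f x + f y" "\<And>c x. f (sc c x) = sc c (f x)"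
  shows "lm f"
  using assms vs by (simp add: linear_iff')

lemma lfI:
  assumes "\<And>x y. f (x + y) = f x + f y" "\<And>c x. f (sc c x) = c * f x"
  shows "lf f"
  using assms vs vector_space_complex by (simp add: linear_iff')

lemma scale_simps: "sc c (x + y) = sc c x + sc c y" "sc (c + d) x = sc c x + sc d x"
    "sc c (sc d x) = sc (c * d) x" "sc 1 x = x" "sc 0 x = 0" "sc c 0 = 0"
  by (simp_all add: scale_right_distrib scale_left_distrib)

lemma sweedler_fun_add: "sweedler (\<lambda>a b. \<beta> a b + \<gamma> a b) x = sweedler \<beta> x + sweedler \<gamma> x"
  by (simp add: sweedler_def case_prod_unfold sum_mset.distrib)

lemma sweedler_fun_0: "sweedler (\<lambda>a b. 0) x = 0"
  by (simp add: sweedler_def case_prod_unfold)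

lemma sweedler_fun_sum: "sweedler (\<lambda>a b. \<Sum>i\<in>I. \<beta> i a b) x = (\<Sum>i\<in>I. sweedler (\<beta> i) x)"
  by (induction I rule: infinite_finite_induct) (simp_all add: sweedler_fun_add sweedler_fun_0)

lemma sweedler_image:
  assumes "f 0 = 0" "\<And>x y. f (x + y) = f x + f y"
  shows "f (sweedler \<beta> x) = sweedler (\<lambda>a b. f (\<beta> a b)) x"
  using assms by (simp add: sweedler_def case_prod_unfold sum_mset_additive[of f])

lemma sweedler_linear:
  assumes "Vector_Spaces.linear s1 s2 f"
  shows "f (sweedler \<beta> x) = sweedler (\<lambda>a b. f (\<beta> a b)) x"
  using sweedler_image linear_vec[OF assms] by metis

lemma sweedler_mult_out:
  fixes \<beta> :: "'a \<Rightarrow> 'a \<Rightarrow> 'r::semiring_0"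
  shows "sweedler \<beta> x * r = sweedler (\<lambda>a b. \<beta> a b * r) x" "r * sweedler \<beta> x = sweedler (\<lambda>a b. r * \<beta> a b) x"
  by (rule sweedler_image[of "\<lambda>y. y * r"], simp, simp add: distrib_right)
    (rule sweedler_image[of "\<lambda>y. r * y"], simp, simp add: distrib_left)

lemma sweedler_add:
  assumes "bilinear_map (hscale H) (hscale H) sU \<beta>"
  shows "sweedler \<beta> (x + y) = sweedler \<beta> x + sweedler \<beta> y"
  unfolding sweedler_def using tensor_eq_lift[OF comul_add assms] by simp

lemma sweedler_scale:
  assumes b: "bilinear_map (hscale H) (hscale H) sU \<beta>"
  shows "sweedler \<beta> (sc c x) = sU c (sweedler \<beta> x)"
proof -
  have "Vector_Spaces.linear (hscale H) sU (\<lambda>a. \<beta> a 0)" using b by (simp add: bilinear_map_def)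
  then interpret U: vector_space sU by (simp add: linear_iff')
  have "sweedler \<beta> (sc c x) = (\<Sum>(a,b)\<in>#image_mset (\<lambda>(a,b). (sc c a, b)) (comul H x). \<beta> a b)"
    unfolding sweedler_def by (rule tensor_eq_lift[OF comul_scale b])
  also have "\<dots> = sweedler (\<lambda>a b. sU c (\<beta> a b)) x"
    by (simp add: sweedler_def image_mset.compositionality o_def case_prod_unfold bilinear_mapD[OF b])
  also have "\<dots> = sU c (sweedler \<beta> x)"
    by (rule sweedler_image[symmetric]) (simp_all add: U.scale_right_distrib)
  finally show ?thesis .
qed

lemma sweedler_0:
  assumes b: "bilinear_map (hscale H) (hscale H) sU \<beta>"
  shows "sweedler \<beta> 0 = 0"
  using sweedler_add[OF b, of 0 0] by simp

lemma sweedler_sweedler: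
  assumes b: "bilinear_map (hscale H) (hscale H) sU \<beta>"
  shows "sweedler \<beta> (sweedler \<gamma> x) = sweedler (\<lambda>a b. sweedler \<beta> (\<gamma> a b)) x"
  by (rule sweedler_image) (simp_all add: sweedler_0[OF b] sweedler_add[OF b])

lemma sweedler_mult:
  assumes b: "bilinear_map (hscale H) (hscale H) sU \<beta>"
  shows "sweedler \<beta> (x * y) = sweedler (\<lambda>a b. sweedler (\<lambda>c d. \<beta> (a * c) (b * d)) y) x"
  unfolding sweedler_def using tensor_eq_lift[OF comul_mult b]
  by (simp add: case_prod_unfold sum_mset_nested)

lemma sweedler_tensor_eq:
  assumes b: "bilinear_map (hscale H) (hscale H) sU \<beta>" and t: "tensor_eq (hscale H) (hscale H) (comul H x) M"
  shows "sweedler \<beta> x = (\<Sum>(a,b)\<in>#M. \<beta> a b)"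
  unfolding sweedler_def by (rule tensor_eq_lift[OF t b])

text \<open>\<open>coassoc\<close> speaks of complex-valued trilinear forms. Composing
  \<open>\<gamma>\<close> with all functionals extends it to vector-valued
  \<open>\<gamma>\<close>.\<close>

lemma sweedler_coassoc:
  fixes sU :: "complex \<Rightarrow> 'c::ab_group_add \<Rightarrow> 'c"
  assumes lin: "\<And>b c. Vector_Spaces.linear (hscale H) sU (\<lambda>a. \<gamma> a b c)"
    "\<And>a c. Vector_Spaces.linear (hscale H) sU (\<lambda>b. \<gamma> a b c)"
    "\<And>a b. Vector_Spaces.linear (hscale H) sU (\<lambda>c. \<gamma> a b c)"
  shows "sweedler (\<lambda>a b. sweedler (\<lambda>a1 a2. \<gamma> a1 a2 b) a) x = sweedler (\<lambda>a b. sweedler (\<lambda>b1 b2. \<gamma> a b1 b2) b) x"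
proof (rule functionals_separate)
  show "vector_space sU" using lin(1)[of 0 0] by (simp add: linear_iff')
  fix \<phi> assume \<phi>: "Vector_Spaces.linear sU (*) \<phi>"
  have "trilinear_form (hscale H) (\<lambda>a b c. \<phi> (\<gamma> a b c))"
    unfolding trilinear_form_def using linear_compose_form[OF lin(1) \<phi>] linear_compose_form[OF lin(2) \<phi>]
      linear_compose_form[OF lin(3) \<phi>] by blast
  then have "(\<Sum>(a,b)\<in>#comul H x. \<Sum>(a1,a2)\<in>#comul H a. \<phi> (\<gamma> a1 a2 b)) =
      (\<Sum>(a,b)\<in>#comul H x. \<Sum>(b1,b2)\<in>#comul H b. \<phi> (\<gamma> a b1 b2))"
    using coassoc[of x, unfolded tensor3_eq_def, rule_format, of "\<lambda>a b c. \<phi> (\<gamma> a b c)"]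
    by (simp add: case_prod_unfold sum_mset_nested)
  then show "\<phi> (sweedler (\<lambda>a b. sweedler (\<lambda>a1 a2. \<gamma> a1 a2 b) a) x) = \<phi> (sweedler (\<lambda>a b. sweedler (\<lambda>b1 b2. \<gamma> a b1 b2) b) x)"
    unfolding sweedler_linear[OF \<phi>] unfolding sweedler_def .
qed

text \<open>The multiplication of the dual algebra.\<close>

definition conv :: "('a \<Rightarrow> complex) \<Rightarrow> ('a \<Rightarrow> complex) \<Rightarrow> 'a \<Rightarrow> complex" where
  "conv \<phi> \<psi> = sweedler (\<lambda>a b. \<phi> a * \<psi> b)"

text \<open>\<open>ract\<close> and \<open>lact\<close> are the two commuting actions of the dual
  algebra on \<open>H\<close>, evaluating the right and the left tensor factor of the coproduct
  respectively.\<close>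

definition ract :: "('a \<Rightarrow> complex) \<Rightarrow> 'a \<Rightarrow> 'a" where
  "ract \<phi> = sweedler (\<lambda>a b. sc (\<phi> b) a)"

definition lact :: "('a \<Rightarrow> complex) \<Rightarrow> 'a \<Rightarrow> 'a" where
  "lact \<phi> = sweedler (\<lambda>a b. sc (\<phi> a) b)"

lemma bil_conv: "lf \<phi> \<Longrightarrow> lf \<psi> \<Longrightarrow> bilinear_map (hscale H) (hscale H) (*) (\<lambda>a b. \<phi> a * \<psi> b)"
  by (rule bilI[OF vector_space_complex]) (simp_all add: linear_vec distrib_left distrib_right)

lemma bil_ract: "lf \<phi> \<Longrightarrow> bilinear_map (hscale H) (hscale H) (hscale H) (\<lambda>a b. sc (\<phi> b) a)"
  by (rule bilI[OF vs]) (simp_all add: linear_vec scale_simps mult.commute)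

lemma bil_lact: "lf \<phi> \<Longrightarrow> bilinear_map (hscale H) (hscale H) (hscale H) (\<lambda>a b. sc (\<phi> a) b)"
  by (rule bilI[OF vs]) (simp_all add: linear_vec scale_simps mult.commute)

lemma lf_conv: "lf \<phi> \<Longrightarrow> lf \<psi> \<Longrightarrow> lf (conv \<phi> \<psi>)"
  unfolding conv_def using sweedler_add[OF bil_conv] sweedler_scale[OF bil_conv] by (intro lfI)

lemma lm_ract: "lf \<phi> \<Longrightarrow> lm (ract \<phi>)"
  unfolding ract_def using sweedler_add[OF bil_ract] sweedler_scale[OF bil_ract] by (intro lmI)

lemma lm_lact: "lf \<phi> \<Longrightarrow> lm (lact \<phi>)"
  unfolding lact_def using sweedler_add[OF bil_lact] sweedler_scale[OF bil_lact] by (intro lmI)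

lemma bil_lin:
  assumes b: "bilinear_map (hscale H) (hscale H) sU \<beta>" and "lm f" "lm g"
  shows "bilinear_map (hscale H) (hscale H) sU (\<lambda>a b. \<beta> (f a) (g b))"
proof -
  have "Vector_Spaces.linear (hscale H) sU (\<lambda>a. \<beta> a 0)" using b by (simp add: bilinear_map_def)
  then have "vector_space sU" by (simp add: linear_iff')
  then show ?thesis
    by (rule bilI) (simp_all add: bilinear_mapD[OF b] linear_vec[OF assms(2)] linear_vec[OF assms(3)])
qed

lemma lm_id: "lm (\<lambda>x. x)" by (rule lmI) auto

lemma bil_vs: "bilinear_map (hscale H) (hscale H) sU \<beta> \<Longrightarrow> vector_space sU"
  by (auto simp: bilinear_map_def linear_iff')

text \<open>Coassociativity in usable form: a functional on an outer factor of the threefold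
  coproduct may be evaluated before or after splitting off the other outer factor.\<close>

lemma
  fixes sU :: "complex \<Rightarrow> 'c::ab_group_add \<Rightarrow> 'c"
  assumes b: "bilinear_map (hscale H) (hscale H) sU \<beta>" and \<phi>: "lf \<phi>"
  shows sweedler_ract: "sweedler \<beta> (ract \<phi> x) = sweedler (\<lambda>a b. \<beta> a (ract \<phi> b)) x"
    and sweedler_lact: "sweedler \<beta> (lact \<phi> x) = sweedler (\<lambda>a b. \<beta> (lact \<phi> a) b) x"
proof -
  interpret U: vector_space sU by (rule bil_vs[OF b])
  note D = bilinear_mapD[OF b]
  have U_out: "sU c (sweedler \<gamma> y) = sweedler (\<lambda>a b. sU c (\<gamma> a b)) y" for c \<gamma> y
    by (rule sweedler_image) (simp_all add: U.scale_right_distrib)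
  have \<beta>_out1: "\<beta> (sweedler \<gamma> y) z = sweedler (\<lambda>a b. \<beta> (\<gamma> a b) z) y" for \<gamma> y z
    by (rule sweedler_image) (simp_all add: D)
  have \<beta>_out2: "\<beta> z (sweedler \<gamma> y) = sweedler (\<lambda>a b. \<beta> z (\<gamma> a b)) y" for \<gamma> y z
    by (rule sweedler_image) (simp_all add: D)
  have uvs: "vector_space sU" by (rule bil_vs[OF b])
  have lin: "Vector_Spaces.linear (hscale H) sU (\<lambda>z. sU (\<phi> a) (\<beta> b z))"
    "Vector_Spaces.linear (hscale H) sU (\<lambda>z. sU (\<phi> a) (\<beta> z b))"
    "Vector_Spaces.linear (hscale H) sU (\<lambda>z. sU (\<phi> z) (\<beta> a b))" for a b
    using \<phi> by (auto simp: linear_iff' vs uvs D U.scale_right_distrib U.scale_left_distrib mult.commute)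
  have "sweedler \<beta> (ract \<phi> x) = sweedler (\<lambda>a b. sweedler (\<lambda>a1 a2. sU (\<phi> b) (\<beta> a1 a2)) a) x"
    unfolding ract_def sweedler_sweedler[OF b] sweedler_scale[OF b] U_out ..
  also have "\<dots> = sweedler (\<lambda>a b. sweedler (\<lambda>b1 b2. sU (\<phi> b2) (\<beta> a b1)) b) x"
    by (rule sweedler_coassoc[of sU "\<lambda>a b c. sU (\<phi> c) (\<beta> a b)"]) (rule lin)+
  finally show "sweedler \<beta> (ract \<phi> x) = sweedler (\<lambda>a b. \<beta> a (ract \<phi> b)) x"
    unfolding ract_def \<beta>_out2 D .
  have "sweedler \<beta> (lact \<phi> x) = sweedler (\<lambda>a b. sweedler (\<lambda>b1 b2. sU (\<phi> a) (\<beta> b1 b2)) b) x"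
    unfolding lact_def sweedler_sweedler[OF b] sweedler_scale[OF b] U_out ..
  also have "\<dots> = sweedler (\<lambda>a b. sweedler (\<lambda>a1 a2. sU (\<phi> a1) (\<beta> a2 b)) a) x"
    by (rule sweedler_coassoc[of sU "\<lambda>a b c. sU (\<phi> a) (\<beta> b c)", symmetric]) (rule lin)+
  finally show "sweedler \<beta> (lact \<phi> x) = sweedler (\<lambda>a b. \<beta> (lact \<phi> a) b) x"
    unfolding lact_def \<beta>_out1 D .
qed

lemma functional_ract: "lf \<phi> \<Longrightarrow> \<phi> (ract \<psi> x) = conv \<phi> \<psi> x"
  unfolding ract_def conv_def by (subst sweedler_linear, assumption) (simp add: linear_vec mult.commute)

lemma functional_lact: "lf \<phi> \<Longrightarrow> \<phi> (lact \<psi> x) = conv \<psi> \<phi> x"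
  unfolding lact_def conv_def by (subst sweedler_linear, assumption) (simp add: linear_vec)

lemma conv_ract: "lf \<phi> \<Longrightarrow> lf \<psi> \<Longrightarrow> lf \<chi> \<Longrightarrow> conv \<phi> \<psi> (ract \<chi> x) = conv \<phi> (conv \<psi> \<chi>) x"
  unfolding conv_def[of \<phi> \<psi>] by (subst sweedler_ract[OF bil_conv], assumption+)
    (simp add: functional_ract conv_def)

lemma ract_ract: "lf \<phi> \<Longrightarrow> lf \<psi> \<Longrightarrow> ract \<phi> (ract \<psi> x) = ract (conv \<phi> \<psi>) x"
  by (subst (1) ract_def, subst sweedler_ract[OF bil_ract], assumption+)
    (simp add: functional_ract, simp add: ract_def)

lemma ract_lact:
  assumes "lf \<phi>" "lf \<psi>"
  shows "ract \<phi> (lact \<psi> x) = lact \<psi> (ract \<phi> x)"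
proof -
  have "ract \<phi> (lact \<psi> x) = sweedler (\<lambda>a b. sc (\<phi> b) (lact \<psi> a)) x"
    using sweedler_lact[OF bil_ract[OF assms(1)] assms(2)] by (simp add: ract_def)
  also have "\<dots> = lact \<psi> (ract \<phi> x)"
    unfolding ract_def using sweedler_linear[OF lm_lact[OF assms(2)]] linear_vec[OF lm_lact[OF assms(2)]] by simp
  finally show ?thesis .
qed

lemma conv_assoc:
  assumes "lf \<phi>" "lf \<psi>" "lf \<chi>"
  shows "conv (conv \<phi> \<psi>) \<chi> x = conv \<phi> (conv \<psi> \<chi>) x"
proof -
  have "conv (conv \<phi> \<psi>) \<chi> x = conv \<phi> \<psi> (ract \<chi> x)"
    using functional_ract[OF lf_conv[OF assms(1,2)]] by simp
  then show ?thesis using conv_ract[OF assms] by simp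
qed

lemma lf_counit: "lf (counit H)" by (rule counit_linear)

lemma ract_counit: "ract (counit H) x = x"
  unfolding ract_def sweedler_def by (rule counit_right)

lemma lact_counit: "lact (counit H) x = x"
  unfolding lact_def sweedler_def by (rule counit_left)

lemma ract_add: "ract (\<lambda>x. \<phi> x + \<psi> x) x = ract \<phi> x + ract \<psi> x"
  by (simp add: ract_def scale_simps sweedler_fun_add)

end

section \<open>Extensions of the group algebra of order two\<close>

lemma UNIV_bit: "(UNIV :: bit set) = {0, 1}"
proof (intro equalityI subsetI)
  show "x \<in> {0, 1}" for x :: bit by (cases x) auto
qed simp

lemma lookup_mult_bit:
  fixes p q :: "bit \<Rightarrow>\<^sub>0 complex"
  shows "Poly_Mapping.lookup (p * q) 0 =
      Poly_Mapping.lookup p 0 * Poly_Mapping.lookup q 0 + Poly_Mapping.lookup p 1 * Poly_Mapping.lookup q 1"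
    and "Poly_Mapping.lookup (p * q) 1 =
      Poly_Mapping.lookup p 0 * Poly_Mapping.lookup q 1 + Poly_Mapping.lookup p 1 * Poly_Mapping.lookup q 0"
proof -
  have "p * q = (\<Sum>x\<in>UNIV. Poly_Mapping.single x (Poly_Mapping.lookup p x)) *
      (\<Sum>x\<in>UNIV. Poly_Mapping.single x (Poly_Mapping.lookup q x))"
    using sum_expand_single[of p] sum_expand_single[of q] by simp
  then have pq: "p * q = Poly_Mapping.single 0 (Poly_Mapping.lookup p 0 * Poly_Mapping.lookup q 0 + Poly_Mapping.lookup p 1 * Poly_Mapping.lookup q 1)
      + Poly_Mapping.single 1 (Poly_Mapping.lookup p 0 * Poly_Mapping.lookup q 1 + Poly_Mapping.lookup p 1 * Poly_Mapping.lookup q 0)"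
    by (simp add: UNIV_bit distrib_left distrib_right mult_single single_add)
  show "Poly_Mapping.lookup (p * q) 0 =
      Poly_Mapping.lookup p 0 * Poly_Mapping.lookup q 0 + Poly_Mapping.lookup p 1 * Poly_Mapping.lookup q 1"
    "Poly_Mapping.lookup (p * q) 1 =
      Poly_Mapping.lookup p 0 * Poly_Mapping.lookup q 1 + Poly_Mapping.lookup p 1 * Poly_Mapping.lookup q 0"
    by (subst pq, simp add: lookup_add lookup_single when_def)+
qed

section \<open>The two gradings of \<open>H\<close> by the group of order two\<close>

locale Z2_extension = hopf_algebra H for H :: "'a::ring_1 hopf" +
  fixes \<iota> :: "('g::{group_add,finite} \<Rightarrow> complex) \<Rightarrow> 'a" and \<pi> :: "'a \<Rightarrow> (bit \<Rightarrow>\<^sub>0 complex)"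
  assumes exact: "exact_hopf_sequence dual_group_algebra \<iota> H \<pi> group_algebra"
begin

lemma
  shows iota_linear: "Vector_Spaces.linear (hscale dual_group_algebra) (hscale H) \<iota>"
    and iota_mult: "\<iota> (f * g) = \<iota> f * \<iota> g" and iota_1: "\<iota> 1 = 1"
    and iota_comul: "tensor_eq (hscale H) (hscale H) (comul H (\<iota> f)) (image_mset (map_prod \<iota> \<iota>) (comul dual_group_algebra f))"
    and iota_counit: "counit H (\<iota> f) = f 0"
    and inj_iota: "inj \<iota>"
    and pi_linear: "Vector_Spaces.linear (hscale H) (hscale group_algebra) \<pi>"
    and pi_mult: "\<pi> (x * y) = \<pi> x * \<pi> y" and pi_1: "\<pi> 1 = 1"
    and pi_comul: "tensor_eq (hscale group_algebra) (hscale group_algebra) (comul group_algebra (\<pi> x)) (image_mset (map_prod \<pi> \<pi>) (comul H x))"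
    and pi_counit: "counit group_algebra (\<pi> x) = counit H x"
    and surj_pi: "surj \<pi>"
    and ker_pi: "{a. \<pi> a = 0} = span {a * \<iota> k |a k. counit (dual_group_algebra :: ('g \<Rightarrow> complex) hopf) k = 0}"
    and range_iota: "range \<iota> = {a. tensor_eq (hscale H) (hscale group_algebra)
                       (image_mset (map_prod id \<pi>) (comul H a)) {#(a, 1)#}}"
  using exact unfolding exact_hopf_sequence_def hopf_hom_def by (auto simp: dual_group_algebra_def)

text \<open>The coordinates of the projection. They are orthogonal idempotents of the dual algebra
  with sum the counit, so their actions on \<open>H\<close> are complementary projections.\<close>

definition \<rho> :: "bit \<Rightarrow> 'a \<Rightarrow> complex" where "\<rho> i x = Poly_Mapping.lookup (\<pi> x) i"

lemma hscale_group_algebra: "Poly_Mapping.lookup (hscale group_algebra c p) i = c * Poly_Mapping.lookup p (i::bit)"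
  by (simp add: group_algebra_def lookup_scale_single)

lemma lf_rho [simp]: "lf (\<rho> i)"
  by (rule lfI) (simp_all add: \<rho>_def linear_vec[OF pi_linear] lookup_add hscale_group_algebra)

lemma rho_counit: "\<rho> 0 x + \<rho> 1 x = counit H x"
  unfolding pi_counit[symmetric] by (simp add: \<rho>_def group_algebra_def UNIV_bit)

lemma rho_mult: "\<rho> 0 (x * y) = \<rho> 0 x * \<rho> 0 y + \<rho> 1 x * \<rho> 1 y"
    "\<rho> 1 (x * y) = \<rho> 0 x * \<rho> 1 y + \<rho> 1 x * \<rho> 0 y"
  by (simp_all add: \<rho>_def pi_mult lookup_mult_bit)

text \<open>\<open>\<pi>\<close> respects coproducts and group elements are grouplike, so the
  coordinates of the group algebra multiply pointwise.\<close>

lemma conv_rho: "conv (\<rho> i) (\<rho> j) x = (if i = j then \<rho> i x else 0)"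
proof -
  have b: "bilinear_map (hscale (group_algebra :: (bit \<Rightarrow>\<^sub>0 complex) hopf)) (hscale group_algebra) (*)
      (\<lambda>p q. Poly_Mapping.lookup p i * Poly_Mapping.lookup q j)"
    using pi_linear vector_space_complex
    by (auto simp: bilinear_map_def linear_iff' lookup_add hscale_group_algebra distrib_left distrib_right)
  have "conv (\<rho> i) (\<rho> j) x =
      (\<Sum>(p,q)\<in>#image_mset (map_prod \<pi> \<pi>) (comul H x). Poly_Mapping.lookup p i * Poly_Mapping.lookup q j)"
    by (simp add: conv_def sweedler_def \<rho>_def image_mset.compositionality o_def case_prod_unfold)
  also have "\<dots> = (\<Sum>(p,q)\<in>#comul group_algebra (\<pi> x). Poly_Mapping.lookup p i * Poly_Mapping.lookup q j)"
    by (rule tensor_eq_lift[OF pi_comul b, symmetric])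
  also have "\<dots> = (\<Sum>z\<in>UNIV. Poly_Mapping.lookup (Poly_Mapping.single z (\<rho> z x)) i *
      Poly_Mapping.lookup (Poly_Mapping.single z 1) j)"
    by (simp add: group_algebra_def image_mset.compositionality o_def case_prod_unfold \<rho>_def
        sum_unfold_sum_mset[symmetric])
  also have "\<dots> = (if i = j then \<rho> i x else 0)"
    by (cases i; cases j) (simp_all add: UNIV_bit lookup_single when_def)
  finally show ?thesis .
qed

text \<open>\<open>p\<close> and \<open>q\<close> project onto the homogeneous components for the
  right and left coaction of the group algebra; index 1 is the odd component.\<close>

abbreviation p where "p i \<equiv> ract (\<rho> i)"
abbreviation q where "q i \<equiv> lact (\<rho> i)"

lemmas p_vec [simp] = linear_vec[OF lm_ract[OF lf_rho]]
lemmas q_vec [simp] = linear_vec[OF lm_lact[OF lf_rho]]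

lemma p_p: "p i (p j x) = (if i = j then p i x else 0)"
proof -
  have "conv (\<rho> i) (\<rho> j) = (\<lambda>x. if i = j then \<rho> i x else 0)" using conv_rho by blast
  then have "p i (p j x) = ract (\<lambda>x. if i = j then \<rho> i x else 0) x" by (simp add: ract_ract)
  then show ?thesis by (auto simp: ract_def scale_simps sweedler_fun_0)
qed

lemma q_q: "q i (q j x) = (if i = j then q i x else 0)"
proof -
  have "conv (\<rho> j) (\<rho> i) = (\<lambda>x. if i = j then \<rho> i x else 0)" using conv_rho by auto
  moreover have "q i (q j x) = lact (conv (\<rho> j) (\<rho> i)) x"
    using sweedler_lact[OF bil_lact[OF lf_rho] lf_rho, of i j x] by (simp add: lact_def[of "\<rho> i"] functional_lact lact_def[of "conv (\<rho> j) (\<rho> i)"])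
  ultimately have "q i (q j x) = lact (\<lambda>x. if i = j then \<rho> i x else 0) x" by simp
  then show ?thesis by (auto simp: lact_def scale_simps sweedler_fun_0)
qed

lemma p_q: "p i (q j x) = q j (p i x)" by (simp add: ract_lact)

lemma p_sum: "p 0 x + p 1 x = x"
proof -
  have "(\<lambda>x. \<rho> 0 x + \<rho> 1 x) = counit H" using rho_counit by auto
  then show ?thesis using ract_add[of "\<rho> 0" "\<rho> 1" x] ract_counit by simp
qed

lemma sweedler_prod:
  "sweedler (\<lambda>a b. sweedler (\<lambda>c d. sc (\<phi> b * \<psi> d) (a * c)) y) x = ract \<phi> x * ract \<psi> y"
  "sweedler (\<lambda>a b. sweedler (\<lambda>c d. sc (\<phi> a * \<psi> c) (b * d)) y) x = lact \<phi> x * lact \<psi> y"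
  by (simp only: ract_def lact_def, subst sweedler_mult_out(1),
      simp add: sweedler_mult_out(2) scale_mult_left scale_mult_right scale_simps mult.commute)+

lemma p_mult: "p 0 (x * y) = p 0 x * p 0 y + p 1 x * p 1 y"
    "p 1 (x * y) = p 0 x * p 1 y + p 1 x * p 0 y"
  by (subst ract_def, subst sweedler_mult[OF bil_ract[OF lf_rho]],
      simp add: rho_mult scale_simps sweedler_fun_add sweedler_prod)+

lemma q_mult: "q 0 (x * y) = q 0 x * q 0 y + q 1 x * q 1 y"
    "q 1 (x * y) = q 0 x * q 1 y + q 1 x * q 0 y"
  by (subst lact_def, subst sweedler_mult[OF bil_lact[OF lf_rho]],
      simp add: rho_mult scale_simps sweedler_fun_add sweedler_prod)+

text \<open>In the basis of the group algebra, the coaction of \<open>x\<close> is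
  \<open>p 0 x\<close> tensor the unit plus \<open>p 1 x\<close> tensor the generator. Coinvariance,
  which is exactness in the middle, thus means that \<open>x\<close> is even.\<close>

lemma range_iota_iff: "x \<in> range \<iota> \<longleftrightarrow> p 0 x = x"
proof
  assume "x \<in> range \<iota>"
  then have t: "tensor_eq (hscale H) (hscale group_algebra) (image_mset (map_prod id \<pi>) (comul H x)) {#(x, 1)#}"
    unfolding range_iota by simp
  have b: "bilinear_map (hscale H) (hscale (group_algebra :: (bit \<Rightarrow>\<^sub>0 complex) hopf)) (hscale H)
      (\<lambda>a b. sc (Poly_Mapping.lookup b 0) a)"
    using pi_linear by (auto simp: bilinear_map_def linear_iff' vs scale_simps lookup_add hscale_group_algebra mult.commute)
  have one: "Poly_Mapping.lookup (1 :: bit \<Rightarrow>\<^sub>0 complex) 0 = 1"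
    by (metis lookup_single_eq single_one)
  show "p 0 x = x"
    using tensor_eq_lift[OF t b]
    by (simp add: ract_def sweedler_def \<rho>_def image_mset.compositionality o_def case_prod_unfold one)
next
  assume px: "p 0 x = x"
  have p1: "p 1 x = 0" using p_p[of 1 0 x] px by simp
  have "tensor_eq (hscale H) (hscale group_algebra) (image_mset (map_prod id \<pi>) (comul H x)) {#(x, 1)#}"
    unfolding tensor_eq_def
  proof (intro allI impI)
    fix \<beta> :: "'a \<Rightarrow> (bit \<Rightarrow>\<^sub>0 complex) \<Rightarrow> complex"
    assume b: "bilinear_map (hscale H) (hscale group_algebra) (*) \<beta>"
    let ?e = "\<lambda>i. Poly_Mapping.single i 1 :: bit \<Rightarrow>\<^sub>0 complex"
    have ex: "\<beta> a (\<pi> y) = \<beta> (sc (\<rho> 0 y) a) (?e 0) + \<beta> (sc (\<rho> 1 y) a) (?e 1)" for a y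
    proof -
      have "\<pi> y = hscale group_algebra (\<rho> 0 y) (?e 0) + hscale group_algebra (\<rho> 1 y) (?e 1)"
        by (subst sum_expand_single) (simp add: UNIV_bit \<rho>_def group_algebra_def mult_single)
      then show ?thesis by (simp add: bilinear_mapD[OF b])
    qed
    have out: "sweedler (\<lambda>a b. \<beta> (\<gamma> a b) z) x = \<beta> (sweedler \<gamma> x) z" for \<gamma> z
      by (rule sweedler_image[symmetric]) (simp_all add: bilinear_mapD[OF b])
    have "(\<Sum>(a,y)\<in>#image_mset (map_prod id \<pi>) (comul H x). \<beta> a y) = sweedler (\<lambda>a y. \<beta> a (\<pi> y)) x"
      by (simp add: sweedler_def image_mset.compositionality o_def case_prod_unfold)
    also have "\<dots> = \<beta> (p 0 x) (?e 0) + \<beta> (p 1 x) (?e 1)"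
      unfolding ex sweedler_fun_add out by (simp add: ract_def)
    also have "\<dots> = \<beta> x 1" using px p1 by (simp add: bilinear_mapD[OF b])
    finally show "(\<Sum>(a,y)\<in>#image_mset (map_prod id \<pi>) (comul H x). \<beta> a y) = (\<Sum>(a,y)\<in>#{#(x, 1)#}. \<beta> a y)" by simp
  qed
  then show "x \<in> range \<iota>" unfolding range_iota by simp
qed

section \<open>The idempotents of the dual group algebra inside \<open>H\<close>\<close>

definition E :: "'g \<Rightarrow> 'a" where "E g = \<iota> (point_mass g)"

lemma EE: "E a * E b = (if a = b then E a else 0)"
  by (simp add: E_def iota_mult[symmetric] point_mass_simps linear_vec[OF iota_linear])

lemma EEx: "E a * (E b * x) = (if a = b then E a * x else 0)"
  by (simp add: mult.assoc[symmetric] EE)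

lemma E_nonzero: "E a \<noteq> 0"
proof
  assume "E a = 0"
  then have "point_mass a = 0" unfolding E_def using inj_iota linear_vec(3)[OF iota_linear] by (metis injD)
  then have "point_mass a a = 0" by simp
  then show False by (simp add: point_mass_def)
qed

lemma sum_E: "(\<Sum>g\<in>UNIV. E g) = 1"
proof -
  have "(1 :: 'g \<Rightarrow> complex) = (\<Sum>g\<in>UNIV. point_mass g)"
    by (simp add: fun_eq_iff sum_fun_apply point_mass_def)
  then have "\<iota> 1 = \<iota> (\<Sum>g\<in>UNIV. point_mass g)" by (rule arg_cong)
  also have "\<dots> = (\<Sum>g\<in>UNIV. \<iota> (point_mass g))" by (rule linear_vec(4)[OF iota_linear])
  finally have "\<iota> 1 = (\<Sum>g\<in>UNIV. \<iota> (point_mass g))" .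
  then show ?thesis by (simp add: E_def iota_1)
qed

lemma sum_Ex: "(\<Sum>g\<in>UNIV. E g * x) = x"
  using sum_E by (simp add: sum_distrib_right[symmetric])

lemma sum_xE: "(\<Sum>g\<in>UNIV. x * E g) = x"
  using sum_E by (simp add: sum_distrib_left[symmetric])

lemma iota_E: "E a * \<iota> f = sc (f a) (E a)" "\<iota> f * E a = sc (f a) (E a)"
proof -
  have "point_mass a * f = hscale dual_group_algebra (f a) (point_mass a)"
    "f * point_mass a = hscale dual_group_algebra (f a) (point_mass a)"
    by (auto simp: fun_eq_iff dual_group_algebra_def point_mass_def)
  then show "E a * \<iota> f = sc (f a) (E a)" "\<iota> f * E a = sc (f a) (E a)"
    unfolding E_def iota_mult[symmetric] by (simp_all add: linear_vec[OF iota_linear])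
qed

lemma p_E [simp]: "p 0 (E g) = E g" "p 1 (E g) = 0"
proof -
  show "p 0 (E g) = E g" using range_iota_iff[of "E g"] by (simp add: E_def)
  then show "p 1 (E g) = 0" using p_p[of 1 0 "E g"] by simp
qed

lemma sweedler_E:
  assumes b: "bilinear_map (hscale H) (hscale H) sU \<beta>"
  shows "sweedler \<beta> (E g) = (\<Sum>a\<in>UNIV. \<beta> (E a) (E (- a + g)))"
proof -
  interpret U: vector_space sU by (rule bil_vs[OF b])
  have "sweedler \<beta> (E g) = (\<Sum>(a,b)\<in>#comul dual_group_algebra (point_mass g). \<beta> (\<iota> a) (\<iota> b))"
    unfolding E_def using sweedler_tensor_eq[OF b iota_comul]
    by (simp add: image_mset.compositionality o_def case_prod_unfold map_prod_def)
  also have "\<dots> = (\<Sum>a\<in>UNIV. \<Sum>h\<in>UNIV. sU (point_mass g (a + h)) (\<beta> (E a) (E h)))"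
    unfolding comul_dual_group_algebra_sum
    by (simp add: linear_vec[OF iota_linear] bilinear_mapD[OF b] E_def)
  also have "\<dots> = (\<Sum>a\<in>UNIV. \<Sum>h\<in>UNIV. if h = - a + g then \<beta> (E a) (E h) else 0)"
  proof (intro sum.cong refl)
    fix a h :: 'g
    have "a + h = g \<longleftrightarrow> h = - a + g" by (metis add_minus_cancel minus_add_cancel)
    then show "sU (point_mass g (a + h)) (\<beta> (E a) (E h)) = (if h = - a + g then \<beta> (E a) (E h) else 0)"
      by (simp add: point_mass_def)
  qed
  finally show ?thesis by simp
qed

lemma counit_E: "counit H (E g) = (if g = 0 then 1 else 0)"
  by (simp add: E_def iota_counit point_mass_def)

text \<open>For \<open>h\<close> different from 0 the point mass has counit 0, so exactness puts
  \<open>E h\<close> into the kernel of \<open>\<pi>\<close>. Since the idempotents sum to 1,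
  \<open>E 0\<close> is sent to 1.\<close>

lemma pi_E: "\<pi> (E g) = (if g = 0 then 1 else 0)"
proof -
  have *: "\<pi> (E h) = 0" if "h \<noteq> 0" for h
  proof -
    have "counit (dual_group_algebra :: ('g \<Rightarrow> complex) hopf) (point_mass h) = 0"
      using that by (simp add: dual_group_algebra_def point_mass_def)
    then have "1 * \<iota> (point_mass h) \<in> span {a * \<iota> k |a k. counit (dual_group_algebra :: ('g \<Rightarrow> complex) hopf) k = 0}"
      by (intro span_base) blast
    then show ?thesis unfolding ker_pi[symmetric] by (simp add: E_def)
  qed
  have "1 = (\<Sum>h\<in>UNIV. \<pi> (E h))"
    using sum_E pi_1 linear_vec(4)[OF pi_linear, of E UNIV] by simp
  also have "\<dots> = (\<Sum>h\<in>UNIV. if h = (0::'g) then \<pi> (E 0) else 0)"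
    by (intro sum.cong) (auto simp: *)
  also have "\<dots> = \<pi> (E 0)" by simp
  finally have "\<pi> (E 0) = 1" by (rule sym)
  then show ?thesis using * by (cases "g = 0") simp_all
qed

lemma q_E [simp]: "q 0 (E g) = E g" "q 1 (E g) = 0"
proof -
  have r: "\<rho> i (E a) = (if a = 0 then if i = 0 then 1 else 0 else 0)" for i a
    by (simp add: \<rho>_def pi_E lookup_one when_def)
  have "q i (E g) = (\<Sum>a\<in>UNIV. if a = (0::'g) then if i = 0 then E g else 0 else 0)" for i
    unfolding lact_def sweedler_E[OF bil_lact[OF lf_rho]] r by (intro sum.cong) (auto simp: scale_simps)
  then show "q 0 (E g) = E g" "q 1 (E g) = 0" by simp_all
qed

lemma kernel_expansion:
  assumes "p 0 x = x"
  obtains f where "x = (\<Sum>a\<in>UNIV. sc (f a) (E a))"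
proof -
  obtain f where f: "x = \<iota> f" using assms range_iota_iff[of x] by auto
  have "x = (\<Sum>a\<in>UNIV. E a * x)" by (rule sum_Ex[symmetric])
  also have "\<dots> = (\<Sum>a\<in>UNIV. sc (f a) (E a))" by (simp add: f iota_E)
  finally show thesis by (rule that)
qed

lemma kernel_scalar:
  assumes "p 0 x = x"
  obtains f where "\<And>a. E a * x = sc (f a) (E a)"
proof -
  obtain f where "x = \<iota> f" using assms range_iota_iff[of x] by auto
  then show thesis by (intro that[of f]) (simp add: iota_E)
qed

text \<open>Compares the two gradings: the right-even part is spanned by the \<open>E a\<close>, and
  these are left-even too.\<close>

lemma q_p: "q 1 (p 0 x) = 0" "q 0 (p 0 x) = p 0 x"
proof -
  have "p 0 (p 0 x) = p 0 x" by (simp add: p_p)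
  then obtain f where f: "p 0 x = (\<Sum>a\<in>UNIV. sc (f a) (E a))" by (rule kernel_expansion)
  show "q 1 (p 0 x) = 0" "q 0 (p 0 x) = p 0 x" unfolding f by simp_all
qed

lemma p_q1 [simp]: "p 1 (q 1 x) = q 1 x" "p 0 (q 1 x) = 0"
proof -
  show "p 0 (q 1 x) = 0" by (simp add: p_q q_p)
  then show "p 1 (q 1 x) = q 1 x" using p_sum[of "q 1 x"] by simp
qed

lemma pE_mult [simp]: "p i (E a * x) = E a * p i x" "p i (x * E a) = p i x * E a"
    "q i (E a * x) = E a * q i x" "q i (x * E a) = q i x * E a"
  by (cases i; simp add: p_mult q_mult)+

text \<open>
  The odd component \<open>{x. p 1 x = x}\<close> is an invertible bimodule: with \<open>\<pi> h\<close> the generator of the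
  group of order two, the antipode axiom for \<open>q 1 h\<close> writes the unit as a sum of products of odd elements.
\<close>

lemma unit_expansion:
  obtains h where "1 = sweedler (\<lambda>a b. q 1 a * p 1 (antipode H b)) h" "counit H (q 1 h) = 1"
proof -
  obtain h where h: "\<pi> h = Poly_Mapping.single 1 1" using surj_pi by (metis surjD)
  have c: "counit H (q 1 h) = 1"
  proof -
    have "counit H (q 1 h) = conv (\<rho> 1) (counit H) h" by (rule functional_lact[OF lf_counit])
    also have "\<dots> = \<rho> 1 (ract (counit H) h)" by (rule functional_ract[OF lf_rho, symmetric])
    finally show ?thesis using h by (simp add: ract_counit \<rho>_def)
  qed
  have S: "lm (antipode H)" by (rule antipode_linear)
  have b: "bilinear_map (hscale H) (hscale H) (hscale H) (\<lambda>a b. p i a * p i (antipode H b))" for i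
    by (rule bilI[OF vs]) (simp_all add: linear_vec[OF S] distrib_left distrib_right scale_mult_left scale_mult_right)
  have "(1::'a) = sweedler (\<lambda>a b. a * antipode H b) (q 1 h)"
    unfolding sweedler_def antipode_right c by (simp add: scale_simps)
  moreover have "p 0 1 = 1"
    using range_iota_iff[of 1] iota_1 by (metis rangeI)
  ultimately have "1 = p 0 (sweedler (\<lambda>a b. a * antipode H b) (q 1 h))" by simp
  also have "\<dots> = sweedler (\<lambda>a b. p 0 (a * antipode H b)) (q 1 h)"
    by (rule sweedler_linear[OF lm_ract[OF lf_rho]])
  also have "\<dots> = sweedler (\<lambda>a b. p 0 a * p 0 (antipode H b)) (q 1 h) + sweedler (\<lambda>a b. p 1 a * p 1 (antipode H b)) (q 1 h)"
    by (simp add: p_mult sweedler_fun_add)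
  \<comment> \<open>Moving \<open>q 1\<close> from \<open>h\<close> onto the first tensor factor
    kills the even summand, because \<open>p 0 (q 1 a) = 0\<close>, and turns
    \<open>p 1 (q 1 a)\<close> into \<open>q 1 a\<close>.\<close>
  also have "\<dots> = sweedler (\<lambda>a b. q 1 a * p 1 (antipode H b)) h"
    using sweedler_lact[OF b lf_rho, of 0 1 h] sweedler_lact[OF b lf_rho, of 1 1 h]
    by (simp add: sweedler_fun_0)
  finally show thesis using that c by blast
qed

section \<open>Generators of the odd component\<close>

lemma odd_odd: "p 1 x = x \<Longrightarrow> p 1 y = y \<Longrightarrow> p 0 (x * y) = x * y"
proof -
  assume x: "p 1 x = x" and y: "p 1 y = y"
  have "p 0 x = 0" "p 0 y = 0" using p_p[of 0 1] x y by (metis zero_neq_one)+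
  then show ?thesis using x y by (simp add: p_mult)
qed

text \<open>If \<open>x\<close> annihilated every odd element, multiplying the unit expansion by
  \<open>x\<close> would give \<open>x = 0\<close>.\<close>

lemma odd_nondegenerate:
  assumes "x \<noteq> 0"
  obtains z where "p 1 z = z" "x * z \<noteq> 0"
proof -
  obtain h where h: "1 = sweedler (\<lambda>a b. q 1 a * p 1 (antipode H b)) h" by (rule unit_expansion)
  have "\<exists>z. p 1 z = z \<and> x * z \<noteq> 0"
  proof (rule ccontr)
    assume "\<not> ?thesis"
    then have 0: "x * z = 0" if "p 1 z = z" for z using that by blast
    have "x = x * sweedler (\<lambda>a b. q 1 a * p 1 (antipode H b)) h" using h by simp
    also have "\<dots> = sweedler (\<lambda>a b. (x * q 1 a) * p 1 (antipode H b)) h"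
      by (simp add: sweedler_mult_out mult.assoc)
    also have "\<dots> = 0" by (simp add: 0 sweedler_fun_0)
    finally show False using assms by simp
  qed
  then show thesis using that by blast
qed

lemma sweedler_nonzero:
  assumes "sweedler \<beta> x \<noteq> 0"
  shows "\<exists>a b. \<beta> a b \<noteq> 0"
proof (rule ccontr)
  assume "\<not> ?thesis"
  then have "\<beta> = (\<lambda>a b. 0)" by auto
  then show False using assms by (simp add: sweedler_fun_0)
qed

lemma scale_unscale: "x \<noteq> 0 \<Longrightarrow> sc c x = sc d x \<Longrightarrow> c = d"
  by simp

text \<open>The odd elements fixed by \<open>E a\<close> on the left form a line, fixed on the right
  by a single \<open>E b\<close>. The passage from \<open>a\<close> to \<open>b\<close> will be
  \<open>\<theta>\<close>, and the generators \<open>c\<close> complete the \<open>E a\<close> to a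
  basis.\<close>

lemma odd_generator:
  "\<exists>c b. E a * c = c \<and> c * E b = c \<and> p 1 c = c \<and> q 1 c = c \<and> c \<noteq> 0 \<and>
     (a = 0 \<longrightarrow> counit H c = 1) \<and> (\<forall>x. p 1 x = x \<longrightarrow> (\<exists>l. E a * x = sc l c))"
proof -
  obtain h where h: "1 = sweedler (\<lambda>y z. q 1 y * p 1 (antipode H z)) h" "counit H (q 1 h) = 1"
    by (rule unit_expansion)
  have exp: "x = sweedler (\<lambda>y z. x * q 1 y * p 1 (antipode H z)) h" for x
  proof -
    have "x = x * sweedler (\<lambda>y z. q 1 y * p 1 (antipode H z)) h" using h(1) by simp
    then show ?thesis by (simp add: sweedler_mult_out mult.assoc)
  qed
  have "sweedler (\<lambda>y z. E a * q 1 y * p 1 (antipode H z)) h \<noteq> 0" using exp[of "E a"] E_nonzero[of a] by simp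
  then obtain y z where "E a * q 1 y * p 1 (antipode H z) \<noteq> 0" using sweedler_nonzero by blast
  then have c0: "E a * q 1 y \<noteq> 0" by auto
  define c where "c = E a * q 1 y"
  have Ec: "E a * c = c" and pc: "p 1 c = c" and qc: "q 1 c = c" and cn: "c \<noteq> 0"
    using c0 by (simp_all add: c_def EEx q_q)
  \<comment> \<open>A nonzero product of \<open>u\<close> with an odd element is even and fixed by
    \<open>E a\<close>, hence a nonzero multiple of \<open>E a\<close>; rescaling gives a right
    inverse relative to \<open>E a\<close>.\<close>
  have ex: "\<exists>z. p 1 z = z \<and> u * z = E a" if u: "E a * u = u" "p 1 u = u" "u \<noteq> 0" for u
  proof -
    obtain z where z: "p 1 z = z" "u * z \<noteq> 0" using odd_nondegenerate[OF u(3)] .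
    obtain f where f: "\<And>a. E a * (u * z) = sc (f a) (E a)" using kernel_scalar[OF odd_odd[OF u(2) z(1)]] by blast
    have uz: "u * z = sc (f a) (E a)" using f[of a] u(1) by (simp add: mult.assoc[symmetric])
    then have "f a \<noteq> 0" using z(2) by (auto simp: scale_simps)
    then have "u * sc (inverse (f a)) z = E a" using uz by (simp add: scale_mult_right scale_simps)
    then show ?thesis using z(1) by (intro exI[of _ "sc (inverse (f a)) z"]) simp
  qed
  obtain z where z: "p 1 z = z" "c * z = E a" using ex[OF Ec pc cn] by blast
  have "\<exists>b. c * E b \<noteq> 0"
  proof (rule ccontr)
    assume "\<not> ?thesis"
    then have "(\<Sum>b\<in>UNIV. c * E b) = 0" by simp
    then show False using sum_xE[of c] cn by simp
  qed
  then obtain b where b: "c * E b \<noteq> 0" by blast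
  \<comment> \<open>Otherwise \<open>E a = c * E b' * w\<close> with \<open>w\<close> odd, and
    inserting it before \<open>c * E b\<close> leaves the even element \<open>w * c\<close> between
    \<open>E b'\<close> and \<open>E b\<close>. Even elements are diagonal, so this
    vanishes.\<close>
  have other: "c * E b' = 0" if b': "b' \<noteq> b" for b'
  proof (rule ccontr)
    assume "c * E b' \<noteq> 0"
    moreover have "E a * (c * E b') = c * E b'" "p 1 (c * E b') = c * E b'"
      using Ec pc by (simp_all add: mult.assoc[symmetric])
    ultimately obtain w where w: "p 1 w = w" "c * E b' * w = E a" using ex by blast
    have "p 0 (w * c) = w * c" by (rule odd_odd[OF w(1) pc])
    then obtain f where f: "\<And>a. E a * (w * c) = sc (f a) (E a)" using kernel_scalar by blast
    have "c * E b = (c * E b' * w) * (c * E b)" using Ec w(2) by (simp add: mult.assoc[symmetric])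
    also have "\<dots> = c * (E b' * (w * c)) * E b" by (simp add: mult.assoc)
    also have "\<dots> = 0" using b' by (simp add: f scale_mult_left scale_mult_right mult.assoc EE scale_simps)
    finally show False using b by simp
  qed
  have cE: "c * E b = c"
  proof -
    have "c = (\<Sum>g\<in>UNIV. if g = b then c * E b else 0)"
      by (subst sum_xE[symmetric]) (rule sum.cong, auto simp: other)
    then show ?thesis by simp
  qed
  \<comment> \<open>Expand \<open>E a * x\<close> by the unit. Each \<open>E a * x * q 1 y\<close>
    is a multiple of \<open>E a = c * z\<close>, so \<open>E a * x\<close> is \<open>c\<close> times
    an even element \<open>k\<close>, and \<open>E b\<close> sees only one scalar of
    \<open>k\<close>.\<close>
  have gen: "\<exists>l. E a * x = sc l c" if x: "p 1 x = x" for x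
  proof -
    have "\<exists>l. E a * x * q 1 y = sc l (E a)" for y
    proof -
      have "p 0 (x * q 1 y) = x * q 1 y" by (rule odd_odd[OF x]) simp
      then obtain f where "\<And>a. E a * (x * q 1 y) = sc (f a) (E a)" using kernel_scalar by blast
      then show ?thesis by (auto simp: mult.assoc)
    qed
    then obtain l where l: "\<And>y. E a * x * q 1 y = sc (l y) (E a)" by metis
    define k where "k = sweedler (\<lambda>y t. sc (l y) (z * p 1 (antipode H t))) h"
    have "E a * x = sweedler (\<lambda>y t. sc (l y) (E a) * p 1 (antipode H t)) h"
      using exp[of "E a * x"] by (simp add: l)
    also have "\<dots> = c * k"
      unfolding z(2)[symmetric] k_def
      by (simp add: sweedler_mult_out scale_mult_left scale_mult_right mult.assoc)
    finally have xk: "E a * x = c * k" .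
    have "p 0 k = k" unfolding k_def
      by (subst sweedler_linear[OF lm_ract[OF lf_rho]]) (simp add: odd_odd[OF z(1)] p_p)
    then obtain f where f: "\<And>a. E a * k = sc (f a) (E a)" using kernel_scalar by blast
    have "E a * x = c * (E b * k)" unfolding xk by (simp add: mult.assoc[symmetric] cE)
    also have "\<dots> = sc (f b) c" by (simp add: f scale_mult_right cE)
    finally show ?thesis by blast
  qed
  \<comment> \<open>Normalises the generator over 0 to counit 1. Its counit is nonzero, since
    \<open>E 0 * q 1 h\<close> is a multiple of it with counit 1.\<close>
  define n where "n = (if a = 0 then inverse (counit H c) else 1)"
  have n: "n \<noteq> 0 \<and> (a = 0 \<longrightarrow> counit H (sc n c) = 1)"
  proof (cases "a = 0")
    case True
    obtain l where "E 0 * q 1 h = sc l c" using gen[of "q 1 h"] True by auto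
    then have "l * counit H c = counit H (E 0 * q 1 h)" using linear_vec(2)[OF lf_counit, of l c] by simp
    also have "\<dots> = 1" using h(2) by (simp add: counit_mult counit_E)
    finally have "counit H c \<noteq> 0" by auto
    then show ?thesis using True by (simp add: n_def linear_vec[OF lf_counit])
  qed (simp add: n_def)
  show ?thesis
  proof (intro exI[of _ "sc n c"] exI[of _ b] conjI allI impI)
    show "E a * sc n c = sc n c" "sc n c * E b = sc n c"
      using Ec cE by (simp_all add: scale_mult_left scale_mult_right)
    show "p 1 (sc n c) = sc n c" "q 1 (sc n c) = sc n c" "sc n c \<noteq> 0" using pc qc cn n by simp_all
    show "counit H (sc n c) = 1" if "a = 0" using n that by simp
    fix x assume "p 1 x = x"
    then obtain l where "E a * x = sc l c" using gen by blast
    then show "\<exists>l. E a * x = sc l (sc n c)"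
      using n by (intro exI[of _ "l * inverse n"]) (simp add: scale_simps)
  qed
qed

end

text \<open>The structure constants of the extension, with \<open>e'\<close> and \<open>c'\<close>
  the dual basis. In the matched pair the group of order two can only be acted on trivially, which
  is why \<open>c g\<close> splits into pairs of \<open>c\<close> and \<open>\<theta>\<close> is
  additive.\<close>

locale graded_basis = hopf_algebra H for H :: "'a::ring_1 hopf" +
  fixes E c :: "'g::{group_add,finite} \<Rightarrow> 'a" and \<theta> :: "'g \<Rightarrow> 'g"
    and \<sigma> :: "'g \<Rightarrow> complex" and \<tau> :: "'g \<Rightarrow> 'g \<Rightarrow> complex"
    and e' c' :: "'g \<Rightarrow> 'a \<Rightarrow> complex"
  assumes EE: "E a * E b = (if a = b then E a else 0)"
    and Ec: "E a * c b = (if a = b then c b else 0)"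
    and cE: "c a * E b = (if b = \<theta> a then c a else 0)"
    and cc: "c a * c b = (if b = \<theta> a then hscale H (\<sigma> a) (E a) else 0)"
    and comul_E: "tensor_eq (hscale H) (hscale H) (comul H (E g))
      (image_mset (\<lambda>a. (E a, E (- a + g))) (mset_set UNIV))"
    and comul_c: "tensor_eq (hscale H) (hscale H) (comul H (c g))
      (image_mset (\<lambda>a. (hscale H (\<tau> a (- a + g)) (c a), c (- a + g))) (mset_set UNIV))"
    and counit_E: "counit H (E g) = (if g = 0 then 1 else 0)"
    and counit_c: "counit H (c g) = (if g = 0 then 1 else 0)"
    and linear_e': "Vector_Spaces.linear (hscale H) (*) (e' a)"
    and linear_c': "Vector_Spaces.linear (hscale H) (*) (c' a)"
    and dual: "e' a (E b) = (if a = b then 1 else 0)" "e' a (c b) = 0"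
      "c' a (E b) = 0" "c' a (c b) = (if a = b then 1 else 0)"
    and expansion: "x = (\<Sum>a\<in>UNIV. hscale H (e' a x) (E a)) + (\<Sum>a\<in>UNIV. hscale H (c' a x) (c a))"
    and theta_add: "\<theta> (a + b) = \<theta> a + \<theta> b" and theta_theta: "\<theta> (\<theta> a) = a"
    and sigma_nonzero: "\<sigma> a \<noteq> 0" and sigma_theta: "\<sigma> (\<theta> a) = \<sigma> a"
    and sigma_add: "\<sigma> (a + b) = \<sigma> a * \<sigma> b * \<tau> a b * \<tau> (\<theta> a) (\<theta> b)"
    and tau_nonzero: "\<tau> a b \<noteq> 0" and tau_0: "\<tau> 0 g = 1" "\<tau> g 0 = 1"
    and cocycle: "\<tau> (a + b) d * \<tau> a b = \<tau> a (b + d) * \<tau> b d"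

lemma (in hopf_algebra) conv_mult:
  assumes "lf \<phi>" "lf \<psi>"
  shows "conv \<phi> \<psi> (x * y) = sweedler (\<lambda>a b. conv (\<lambda>z. \<phi> (a * z)) (\<lambda>z. \<psi> (b * z)) y) x"
  unfolding conv_def by (rule sweedler_mult[OF bil_conv[OF assms]])

lemma minus_add_eq_iff: "- k + g = b \<longleftrightarrow> g = k + (b :: 'g::group_add)"
  by (metis add_minus_cancel minus_add_cancel)

lemma sum_delta_if:
  fixes F :: "'g::finite \<Rightarrow> 'x::comm_monoid_add"
  shows "(\<Sum>k\<in>UNIV. if k = a \<and> P k then F k else 0) = (if P a then F a else 0)"
proof -
  have "(\<Sum>k\<in>UNIV. if k = a \<and> P k then F k else 0) = (\<Sum>k\<in>UNIV. if k = a then (if P a then F a else 0) else 0)"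
    by (intro sum.cong) auto
  then show ?thesis by simp
qed

section \<open>Structure constants of the extension\<close>

context Z2_extension begin

text \<open>Pick a generator on each odd line and define all scalars as coordinates. The required
  identities then follow by comparing coordinates in associativity, coassociativity, the counit
  axioms and multiplicativity of the coproduct.\<close>

theorem graded_basis_exists:
  obtains c \<theta> \<sigma> \<tau> e' c' where "graded_basis H E c \<theta> \<sigma> \<tau> e' c'"
proof -
  obtain c \<theta> where Eca: "\<And>a. E a * c a = c a" and cEa: "\<And>a. c a * E (\<theta> a) = c a"
    and pc: "\<And>a. p 1 (c a) = c a" and qc: "\<And>a. q 1 (c a) = c a" and cn: "\<And>a. c a \<noteq> 0"
    and c0: "counit H (c 0) = 1" and gen: "\<And>a x. p 1 x = x \<Longrightarrow> \<exists>l. E a * x = sc l (c a)"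
    using odd_generator by metis
  have Ec: "E a * c b = (if a = b then c b else 0)" for a b
    using EEx[of a b "c b"] Eca by (metis)
  have cE: "c a * E b = (if b = \<theta> a then c a else 0)" for a b
  proof -
    have "c a * E b = c a * (E (\<theta> a) * E b)" using cEa by (simp add: mult.assoc[symmetric])
    then show ?thesis by (auto simp: EE cEa)
  qed
  have p0c: "p 0 (c a) = 0" for a using p_sum[of "c a"] pc by simp
  have "\<exists>l. E a * p 0 x = sc l (E a)" for a x
    using kernel_scalar[of "p 0 x"] by (metis p_p)
  then obtain e' where e': "\<And>a x. E a * p 0 x = sc (e' a x) (E a)" by metis
  have "\<exists>l. E a * p 1 x = sc l (c a)" for a x by (rule gen) (simp add: p_p)
  then obtain c' where c': "\<And>a x. E a * p 1 x = sc (c' a x) (c a)" by metis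
  have le: "lf (e' a)" for a
  proof (rule lfI)
    show "e' a (x + y) = e' a x + e' a y" for x y
      by (rule scale_unscale[OF E_nonzero[of a]]) (simp add: e'[symmetric] scale_simps distrib_left)
    show "e' a (sc l x) = l * e' a x" for l x
      by (rule scale_unscale[OF E_nonzero[of a]]) (simp add: e'[symmetric] scale_simps(3)[symmetric] scale_mult_right)
  qed
  have lc: "lf (c' a)" for a
  proof (rule lfI)
    show "c' a (x + y) = c' a x + c' a y" for x y
      by (rule scale_unscale[OF cn[of a]]) (simp add: c'[symmetric] scale_simps distrib_left)
    show "c' a (sc l x) = l * c' a x" for l x
      by (rule scale_unscale[OF cn[of a]]) (simp add: c'[symmetric] scale_simps(3)[symmetric] scale_mult_right)
  qed
  have e'E: "e' a (E b) = (if a = b then 1 else 0)" for a b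
    by (rule scale_unscale[OF E_nonzero[of a]]) (simp add: e'[symmetric] EE scale_simps)
  have e'c: "e' a (c b) = 0" for a b
    by (rule scale_unscale[OF E_nonzero[of a]]) (simp add: e'[symmetric] p0c scale_simps)
  have c'E: "c' a (E b) = 0" for a b
    by (rule scale_unscale[OF cn[of a]]) (simp add: c'[symmetric] scale_simps)
  have c'c: "c' a (c b) = (if a = b then 1 else 0)" for a b
    by (rule scale_unscale[OF cn[of a]]) (simp add: c'[symmetric] pc Ec scale_simps)
  have e'Ex: "e' a (E b * x) = (if a = b then e' a x else 0)" for a b x
    by (rule scale_unscale[OF E_nonzero[of a]]) (simp add: e'[symmetric] EEx scale_simps)
  have c'Ex: "c' a (E b * x) = (if a = b then c' a x else 0)" for a b x
    by (rule scale_unscale[OF cn[of a]]) (simp add: c'[symmetric] EEx scale_simps)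
  have p1x: "p 1 x = (\<Sum>a\<in>UNIV. sc (c' a x) (c a))" for x
    using sum_Ex[of "p 1 x"] by (simp add: c')
  have p0x: "p 0 x = (\<Sum>a\<in>UNIV. sc (e' a x) (E a))" for x
    using sum_Ex[of "p 0 x"] by (simp add: e')
  have expansion: "x = (\<Sum>a\<in>UNIV. sc (e' a x) (E a)) + (\<Sum>a\<in>UNIV. sc (c' a x) (c a))" for x
    using p_sum[of x] by (simp only: p0x p1x)
  \<comment> \<open>Both tensor factors are odd because \<open>p 1\<close> and \<open>q 1\<close>
    fix \<open>c g\<close> and agree. Writing \<open>c g = E g * c g\<close> forces the indices of
    the two factors to have sum \<open>g\<close>.\<close>
  have sw_c: "sweedler \<beta> (c g) = (\<Sum>a\<in>UNIV. sU (conv (c' a) (c' (- a + g)) (c g)) (\<beta> (c a) (c (- a + g))))"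
    if b: "bilinear_map (hscale H) (hscale H) sU \<beta>" for sU :: "complex \<Rightarrow> 'z::ab_group_add \<Rightarrow> 'z" and \<beta> g
  proof -
    interpret U: vector_space sU by (rule bil_vs[OF b])
    have b1: "bilinear_map (hscale H) (hscale H) sU (\<lambda>x y. \<beta> x (p 1 y))"
      by (rule bil_lin[OF b lm_id lm_ract[OF lf_rho]])
    have q1p1: "q 1 x = p 1 x" for x
    proof -
      have "q 1 x = q 1 (p 0 x) + q 1 (p 1 x)" by (simp add: q_vec(1)[symmetric] p_sum del: q_vec(1))
      also have "\<dots> = p 1 x" unfolding q_p p1x by (simp add: qc)
      finally show ?thesis .
    qed
    have zero: "conv (c' a) (c' k) (c g) = (if k = - a + g then conv (c' a) (c' k) (c g) else 0)" for a k
    proof -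
      have "conv (c' a) (c' k) (c g) = conv (c' a) (c' k) (E g * c g)" by (simp add: Eca)
      also have "\<dots> = (\<Sum>l\<in>UNIV. conv (\<lambda>z. c' a (E l * z)) (\<lambda>z. c' k (E (- l + g) * z)) (c g))"
      proof -
        have "bilinear_map (hscale H) (hscale H) (*) (\<lambda>x y. conv (\<lambda>z. c' a (x * z)) (\<lambda>z. c' k (y * z)) (c g))"
          unfolding conv_def sweedler_def case_prod_unfold
          by (rule bilI[OF vector_space_complex])
            (simp_all add: distrib_right distrib_left linear_vec[OF lc] scale_mult_left sum_mset.distrib sum_mset_distrib_left mult_ac)
        from sweedler_E[OF this, of g] show ?thesis by (simp add: conv_mult[OF lc lc])
      qed
      also have "\<dots> = (\<Sum>l\<in>UNIV. if l = a \<and> k = - l + g then conv (c' a) (c' k) (c g) else 0)"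
      proof (intro sum.cong refl)
        fix l
        show "conv (\<lambda>z. c' a (E l * z)) (\<lambda>z. c' k (E (- l + g) * z)) (c g) =
            (if l = a \<and> k = - l + g then conv (c' a) (c' k) (c g) else 0)"
          by (cases "a = l"; cases "k = - l + g"; simp add: c'Ex conv_def sweedler_fun_0; auto)
      qed
      also have "\<dots> = (if k = - a + g then conv (c' a) (c' k) (c g) else 0)"
        by (rule sum_delta_if)
      finally show ?thesis .
    qed
    have "sweedler \<beta> (c g) = sweedler \<beta> (p 1 (c g))" by (simp add: pc)
    also have "\<dots> = sweedler (\<lambda>x y. \<beta> x (p 1 y)) (q 1 (c g))"
      unfolding sweedler_ract[OF b lf_rho] by (simp add: qc)
    also have "\<dots> = sweedler (\<lambda>x y. \<beta> (p 1 x) (p 1 y)) (c g)"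
      by (subst sweedler_lact[OF b1 lf_rho]) (simp only: q1p1)
    also have "\<dots> = sweedler (\<lambda>x y. \<Sum>a\<in>UNIV. \<Sum>k\<in>UNIV. sU (c' a x * c' k y) (\<beta> (c a) (c k))) (c g)"
    proof -
      have 1: "\<beta> (p 1 x) z = (\<Sum>a\<in>UNIV. sU (c' a x) (\<beta> (c a) z))" for x z
        by (simp add: p1x bilinear_map_sum(1)[OF b] bilinear_mapD[OF b])
      have 2: "\<beta> z (p 1 y) = (\<Sum>k\<in>UNIV. sU (c' k y) (\<beta> z (c k)))" for y z
        by (simp add: p1x bilinear_map_sum(2)[OF b] bilinear_mapD[OF b])
      have "\<beta> (p 1 x) (p 1 y) = (\<Sum>a\<in>UNIV. \<Sum>k\<in>UNIV. sU (c' a x * c' k y) (\<beta> (c a) (c k)))" for x y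
        unfolding 1 by (simp add: 2 U.scale_sum_right)
      then show ?thesis by simp
    qed
    also have "\<dots> = (\<Sum>a\<in>UNIV. \<Sum>k\<in>UNIV. sU (conv (c' a) (c' k) (c g)) (\<beta> (c a) (c k)))"
    proof -
      have "sU (conv (c' a) (c' k) (c g)) z = sweedler (\<lambda>x y. sU (c' a x * c' k y) z) (c g)" for a k z
        unfolding conv_def by (rule sweedler_image[of "\<lambda>l. sU l z"]) (simp_all add: U.scale_left_distrib)
      then show ?thesis by (simp add: sweedler_fun_sum)
    qed
    also have "\<dots> = (\<Sum>a\<in>UNIV. \<Sum>k\<in>UNIV. if k = - a + g then sU (conv (c' a) (c' k) (c g)) (\<beta> (c a) (c k)) else 0)"
      by (subst zero, intro sum.cong refl) auto
    finally show ?thesis by simp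
  qed
  define \<tau> where "\<tau> a b = conv (c' a) (c' b) (c (a + b))" for a b
  have sw_c: "sweedler \<beta> (c g) = (\<Sum>a\<in>UNIV. sU (\<tau> a (- a + g)) (\<beta> (c a) (c (- a + g))))"
    if b: "bilinear_map (hscale H) (hscale H) sU \<beta>" for sU :: "complex \<Rightarrow> 'z::ab_group_add \<Rightarrow> 'z" and \<beta> g
    using sw_c[OF b, of g] by (simp add: \<tau>_def add.assoc[symmetric])
  have conv_c: "conv \<phi> \<psi> (c g) = (\<Sum>a\<in>UNIV. \<tau> a (- a + g) * (\<phi> (c a) * \<psi> (c (- a + g))))"
    if "lf \<phi>" "lf \<psi>" for \<phi> \<psi> g
    unfolding conv_def by (rule sw_c[OF bil_conv[OF that]])
  have conv_E: "conv \<phi> \<psi> (E g) = (\<Sum>a\<in>UNIV. \<phi> (E a) * \<psi> (E (- a + g)))"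
    if "lf \<phi>" "lf \<psi>" for \<phi> \<psi> g
    unfolding conv_def by (rule sweedler_E[OF bil_conv[OF that]])
  \<comment> \<open>The scalar is nonzero by nondegeneracy: some odd \<open>z\<close> has nonzero
    \<open>c a * z\<close>, and only its part \<open>E (\<theta> a) * z\<close>, a multiple of
    \<open>c (\<theta> a)\<close>, matters.\<close>
  have "\<exists>s. s \<noteq> 0 \<and> c a * c (\<theta> a) = sc s (E a)" for a
  proof -
    have "p 0 (c a * c (\<theta> a)) = c a * c (\<theta> a)" by (rule odd_odd[OF pc pc])
    then obtain f where f: "\<And>b. E b * (c a * c (\<theta> a)) = sc (f b) (E b)" using kernel_scalar by blast
    have s: "c a * c (\<theta> a) = sc (f a) (E a)" using f[of a] Eca by (simp add: mult.assoc[symmetric])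
    obtain z where z: "p 1 z = z" "c a * z \<noteq> 0" using odd_nondegenerate[OF cn[of a]] .
    obtain l where l: "E (\<theta> a) * z = sc l (c (\<theta> a))" using gen[OF z(1)] by blast
    have "c a * z = c a * (E (\<theta> a) * z)" using cEa by (simp add: mult.assoc[symmetric])
    then have "c a * z = sc l (c a * c (\<theta> a))" by (simp add: l scale_mult_right)
    then have "c a * c (\<theta> a) \<noteq> 0" using z(2) by auto
    then have "f a \<noteq> 0" unfolding s by auto
    then show ?thesis using s by blast
  qed
  then obtain \<sigma> where \<sigma>: "\<And>a. \<sigma> a \<noteq> 0" "\<And>a. c a * c (\<theta> a) = sc (\<sigma> a) (E a)" by metis
  have cc: "c a * c b = (if b = \<theta> a then sc (\<sigma> a) (E a) else 0)" for a b
  proof -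
    have "c a * c b = c a * E b * c b" by (simp add: mult.assoc Eca)
    then show ?thesis by (auto simp: cE \<sigma>)
  qed
  \<comment> \<open>\<open>E (\<theta> (\<theta> a))\<close> fixes
    \<open>c a * c (\<theta> a)\<close> on the right, and that product is a nonzero multiple of
    \<open>E a\<close>.\<close>
  have theta_theta: "\<theta> (\<theta> a) = a" for a
  proof (rule ccontr)
    assume "\<theta> (\<theta> a) \<noteq> a"
    then have "sc (\<sigma> a) (E a) * E (\<theta> (\<theta> a)) = 0" by (simp add: scale_mult_left EE)
    then have "c a * (c (\<theta> a) * E (\<theta> (\<theta> a))) = 0" unfolding \<sigma>(2)[symmetric] by (simp add: mult.assoc)
    then have "sc (\<sigma> a) (E a) = 0" by (simp add: cEa \<sigma>(2))
    then show False using \<sigma>(1) E_nonzero by simp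
  qed
  have sigma_theta: "\<sigma> (\<theta> a) = \<sigma> a" for a
  proof (rule scale_unscale[OF cn[of a]])
    have "sc (\<sigma> (\<theta> a)) (c a) = c a * (c (\<theta> a) * c (\<theta> (\<theta> a)))"
      by (simp only: \<sigma>(2) scale_mult_right cEa)
    also have "\<dots> = (c a * c (\<theta> a)) * c a" by (simp add: theta_theta mult.assoc)
    also have "\<dots> = sc (\<sigma> a) (c a)" by (simp add: \<sigma>(2) scale_mult_left Eca)
    finally show "sc (\<sigma> (\<theta> a)) (c a) = sc (\<sigma> a) (c a)" .
  qed
  have e'cc: "e' a (c k * c l) = (if k = a \<and> l = \<theta> k then \<sigma> a else 0)" for a k l
    by (auto simp: cc linear_vec[OF le] e'E)
  \<comment> \<open>The coefficient of \<open>E a\<close> tensor \<open>E b\<close> in the coproduct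
    of \<open>c ?g * c (\<theta> ?g)\<close>, computed before and after multiplying. As
    \<open>\<sigma>\<close> never vanishes, the zero case is excluded, which yields additivity of
    \<open>\<theta>\<close> and the formula for \<open>\<sigma>\<close> together.\<close>
  have key: "\<sigma> (a + b) = (if \<theta> (a + b) = \<theta> a + \<theta> b then \<sigma> a * \<sigma> b * \<tau> a b * \<tau> (\<theta> a) (\<theta> b) else 0)" for a b
  proof -
    let ?g = "a + b"
    have "\<sigma> ?g = \<sigma> ?g * conv (e' a) (e' b) (E ?g)"
    proof -
      have "conv (e' a) (e' b) (E ?g) = (\<Sum>k\<in>UNIV. if k = a \<and> b = - k + ?g then 1 else 0)"
        unfolding conv_E[OF le le] by (intro sum.cong) (auto simp: e'E)
      also have "\<dots> = 1" unfolding sum_delta_if by simp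
      finally show ?thesis by simp
    qed
    also have "\<dots> = conv (e' a) (e' b) (c ?g * c (\<theta> ?g))"
      using linear_vec(2)[OF lf_conv[OF le le]] by (simp add: \<sigma>(2))
    also have "\<dots> = sweedler (\<lambda>x y. conv (\<lambda>z. e' a (x * z)) (\<lambda>z. e' b (y * z)) (c (\<theta> ?g))) (c ?g)"
      by (rule conv_mult[OF le le])
    also have "\<dots> = (\<Sum>k\<in>UNIV. \<tau> k (- k + ?g) * conv (\<lambda>z. e' a (c k * z)) (\<lambda>z. e' b (c (- k + ?g) * z)) (c (\<theta> ?g)))"
    proof (rule sw_c)
      show "bilinear_map (hscale H) (hscale H) (*) (\<lambda>x y. conv (\<lambda>z. e' a (x * z)) (\<lambda>z. e' b (y * z)) (c (\<theta> ?g)))"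
        unfolding conv_def sweedler_def case_prod_unfold
        by (rule bilI[OF vector_space_complex])
          (simp_all add: distrib_right distrib_left linear_vec[OF le] scale_mult_left sum_mset.distrib sum_mset_distrib_left mult_ac)
    qed
    also have "\<dots> = (\<Sum>k\<in>UNIV. if k = a \<and> True then \<tau> a b * (if \<theta> b = - \<theta> a + \<theta> ?g then \<tau> (\<theta> a) (\<theta> b) * (\<sigma> a * \<sigma> b) else 0) else 0)"
    proof (intro sum.cong refl)
      fix k
      have "lf (\<lambda>z. e' a (x * z))" for a x
        by (rule lfI) (simp_all add: distrib_left scale_mult_right linear_vec[OF le])
      then have "conv (\<lambda>z. e' a (c k * z)) (\<lambda>z. e' b (c (- k + ?g) * z)) (c (\<theta> ?g)) =
          (\<Sum>l\<in>UNIV. \<tau> l (- l + \<theta> ?g) * (e' a (c k * c l) * e' b (c (- k + ?g) * c (- l + \<theta> ?g))))"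
        by (intro conv_c)
      also have "\<dots> = (\<Sum>l\<in>UNIV. if l = \<theta> a \<and> (k = a \<and> \<theta> b = - l + \<theta> ?g) then \<tau> (\<theta> a) (\<theta> b) * (\<sigma> a * \<sigma> b) else 0)"
        by (intro sum.cong) (auto simp: e'cc)
      also have "\<dots> = (if k = a \<and> \<theta> b = - \<theta> a + \<theta> ?g then \<tau> (\<theta> a) (\<theta> b) * (\<sigma> a * \<sigma> b) else 0)"
        by (rule sum_delta_if)
      finally show "\<tau> k (- k + ?g) * conv (\<lambda>z. e' a (c k * z)) (\<lambda>z. e' b (c (- k + ?g) * z)) (c (\<theta> ?g)) =
        (if k = a \<and> True then \<tau> a b * (if \<theta> b = - \<theta> a + \<theta> ?g then \<tau> (\<theta> a) (\<theta> b) * (\<sigma> a * \<sigma> b) else 0) else 0)"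
        by simp
    qed
    also have "\<dots> = \<tau> a b * (if \<theta> b = - \<theta> a + \<theta> ?g then \<tau> (\<theta> a) (\<theta> b) * (\<sigma> a * \<sigma> b) else 0)"
      unfolding sum_delta_if by simp
    finally have "\<sigma> ?g = \<tau> a b * (if \<theta> b = - \<theta> a + \<theta> ?g then \<tau> (\<theta> a) (\<theta> b) * (\<sigma> a * \<sigma> b) else 0)" .
    moreover have "\<theta> b = - \<theta> a + \<theta> ?g \<longleftrightarrow> \<theta> ?g = \<theta> a + \<theta> b"
      using minus_add_eq_iff[of "\<theta> a" "\<theta> ?g" "\<theta> b"] by auto
    ultimately show ?thesis by (simp add: mult_ac)
  qed
  have theta_add: "\<theta> (a + b) = \<theta> a + \<theta> b" for a b using key[of a b] \<sigma>(1)[of "a + b"] by (metis)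
  have sigma_add: "\<sigma> (a + b) = \<sigma> a * \<sigma> b * \<tau> a b * \<tau> (\<theta> a) (\<theta> b)" for a b
    using key[of a b] theta_add by simp
  have counit_c: "counit H (c g) = (if g = 0 then 1 else 0)" for g
  proof -
    have "counit H (c g) = counit H (E g) * counit H (c g)" unfolding counit_mult[symmetric] by (simp add: Eca)
    then show ?thesis using c0 by (auto simp: counit_E)
  qed
  have conv_cc: "conv (c' a) (c' b) (c g) = (if g = a + b then \<tau> a b else 0)" for a b g
  proof -
    have "conv (c' a) (c' b) (c g) = (\<Sum>k\<in>UNIV. if k = a \<and> b = - k + g then \<tau> a b else 0)"
      unfolding conv_c[OF lc lc] by (intro sum.cong) (auto simp: c'c)
    also have "\<dots> = (if b = - a + g then \<tau> a b else 0)" by (rule sum_delta_if)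
    finally show ?thesis by (auto simp: minus_add_eq_iff add.assoc[symmetric])
  qed
  \<comment> \<open>Coassociativity on \<open>c ?g\<close>, read off in the coordinates
    \<open>c' a\<close>, \<open>c' b\<close>, \<open>c' d\<close>.\<close>
  have cocycle: "\<tau> (a + b) d * \<tau> a b = \<tau> a (b + d) * \<tau> b d" for a b d
  proof -
    let ?g = "a + b + d"
    have "conv (conv (c' a) (c' b)) (c' d) (c ?g) =
        (\<Sum>k\<in>UNIV. if k = a + b \<and> d = - k + ?g then \<tau> (a + b) d * \<tau> a b else 0)"
      unfolding conv_c[OF lf_conv[OF lc lc] lc] by (intro sum.cong) (auto simp: c'c conv_cc)
    also have "\<dots> = \<tau> (a + b) d * \<tau> a b" unfolding sum_delta_if
      using minus_add_eq_iff[of "a + b" ?g d] by simp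
    finally have 1: "conv (conv (c' a) (c' b)) (c' d) (c ?g) = \<tau> (a + b) d * \<tau> a b" .
    have "conv (c' a) (conv (c' b) (c' d)) (c ?g) =
        (\<Sum>k\<in>UNIV. if k = a \<and> b + d = - k + ?g then \<tau> a (b + d) * \<tau> b d else 0)"
      unfolding conv_c[OF lc lf_conv[OF lc lc]] by (intro sum.cong) (auto simp: c'c conv_cc)
    also have "\<dots> = \<tau> a (b + d) * \<tau> b d" unfolding sum_delta_if
      using minus_add_eq_iff[of a ?g "b + d"] by (simp add: add.assoc)
    finally show ?thesis using 1 conv_assoc[OF lc lc lc, of a b d "c ?g"] by simp
  qed
  have tau_0: "\<tau> 0 g = 1" "\<tau> g 0 = 1" for g
  proof -
    have "1 = c' g (lact (counit H) (c g))" by (simp add: lact_counit c'c)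
    also have "\<dots> = conv (counit H) (c' g) (c g)" by (rule functional_lact[OF lc])
    also have "\<dots> = (\<Sum>k\<in>UNIV. if k = (0::'g) \<and> True then \<tau> 0 g else 0)"
      unfolding conv_c[OF lf_counit lc] by (intro sum.cong) (auto simp: c'c counit_c)
    finally show "\<tau> 0 g = 1" by simp
    have "1 = c' g (ract (counit H) (c g))" by (simp add: ract_counit c'c)
    also have "\<dots> = conv (c' g) (counit H) (c g)" by (rule functional_ract[OF lc])
    also have "\<dots> = (\<Sum>k\<in>UNIV. if k = g \<and> True then \<tau> g 0 else 0)"
      unfolding conv_c[OF lc lf_counit] by (intro sum.cong) (auto simp: c'c counit_c)
    finally show "\<tau> g 0 = 1" by simp
  qed
  have tau_nonzero: "\<tau> a b \<noteq> 0" for a b using sigma_add[of a b] \<sigma>(1)[of "a + b"] by auto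
  have comul_E: "tensor_eq (hscale H) (hscale H) (comul H (E g))
      (image_mset (\<lambda>a. (E a, E (- a + g))) (mset_set UNIV))" for g
    unfolding tensor_eq_def using sweedler_E[of "(*)"]
    by (simp add: sweedler_def image_mset.compositionality o_def sum_unfold_sum_mset)
  have comul_c: "tensor_eq (hscale H) (hscale H) (comul H (c g))
      (image_mset (\<lambda>a. (sc (\<tau> a (- a + g)) (c a), c (- a + g))) (mset_set UNIV))" for g
    unfolding tensor_eq_def using sw_c[of "(*)"]
    by (simp add: sweedler_def image_mset.compositionality o_def sum_unfold_sum_mset bilinear_mapD)
  have "graded_basis H E c \<theta> \<sigma> \<tau> e' c'"
    by (intro graded_basis.intro graded_basis_axioms.intro)
      (fact hopf_algebra_axioms EE Ec cE cc comul_E comul_c counit_E counit_c le lc e'E e'c c'E c'c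
        expansion theta_add theta_theta \<sigma>(1) sigma_theta sigma_add tau_nonzero tau_0 cocycle)+
  then show thesis by (rule that)
qed

end

section \<open>Indicators\<close>

context hopf_algebra begin

lemma
  assumes "B = (SOME B. independent B \<and> span B = UNIV)"
  shows chosen_basis: "independent B" "span B = UNIV" "finite B"
proof -
  have "independent (extend_basis {})" "span (extend_basis {}) = UNIV"
    using independent_extend_basis[OF independent_empty] span_extend_basis[OF independent_empty] by auto
  then have "independent B \<and> span B = UNIV"
    unfolding assms by (intro someI[of "\<lambda>B. independent B \<and> span B = UNIV"]) simp
  then show i: "independent B" "span B = UNIV" by auto
  obtain T where "finite T" "span T = UNIV" using finite_dimensional by auto
  then show "finite B" using independent_span_bound[of T B] i by auto
qed

text \<open>Any decomposition into rank-one maps computes the trace, so the basis chosen in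
  \<open>linear_trace\<close> never needs to be identified.\<close>

lemma linear_trace_sum_rank_one:
  assumes f: "\<And>x. f x = (\<Sum>i\<in>I. sc (\<phi> i x) (v i))" and \<phi>: "\<And>i. i \<in> I \<Longrightarrow> lf (\<phi> i)"
  shows "linear_trace sc f = (\<Sum>i\<in>I. \<phi> i (v i))"
proof -
  define B where "B = (SOME B. independent B \<and> span B = UNIV)"
  note B = chosen_basis[OF B_def]
  have "linear_trace sc f = (\<Sum>b\<in>B. representation B (f b) b)"
    by (simp add: linear_trace_def B_def Let_def)
  also have "\<dots> = (\<Sum>b\<in>B. \<Sum>i\<in>I. \<phi> i b * representation B (v i) b)"
    unfolding f using B by (simp add: representation_sum representation_scale)
  also have "\<dots> = (\<Sum>i\<in>I. \<Sum>b\<in>B. \<phi> i b * representation B (v i) b)" by (rule sum.swap)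
  also have "\<dots> = (\<Sum>i\<in>I. \<phi> i (v i))"
  proof (intro sum.cong refl)
    fix i assume i: "i \<in> I"
    have "v i = (\<Sum>b\<in>B. sc (representation B (v i) b) b)"
      using sum_representation_eq[OF B(1) _ B(3) order_refl, of "v i"] B(2) by simp
    then have "\<phi> i (v i) = \<phi> i (\<Sum>b\<in>B. sc (representation B (v i) b) b)" by simp
    also have "\<dots> = (\<Sum>b\<in>B. \<phi> i b * representation B (v i) b)"
      by (simp add: linear_vec[OF \<phi>[OF i]] mult.commute)
    finally show "(\<Sum>b\<in>B. \<phi> i b * representation B (v i) b) = \<phi> i (v i)" by simp
  qed
  finally show ?thesis .
qed

lemma lf_regular_character: "lf (regular_character H)"
proof -
  define B where "B = (SOME B. independent B \<and> span B = UNIV)"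
  note B = chosen_basis[OF B_def]
  have r: "regular_character H a = (\<Sum>b\<in>B. representation B (a * b) b)" for a
    by (simp add: regular_character_def linear_trace_def B_def Let_def)
  show ?thesis
    by (rule lfI) (simp_all add: r B distrib_right scale_mult_left representation_add representation_scale
        sum.distrib sum_distrib_left)
qed

lemma sweedler_product_1: "sweedler_product H (Suc 0) x = x"
  by (simp add: sweedler_product_def)

lemma sweedler_product_Suc:
  "sweedler_product H (Suc (Suc n)) x = sweedler (\<lambda>a b. a * sweedler_product H (Suc n) b) x"
  by (simp add: sweedler_product_def sweedler_def case_prod_unfold sum_mset_nested sum_mset_distrib_left)

lemma lm_sweedler_product: "lm (sweedler_product H (Suc n))"
proof (induction n)
  case 0
  show ?case using lm_id by (simp add: sweedler_product_1[abs_def])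
next
  case (Suc n)
  have b: "bilinear_map (hscale H) (hscale H) (hscale H) (\<lambda>a b. a * sweedler_product H (Suc n) b)"
    by (rule bilI[OF vs]) (simp_all add: linear_vec[OF Suc] distrib_left distrib_right scale_mult_left scale_mult_right)
  show ?case unfolding sweedler_product_Suc[abs_def]
    by (rule lmI) (simp_all add: sweedler_add[OF b] sweedler_scale[OF b])
qed

lemma bil_sweedler_product:
  "bilinear_map (hscale H) (hscale H) (hscale H) (\<lambda>a b. a * sweedler_product H (Suc n) b)"
  by (rule bilI[OF vs])
    (simp_all add: linear_vec[OF lm_sweedler_product] distrib_left distrib_right scale_mult_left scale_mult_right)

lemma normalized_integral_eq:
  assumes "is_normalized_integral H L"
  shows "normalized_integral H = L"
  unfolding normalized_integral_def
proof (rule the_equality[where P = "is_normalized_integral H", OF assms])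
  fix M assume M: "is_normalized_integral H M"
  have "L * M = sc (counit H L) M" "L * M = sc (counit H M) L"
    using assms M unfolding is_normalized_integral_def by blast+
  moreover have "counit H L = 1" "counit H M = 1" using assms M by (simp_all add: is_normalized_integral_def)
  ultimately show "M = L" by simp
qed

end

primrec npow :: "nat \<Rightarrow> 'g::group_add \<Rightarrow> 'g" where
  "npow 0 a = 0"
| "npow (Suc n) a = a + npow n a"

section \<open>The indicators in terms of the structure constants\<close>

context graded_basis begin

text \<open>The alternating product of \<open>a\<close> and \<open>\<theta> a\<close>, which is the
  first component of the \<open>n\<close>-th power of \<open>(a, True)\<close> in the semidirect
  product.\<close>

primrec alt :: "nat \<Rightarrow> 'g \<Rightarrow> 'g" where
  "alt 0 a = 0"
| "alt (Suc n) a = a + alt n (\<theta> a)"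

text \<open>
  The coefficient of \<open>c a \<otimes> c (\<theta> a) \<otimes> c a \<otimes> \<dots>\<close> (\<open>n\<close> factors) in the iterated coproduct of
  \<open>c (alt n a)\<close>.
\<close>

primrec t :: "nat \<Rightarrow> 'g \<Rightarrow> complex" where
  "t 0 a = 1"
| "t (Suc n) a = \<tau> a (alt n (\<theta> a)) * t n (\<theta> a)"

text \<open>The only products of \<open>n\<close> generators \<open>c\<close> starting with
  \<open>c a\<close> that can be nonzero: each index must be \<open>\<theta>\<close> of the
  preceding one.\<close>

primrec word :: "nat \<Rightarrow> 'g \<Rightarrow> 'a" where
  "word 0 a = 1"
| "word (Suc n) a = c a * word n (\<theta> a)"

lemma theta_0: "\<theta> 0 = 0"
  using theta_add[of 0 0] add_left_cancel[of "\<theta> 0" "\<theta> 0" 0] by simp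

lemma sigma_0: "\<sigma> 0 = 1"
  using sigma_add[of 0 0] sigma_nonzero[of 0] by (simp add: theta_0 tau_0)

lemma card_carrier_eq: "dim UNIV = 2 * card (UNIV :: 'g set)"
proof -
  let ?B = "range E \<union> range c"
  have inj: "inj E" "inj c" by (rule injI, metis dual zero_neq_one)+
  have disj: "range E \<inter> range c = {}"
  proof (rule ccontr)
    assume "range E \<inter> range c \<noteq> {}"
    then obtain a b where "E a = c b" by blast
    then show False using dual(1)[of a a] dual(2)[of a b] by simp
  qed
  have fin: "finite ?B" by simp
  have "independent ?B"
  proof (rule independent_if_scalars_zero[OF fin])
    fix f x assume "(\<Sum>x\<in>?B. sc (f x) x) = 0" and x: "x \<in> ?B"
    then have "(\<Sum>a\<in>UNIV. sc (f (E a)) (E a)) + (\<Sum>a\<in>UNIV. sc (f (c a)) (c a)) = 0"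
      using disj inj by (simp add: sum.union_disjoint sum.reindex)
    then have 0: "\<phi> ((\<Sum>a\<in>UNIV. sc (f (E a)) (E a)) + (\<Sum>a\<in>UNIV. sc (f (c a)) (c a))) = 0" if "lf \<phi>" for \<phi>
      using linear_vec(3)[OF that] by simp
    have "f (E b) = 0" "f (c b) = 0" for b
      using 0[OF linear_e'[of b]] 0[OF linear_c'[of b]]
      by (simp_all add: linear_vec[OF linear_e'] linear_vec[OF linear_c'] dual if_distrib[of "(*) _"] cong: if_cong)
    then show "f x = 0" using x by auto
  qed
  moreover have "span ?B = UNIV"
  proof -
    have "(\<Sum>a\<in>UNIV. sc (e' a x) (E a)) + (\<Sum>a\<in>UNIV. sc (c' a x) (c a)) \<in> span ?B" for x
      by (intro span_add span_sum span_scale span_base) auto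
    then show ?thesis using expansion by (metis UNIV_eq_I)
  qed
  ultimately have "dim UNIV = card ?B" by (intro dim_eq_card) simp_all
  then show ?thesis using disj inj by (simp add: card_Un_disjoint card_image)
qed

lemma counit_expansion: "counit H x = e' 0 x + c' 0 x"
proof -
  have "counit H x = counit H ((\<Sum>a\<in>UNIV. sc (e' a x) (E a)) + (\<Sum>a\<in>UNIV. sc (c' a x) (c a)))"
    using expansion[of x] by simp
  also have "\<dots> = e' 0 x + c' 0 x"
    by (simp add: linear_vec[OF lf_counit] counit_E counit_c if_distrib[of "(*) _"] cong: if_cong)
  finally show ?thesis .
qed

definition \<Lambda> :: 'a where "\<Lambda> = sc (1/2) (E 0 + c 0)"

lemma integral: "is_normalized_integral H \<Lambda>"
proof -
  have E: "E a * \<Lambda> = (if a = 0 then \<Lambda> else 0)" "\<Lambda> * E a = (if a = 0 then \<Lambda> else 0)" for a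
    by (auto simp: \<Lambda>_def scale_mult_left scale_mult_right distrib_left distrib_right EE Ec cE theta_0)
  have c: "c a * \<Lambda> = (if a = 0 then \<Lambda> else 0)" "\<Lambda> * c a = (if a = 0 then \<Lambda> else 0)" for a
  proof -
    have "0 = \<theta> a \<longleftrightarrow> a = 0" using theta_0 theta_theta[of a] by auto
    then show "c a * \<Lambda> = (if a = 0 then \<Lambda> else 0)" "\<Lambda> * c a = (if a = 0 then \<Lambda> else 0)"
      by (auto simp: \<Lambda>_def scale_mult_left scale_mult_right distrib_left distrib_right Ec cE cc theta_0 sigma_0 add.commute)
  qed
  have ite: "sc l (if P then x else 0) = (if P then sc l x else 0)" for l P x by simp
  have "h * \<Lambda> = sc (counit H h) \<Lambda>" for h
  proof -
    have "h * \<Lambda> = ((\<Sum>a\<in>UNIV. sc (e' a h) (E a)) + (\<Sum>a\<in>UNIV. sc (c' a h) (c a))) * \<Lambda>"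
      using expansion[of h] by simp
    also have "\<dots> = sc (counit H h) \<Lambda>"
      by (simp add: distrib_right sum_distrib_right scale_mult_left E c ite counit_expansion scale_simps del: scale_eq_0_iff)
    finally show ?thesis .
  qed
  moreover have "\<Lambda> * h = sc (counit H h) \<Lambda>" for h
  proof -
    have "\<Lambda> * h = \<Lambda> * ((\<Sum>a\<in>UNIV. sc (e' a h) (E a)) + (\<Sum>a\<in>UNIV. sc (c' a h) (c a)))"
      using expansion[of h] by simp
    also have "\<dots> = sc (counit H h) \<Lambda>"
      by (simp add: distrib_left sum_distrib_left scale_mult_right E c ite counit_expansion scale_simps)
    finally show ?thesis .
  qed
  moreover have "counit H \<Lambda> = 1" by (simp add: \<Lambda>_def linear_vec[OF lf_counit] counit_E counit_c)
  ultimately show ?thesis by (simp add: is_normalized_integral_def)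
qed

text \<open>The \<open>E a\<close> are orthogonal, so only terms with all indices equal
  survive.\<close>

lemma sweedler_product_E:
  "sweedler_product H (Suc n) (E g) = (\<Sum>a\<in>UNIV. if npow (Suc n) a = g then E a else 0)"
proof (induction n arbitrary: g)
  case 0
  show ?case by (simp add: sweedler_product_1)
next
  case (Suc n)
  have "sweedler_product H (Suc (Suc n)) (E g) = (\<Sum>a\<in>UNIV. E a * sweedler_product H (Suc n) (E (- a + g)))"
    unfolding sweedler_product_Suc sweedler_tensor_eq[OF bil_sweedler_product comul_E]
    by (simp add: image_mset.compositionality o_def sum_unfold_sum_mset)
  also have "\<dots> = (\<Sum>a\<in>UNIV. if npow (Suc (Suc n)) a = g then E a else 0)"
  proof (intro sum.cong refl)
    fix a
    have "E a * sweedler_product H (Suc n) (E (- a + g)) =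
        (\<Sum>b\<in>UNIV. if b = a \<and> npow (Suc n) b = - a + g then E a else 0)"
      unfolding Suc sum_distrib_left by (intro sum.cong) (auto simp: EE)
    also have "\<dots> = (if npow (Suc n) a = - a + g then E a else 0)" by (rule sum_delta_if)
    also have "npow (Suc n) a = - a + g \<longleftrightarrow> npow (Suc (Suc n)) a = g"
      using minus_add_eq_iff[of a g "npow (Suc n) a"] by auto
    finally show "E a * sweedler_product H (Suc n) (E (- a + g)) = (if npow (Suc (Suc n)) a = g then E a else 0)" .
  qed
  finally show ?case .
qed

text \<open>Since \<open>c a * c b\<close> vanishes unless \<open>b = \<theta> a\<close>, only
  alternating terms survive; \<open>t\<close> collects their coproduct coefficients.\<close>

lemma sweedler_product_c:
  "sweedler_product H (Suc n) (c g) = (\<Sum>a\<in>UNIV. if alt (Suc n) a = g then sc (t (Suc n) a) (word (Suc n) a) else 0)"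
proof (induction n arbitrary: g)
  case 0
  show ?case by (simp add: sweedler_product_1 tau_0)
next
  case (Suc n)
  have "sweedler_product H (Suc (Suc n)) (c g) =
      (\<Sum>a\<in>UNIV. sc (\<tau> a (- a + g)) (c a * sweedler_product H (Suc n) (c (- a + g))))"
    unfolding sweedler_product_Suc sweedler_tensor_eq[OF bil_sweedler_product comul_c]
    by (simp add: image_mset.compositionality o_def sum_unfold_sum_mset scale_mult_left)
  also have "\<dots> = (\<Sum>a\<in>UNIV. if alt (Suc (Suc n)) a = g then sc (t (Suc (Suc n)) a) (word (Suc (Suc n)) a) else 0)"
  proof (intro sum.cong refl)
    fix a
    have z: "b = \<theta> a \<or> c a * word (Suc n) b = 0" for b
      by (auto simp: mult.assoc[symmetric] cc)
    have "c a * sweedler_product H (Suc n) (c (- a + g)) =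
        (\<Sum>b\<in>UNIV. if b = \<theta> a \<and> alt (Suc n) b = - a + g then sc (t (Suc n) b) (c a * word (Suc n) b) else 0)"
      unfolding Suc sum_distrib_left
    proof (intro sum.cong refl)
      fix b
      show "c a * (if alt (Suc n) b = - a + g then sc (t (Suc n) b) (word (Suc n) b) else 0) =
          (if b = \<theta> a \<and> alt (Suc n) b = - a + g then sc (t (Suc n) b) (c a * word (Suc n) b) else 0)"
        using z[of b] by (auto simp: scale_mult_right simp del: word.simps alt.simps t.simps)
    qed
    also have "\<dots> = (if alt (Suc n) (\<theta> a) = - a + g then sc (t (Suc n) (\<theta> a)) (c a * word (Suc n) (\<theta> a)) else 0)"
      by (rule sum_delta_if)
    finally have "sc (\<tau> a (- a + g)) (c a * sweedler_product H (Suc n) (c (- a + g))) =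
        (if alt (Suc n) (\<theta> a) = - a + g then sc (\<tau> a (alt (Suc n) (\<theta> a)) * t (Suc n) (\<theta> a)) (c a * word (Suc n) (\<theta> a)) else 0)"
      by (simp only: if_distrib[of "sc _"] scale_simps split: if_split) simp
    also have "alt (Suc n) (\<theta> a) = - a + g \<longleftrightarrow> alt (Suc (Suc n)) a = g"
      using minus_add_eq_iff[of a g "alt (Suc n) (\<theta> a)"] by auto
    finally show "sc (\<tau> a (- a + g)) (c a * sweedler_product H (Suc n) (c (- a + g))) =
        (if alt (Suc (Suc n)) a = g then sc (t (Suc (Suc n)) a) (word (Suc (Suc n)) a) else 0)"
      by (simp only: t.simps(2)[of "Suc n"] word.simps(2)[of "Suc n"])
  qed
  finally show ?case .
qed

text \<open>Consecutive pairs collapse to scalars times idempotents; a leftover factor keeps words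
  of odd length odd.\<close>

lemma word_eq:
  "word (Suc (2 * m)) a = sc (\<sigma> a ^ m) (c a)" "word (Suc (Suc (2 * m))) a = sc (\<sigma> a ^ Suc m) (E a)"
proof (induction m arbitrary: a)
  case 0
  case 1 show ?case by simp
  case 2 show ?case by (simp add: cc)
next
  case (Suc m)
  have w: "word (Suc (2 * Suc m)) a = sc (\<sigma> a ^ Suc m) (c a)" for a
  proof -
    have "word (Suc (2 * Suc m)) a = c a * word (Suc (Suc (2 * m))) (\<theta> a)" by simp
    then show ?thesis unfolding Suc(2) by (simp add: scale_mult_right cE sigma_theta)
  qed
  case 1 show ?case by (rule w)
  case 2
  have "word (Suc (Suc (2 * Suc m))) a = c a * word (Suc (2 * Suc m)) (\<theta> a)" by simp
  then show ?case unfolding w by (simp add: scale_mult_right cc sigma_theta mult_ac)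
qed

text \<open>Left multiplication by \<open>E a\<close> projects onto the span of \<open>E a\<close>
  and \<open>c a\<close>.\<close>

lemma regular_character_E: "regular_character H (E a) = 2"
proof -
  have "E a * x = (\<Sum>i\<in>UNIV. sc ((if i then e' a else c' a) x) (if i then E a else c a))" for x
  proof -
    have "E a * x = E a * ((\<Sum>b\<in>UNIV. sc (e' b x) (E b)) + (\<Sum>b\<in>UNIV. sc (c' b x) (c b)))"
      using expansion[of x] by simp
    also have "\<dots> = sc (e' a x) (E a) + sc (c' a x) (c a)"
      by (simp add: distrib_left sum_distrib_left scale_mult_right EE Ec if_distrib[of "sc _"] cong: if_cong)
    finally show ?thesis by (simp add: UNIV_bool add.commute)
  qed
  then have "regular_character H (E a) = (\<Sum>i\<in>UNIV. (if i then e' a else c' a) (if i then E a else c a))"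
    unfolding regular_character_def by (rule linear_trace_sum_rank_one) (simp add: linear_e' linear_c')
  then show ?thesis by (simp add: UNIV_bool dual)
qed

text \<open>Left multiplication by \<open>c a\<close> exchanges even and odd elements, so it has no
  diagonal entries.\<close>

lemma regular_character_c: "regular_character H (c a) = 0"
proof -
  have "c a * x = (\<Sum>i\<in>UNIV. sc ((if i then e' (\<theta> a) else c' (\<theta> a)) x) (if i then c a else sc (\<sigma> a) (E a)))" for x
  proof -
    have "c a * x = c a * ((\<Sum>b\<in>UNIV. sc (e' b x) (E b)) + (\<Sum>b\<in>UNIV. sc (c' b x) (c b)))"
      using expansion[of x] by simp
    also have "\<dots> = sc (e' (\<theta> a) x) (c a) + sc (c' (\<theta> a) x) (sc (\<sigma> a) (E a))"
      by (simp add: distrib_left sum_distrib_left scale_mult_right cE cc if_distrib[of "sc _"] cong: if_cong)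
    finally show ?thesis by (simp add: UNIV_bool add.commute)
  qed
  then have "regular_character H (c a) = (\<Sum>i\<in>UNIV. (if i then e' (\<theta> a) else c' (\<theta> a)) (if i then c a else sc (\<sigma> a) (E a)))"
    unfolding regular_character_def by (rule linear_trace_sum_rank_one) (simp add: linear_e' linear_c')
  then show ?thesis by (simp add: UNIV_bool dual linear_vec[OF linear_c'])
qed

text \<open>Coproduct coefficient times the scalar of the collapsed word. For odd \<open>n\<close>
  the word is odd and has trace 0.\<close>

definition \<kappa> :: "nat \<Rightarrow> 'g \<Rightarrow> complex" where
  "\<kappa> n a = (if even n then t n a * \<sigma> a ^ (n div 2) else 0)"

text \<open>The factor 1/2 in the integral cancels against the character value 2 of each
  \<open>E a\<close>.\<close>

lemma fs_indicator_eq: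
  assumes "n > 0"
  shows "fs_indicator n H = of_nat (card {a. npow n a = (0::'g)}) + (\<Sum>a | alt n a = 0. \<kappa> n a)"
proof -
  obtain m where m: "n = Suc m" using assms by (cases n) auto
  note L = linear_vec[OF lf_regular_character]
  have w: "regular_character H (word n a) = (if even n then 2 * \<sigma> a ^ (n div 2) else 0)" for a
  proof (cases "even n")
    case True
    then obtain k where "n = Suc (Suc (2 * k))" using assms by (auto elim!: evenE) (metis Suc_pred mult_Suc_right add_2_eq_Suc)
    then show ?thesis by (simp only: word_eq(2) L regular_character_E) simp
  next
    case False
    then obtain k where "n = Suc (2 * k)" by (auto elim!: oddE)
    then show ?thesis by (simp only: word_eq(1) L regular_character_c) simp
  qed
  have "fs_indicator n H = regular_character H (sc (1/2) (sweedler_product H n (E 0) + sweedler_product H n (c 0)))"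
    unfolding fs_indicator_def normalized_integral_eq[OF integral] \<Lambda>_def m
    by (simp add: linear_vec[OF lm_sweedler_product])
  also have "\<dots> = (\<Sum>a\<in>UNIV. if npow n a = (0::'g) then 1 else 0) + (\<Sum>a\<in>UNIV. if alt n a = 0 then \<kappa> n a else 0)"
  proof -
    have 1: "regular_character H (sweedler_product H n (E 0)) = 2 * (\<Sum>a\<in>UNIV. if npow n a = (0::'g) then 1 else 0)"
      unfolding m sweedler_product_E L sum_distrib_left by (intro sum.cong) (auto simp: regular_character_E L)
    have 2: "regular_character H (sweedler_product H n (c 0)) = 2 * (\<Sum>a\<in>UNIV. if alt n a = 0 then \<kappa> n a else 0)"
    proof -
      have "regular_character H (sweedler_product H n (c 0)) =
          (\<Sum>a\<in>UNIV. regular_character H (if alt n a = 0 then sc (t n a) (word n a) else 0))"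
        unfolding m sweedler_product_c L ..
      also have "\<dots> = (\<Sum>a\<in>UNIV. 2 * (if alt n a = 0 then \<kappa> n a else 0))"
        by (intro sum.cong) (auto simp: L w \<kappa>_def)
      finally show ?thesis by (simp add: sum_distrib_left)
    qed
    show ?thesis by (simp add: L 1 2)
  qed
  finally show ?thesis by (simp add: sum.If_cases)
qed

section \<open>The semidirect product and its extension by the nonzero complex numbers\<close>

definition semidirect :: "('g \<times> bool) monoid" where
  "semidirect = \<lparr>carrier = UNIV,
     mult = (\<lambda>(g,i) (h,j). (g + (if i then \<theta> h else h), i \<noteq> j)), one = (0, False)\<rparr>"

text \<open>Elements flagged \<open>True\<close> invert the scalar passing through them. The factors
  from \<open>\<sigma>\<close> and \<open>\<tau>\<close> form the cocycle for which even powers of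
  \<open>(1, a, True)\<close> produce the scalars \<open>\<kappa>\<close>.\<close>

definition twisted :: "(complex \<times> 'g \<times> bool) monoid" where
  "twisted = \<lparr>carrier = {(l,g,i). l \<noteq> 0},
     mult = (\<lambda>(l,g,i) (m,h,j). if i then (l * inverse m * \<sigma> h * \<tau> g (\<theta> h), g + \<theta> h, \<not> j)
       else (l * m * \<tau> g h, g + h, j)), one = (1, 0, False)\<rparr>"

lemma semidirect_simps [simp]:
  "carrier semidirect = UNIV" "\<one>\<^bsub>semidirect\<^esub> = (0, False)"
  "(g, i) \<otimes>\<^bsub>semidirect\<^esub> (h, j) = (g + (if i then \<theta> h else h), i \<noteq> j)"
  by (simp_all add: semidirect_def)

lemma twisted_simps [simp]:
  "(l, g, i) \<in> carrier twisted \<longleftrightarrow> l \<noteq> 0" "\<one>\<^bsub>twisted\<^esub> = (1, 0, False)"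
  "(l, g, True) \<otimes>\<^bsub>twisted\<^esub> (m, h, j) = (l * inverse m * \<sigma> h * \<tau> g (\<theta> h), g + \<theta> h, \<not> j)"
  "(l, g, False) \<otimes>\<^bsub>twisted\<^esub> (m, h, j) = (l * m * \<tau> g h, g + h, j)"
  by (simp_all add: twisted_def)

lemma group_semidirect: "group semidirect"
proof (rule groupI)
  fix x :: "'g \<times> bool"
  show "\<exists>y\<in>carrier semidirect. y \<otimes>\<^bsub>semidirect\<^esub> x = \<one>\<^bsub>semidirect\<^esub>"
  proof (cases x)
    case (Pair g i)
    then show ?thesis
      by (intro bexI[of _ "(if i then - \<theta> g else - g, i)"]) auto
  qed
qed (auto simp: theta_add theta_theta add.assoc)

lemma group_twisted: "group twisted"
proof (rule groupI)
  fix x y z assume "x \<in> carrier twisted" "y \<in> carrier twisted" "z \<in> carrier twisted"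
  then obtain l g i m h j n k u where xyz: "x = (l,g,i)" "y = (m,h,j)" "z = (n,k,u)"
    and nz: "l \<noteq> 0" "m \<noteq> 0" "n \<noteq> 0" by (metis prod_cases3 twisted_simps(1))
  note nz' = nz tau_nonzero sigma_nonzero
  \<comment> \<open>The four cases of associativity, named by the flags of the first two factors.
    All rest on \<open>cocycle\<close>; those with first flag \<open>T\<close> also need
    \<open>sigma_add\<close>.\<close>
  have FF: "l * m * \<tau> g h * n * \<tau> (g + h) k = l * (m * n * \<tau> h k) * \<tau> g (h + k)"
    using cocycle[of g h k] by (simp add: mult_ac)
  have FT: "l * m * \<tau> g h * inverse n * \<sigma> k * \<tau> (g + h) (\<theta> k) = l * (m * inverse n * \<sigma> k * \<tau> h (\<theta> k)) * \<tau> g (h + \<theta> k)"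
    using cocycle[of g h "\<theta> k"] by (simp add: mult_ac)
  have TF: "l * inverse m * \<sigma> h * \<tau> g (\<theta> h) * inverse n * \<sigma> k * \<tau> (g + \<theta> h) (\<theta> k) =
      l * inverse (m * n * \<tau> h k) * \<sigma> (h + k) * \<tau> g (\<theta> h + \<theta> k)"
    using cocycle[of g "\<theta> h" "\<theta> k"] nz' by (simp add: sigma_add field_simps)
  have TT: "l * inverse m * \<sigma> h * \<tau> g (\<theta> h) * n * \<tau> (g + \<theta> h) k =
      l * inverse (m * inverse n * \<sigma> k * \<tau> h (\<theta> k)) * \<sigma> (h + \<theta> k) * \<tau> g (\<theta> h + k)"
    using cocycle[of g "\<theta> h" k] nz' by (simp add: sigma_add sigma_theta theta_theta field_simps)
  show "x \<otimes>\<^bsub>twisted\<^esub> y \<otimes>\<^bsub>twisted\<^esub> z = x \<otimes>\<^bsub>twisted\<^esub> (y \<otimes>\<^bsub>twisted\<^esub> z)"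
    using FF FT TF TT
    by (cases i; cases j; simp add: xyz theta_add theta_theta add.assoc)
next
  fix x assume "x \<in> carrier twisted"
  then obtain l g i where x: "x = (l,g,i)" and l: "l \<noteq> 0" by (cases x) auto
  show "\<exists>y\<in>carrier twisted. y \<otimes>\<^bsub>twisted\<^esub> x = \<one>\<^bsub>twisted\<^esub>"
  proof (cases i)
    case True
    then show ?thesis using x l tau_nonzero sigma_nonzero
      by (intro bexI[of _ "(l / (\<sigma> g * \<tau> (- \<theta> g) (\<theta> g)), - \<theta> g, True)"]) (simp_all add: field_simps)
  next
    case False
    then show ?thesis using x l tau_nonzero
      by (intro bexI[of _ "(inverse (l * \<tau> (- g) g), - g, False)"]) (simp_all add: field_simps)
  qed
next
  fix x y assume "x \<in> carrier twisted" "y \<in> carrier twisted"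
  moreover obtain l g i m h j where "x = (l, g, i)" "y = (m, h, j)" by (metis prod_cases3)
  ultimately show "x \<otimes>\<^bsub>twisted\<^esub> y \<in> carrier twisted"
    by (cases i) (simp_all add: tau_nonzero sigma_nonzero)
next
  fix x assume "x \<in> carrier twisted"
  then show "\<one>\<^bsub>twisted\<^esub> \<otimes>\<^bsub>twisted\<^esub> x = x" by (cases x) (simp add: tau_0)
qed simp

text \<open>The kernel consists of the scalars over the identity: complex square roots exist, and 1
  and -1 are the only scalars with square 1.\<close>

sublocale ext: inverting_extension twisted semidirect snd "{x. snd x}" "(- 1, 0, False)"
proof -
  interpret T: group twisted by (rule group_twisted)
  interpret S: group semidirect by (rule group_semidirect)
  have ker: "z \<in> kernel twisted semidirect snd \<longleftrightarrow> (\<exists>m. m \<noteq> 0 \<and> z = (m, 0, False))" for z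
    by (cases z) (auto simp: kernel_def)
  have inv: "inv\<^bsub>twisted\<^esub> (m, 0, False) = (inverse m, 0, False)" if "m \<noteq> 0" for m
    by (rule T.inv_equality) (use that in \<open>auto simp: tau_0\<close>)
  show "inverting_extension twisted semidirect snd {x. snd x} (- 1, 0, False)"
  proof
    show "finite (carrier semidirect)" by simp
    show "snd \<in> hom twisted semidirect"
    proof (rule homI)
      fix x y :: "complex \<times> 'g \<times> bool"
      obtain l g i m h j where "x = (l, g, i)" "y = (m, h, j)" by (metis prod_cases3)
      then show "snd (x \<otimes>\<^bsub>twisted\<^esub> y) = snd x \<otimes>\<^bsub>semidirect\<^esub> snd y" by (cases i) simp_all
    qed simp
    show "snd ` carrier twisted = carrier semidirect"
    proof -
      have "x \<in> snd ` carrier twisted" for x :: "'g \<times> bool"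
        by (cases x) (auto intro!: image_eqI[of _ _ "(1, x)"])
      then show ?thesis by auto
    qed
    show "{x. snd x} \<subseteq> carrier semidirect" by simp
    show "(x \<otimes>\<^bsub>semidirect\<^esub> y \<in> {x. snd x}) = ((x \<in> {x. snd x}) \<noteq> (y \<in> {x. snd x}))" for x y
      by (cases x; cases y) simp
    show "y \<otimes>\<^bsub>twisted\<^esub> z = inv\<^bsub>twisted\<^esub> z \<otimes>\<^bsub>twisted\<^esub> y"
      if "y \<in> carrier twisted" "snd y \<in> {x. snd x}" "z \<in> kernel twisted semidirect snd" for y z
      using that by (cases y) (auto simp: ker inv tau_0 theta_0 sigma_0)
    show "y \<otimes>\<^bsub>twisted\<^esub> z = z \<otimes>\<^bsub>twisted\<^esub> y"
      if "y \<in> carrier twisted" "snd y \<notin> {x. snd x}" "z \<in> kernel twisted semidirect snd" for y z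
      using that by (cases y) (auto simp: ker tau_0)
    show "\<exists>s\<in>kernel twisted semidirect snd. s \<otimes>\<^bsub>twisted\<^esub> s = z" if "z \<in> kernel twisted semidirect snd" for z
    proof -
      from that obtain m where m: "m \<noteq> 0" "z = (m, 0, False)" unfolding ker by (elim exE conjE)
      have "csqrt m * csqrt m = m" by (simp flip: power2_eq_square)
      then show ?thesis using m
        by (intro bexI[of _ "(csqrt m, 0, False)"]) (auto simp: ker tau_0)
    qed
    show "(- 1, 0, False) \<in> kernel twisted semidirect snd" by (simp add: ker)
    show "(- 1, 0, False) \<otimes>\<^bsub>twisted\<^esub> (- 1, 0, False) = \<one>\<^bsub>twisted\<^esub>" by (simp add: tau_0)
    show "(- 1, 0, False) \<noteq> \<one>\<^bsub>twisted\<^esub>" by simp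
    show "z = \<one>\<^bsub>twisted\<^esub> \<or> z = (- 1, 0, False)"
      if "z \<in> kernel twisted semidirect snd" "z \<otimes>\<^bsub>twisted\<^esub> z = \<one>\<^bsub>twisted\<^esub>" for z
      using that by (auto simp: ker tau_0 square_eq_1_iff)
  qed
qed

section \<open>From powers in the two groups to divisibility of the indicator\<close>

lemma semidirect_pow:
  "(a, False) [^]\<^bsub>semidirect\<^esub> n = (npow n a, False)" "(a, True) [^]\<^bsub>semidirect\<^esub> n = (alt n a, odd n)"
proof -
  have Suc: "x [^]\<^bsub>semidirect\<^esub> Suc n = x \<otimes>\<^bsub>semidirect\<^esub> x [^]\<^bsub>semidirect\<^esub> n" for x n
    by (rule ext.L.nat_pow_Suc2) simp
  show "(a, False) [^]\<^bsub>semidirect\<^esub> n = (npow n a, False)"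
  proof (induction n)
    case (Suc n)
    show ?case unfolding \<open>\<And>x n. x [^]\<^bsub>semidirect\<^esub> Suc n = _\<close> Suc by simp
  qed simp
  have alt_theta: "alt n (\<theta> a) = \<theta> (alt n a)" for n a
    by (induction n arbitrary: a) (simp_all add: theta_0 theta_add)
  show "(a, True) [^]\<^bsub>semidirect\<^esub> n = (alt n a, odd n)"
  proof (induction n)
    case (Suc n)
    show ?case unfolding \<open>\<And>x n. x [^]\<^bsub>semidirect\<^esub> Suc n = _\<close> Suc by (simp add: alt_theta)
  qed simp
qed

text \<open>Exponents advance by two, since the square
  \<open>(\<sigma> a * \<tau> a (\<theta> a), a + \<theta> a, False)\<close> no longer inverts
  scalars; \<open>cocycle\<close> then rearranges the coefficient into the recursion of
  \<open>t\<close>.\<close>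

lemma twisted_pow: "(1, a, True) [^]\<^bsub>twisted\<^esub> (2 * m) = (t (2 * m) a * \<sigma> a ^ m, alt (2 * m) a, False)"
proof (induction m)
  case 0
  show ?case by simp
next
  case (Suc m)
  let ?y = "(1, a, True)" and ?A = "alt (2 * m) a"
  have y: "?y \<in> carrier twisted" by simp
  have "?y [^]\<^bsub>twisted\<^esub> (2 * Suc m) = (?y \<otimes>\<^bsub>twisted\<^esub> ?y) \<otimes>\<^bsub>twisted\<^esub> ?y [^]\<^bsub>twisted\<^esub> (2 * m)"
    using ext.G.nat_pow_mult[OF y, of 2 "2 * m"] y by (simp only: numeral_2_eq_2 mult_Suc_right ext.G.nat_pow_Suc ext.G.nat_pow_0 ext.G.l_one)
  also have "\<dots> = (\<sigma> a * \<tau> a (\<theta> a) * (t (2 * m) a * \<sigma> a ^ m) * \<tau> (a + \<theta> a) ?A, a + \<theta> a + ?A, False)"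
    unfolding Suc by simp
  also have "\<sigma> a * \<tau> a (\<theta> a) * (t (2 * m) a * \<sigma> a ^ m) * \<tau> (a + \<theta> a) ?A =
      (\<tau> (a + \<theta> a) ?A * \<tau> a (\<theta> a)) * (t (2 * m) a * \<sigma> a ^ Suc m)" by simp
  also have "\<dots> = t (2 * Suc m) a * \<sigma> a ^ Suc m"
    unfolding cocycle by (simp add: theta_theta mult_ac)
  finally show ?case by (simp add: theta_theta add.assoc)
qed

lemma order_semidirect: "order semidirect = 2 * card (UNIV :: 'g set)"
proof -
  have "order semidirect = card ((UNIV :: 'g set) \<times> (UNIV :: bool set))"
    by (simp only: order_def semidirect_simps UNIV_Times_UNIV)
  also have "\<dots> = 2 * card (UNIV :: 'g set)" unfolding card_cartesian_product by simp
  finally show ?thesis .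
qed

lemma card_roots_semidirect:
  "card (ext.L.roots n) = card {a. npow n a = (0::'g)} + (if even n then card {a. alt n a = 0} else 0)"
proof -
  have "ext.L.roots n = (\<lambda>a. (a, False)) ` {a. npow n a = 0} \<union> (\<lambda>a. (a, True)) ` {a. alt n a = 0 \<and> even n}"
  proof (rule Set.set_eqI)
    fix x :: "'g \<times> bool"
    obtain a i where x: "x = (a, i)" by (cases x)
    show "x \<in> ext.L.roots n \<longleftrightarrow> x \<in> (\<lambda>a. (a, False)) ` {a. npow n a = 0} \<union> (\<lambda>a. (a, True)) ` {a. alt n a = 0 \<and> even n}"
      by (cases i) (auto simp: x ext.L.roots_def semidirect_pow)
  qed
  then have "card (ext.L.roots n) = card {a. npow n a = (0::'g)} + card {a. alt n a = 0 \<and> even n}"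
    by (simp add: card_Un_disjoint card_image inj_on_def image_Int disjoint_iff image_iff)
  then show ?thesis by simp
qed

text \<open>\<open>\<kappa> n a\<close> is the scalar of the \<open>n\<close>-th power of the lift
  \<open>(1, a, True)\<close>, which \<open>pow_in_kernel\<close> restricts to 1 or -1.\<close>

lemma kappa_sign:
  assumes n: "even n" and a: "alt n a = 0"
  shows "\<kappa> n a = 1 - 2 * (if (a, True) \<in> ext.neg n then 1 else 0)"
proof -
  obtain m where m: "n = 2 * m" using n by auto
  have y: "(1, a, True) \<in> carrier twisted" by simp
  have p: "(1, a, True) [^]\<^bsub>twisted\<^esub> n = (\<kappa> n a, 0, False)"
    using twisted_pow[of a m] a by (simp add: m \<kappa>_def)
  have "snd (1::complex, a, True) [^]\<^bsub>semidirect\<^esub> n = \<one>\<^bsub>semidirect\<^esub>"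
    using a n by (simp add: semidirect_pow)
  then have "(\<kappa> n a, 0, False) = \<one>\<^bsub>twisted\<^esub> \<or> (\<kappa> n a, 0, False) = (- 1, 0::'g, False)"
    using ext.pow_in_kernel[OF y, of n] p by simp
  then have "\<kappa> n a = 1 \<or> \<kappa> n a = - 1" by simp
  moreover have "(a, True) \<in> ext.neg n \<longleftrightarrow> \<kappa> n a = - 1"
    using ext.neg_lift[OF n y] p by simp
  ultimately show ?thesis by auto
qed

text \<open>If all signs were 1, an even \<open>n\<close> would give the number of roots in the
  semidirect product; each sign -1 lowers this by two. For odd \<open>n\<close> neither side sees
  elements flagged \<open>True\<close>.\<close>

lemma fs_indicator_int:
  assumes "n > 0"
  shows "fs_indicator n H = of_int (int (card (ext.L.roots n)) - (if even n then int (2 * card (ext.neg n)) else 0))"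
proof (cases "even n")
  case False
  then show ?thesis by (simp add: fs_indicator_eq[OF assms] \<kappa>_def card_roots_semidirect)
next
  case True
  have "card {a. alt n a = 0 \<and> (a, True) \<in> ext.neg n} = card (ext.neg n)"
  proof -
    have "(\<lambda>a. (a, True)) ` {a. alt n a = 0 \<and> (a, True) \<in> ext.neg n} = ext.neg n"
    proof (intro equalityI subsetI)
      fix x assume x: "x \<in> ext.neg n"
      obtain a where a: "x = (a, True)" using x by (cases x) (auto simp: ext.neg_def)
      have "(a, True) \<in> ext.L.roots n" using subsetD[OF ext.neg_roots x] a by simp
      then have "alt n a = 0" by (simp add: ext.L.roots_def semidirect_pow)
      then show "x \<in> (\<lambda>a. (a, True)) ` {a. alt n a = 0 \<and> (a, True) \<in> ext.neg n}" using x a by auto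
    qed auto
    then show ?thesis by (metis (no_types, lifting) card_image inj_onI prod.inject)
  qed
  moreover have "(\<Sum>a | alt n a = 0. \<kappa> n a) =
      of_nat (card {a. alt n a = 0}) - 2 * of_nat (card {a. alt n a = 0 \<and> (a, True) \<in> ext.neg n})"
  proof -
    have "(\<Sum>a | alt n a = 0. \<kappa> n a) = (\<Sum>a | alt n a = 0. 1 - 2 * (if (a, True) \<in> ext.neg n then 1 else 0))"
      by (intro sum.cong) (auto simp: kappa_sign[OF True])
    also have "\<dots> = of_nat (card {a. alt n a = 0}) - 2 * (\<Sum>a | alt n a = 0. if (a, True) \<in> ext.neg n then 1 else 0)"
      by (simp add: sum_subtractf sum_distrib_left)
    also have "(\<Sum>a | alt n a = 0. if (a, True) \<in> ext.neg n then 1 else (0::complex)) =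
        of_nat (card {a. alt n a = 0 \<and> (a, True) \<in> ext.neg n})"
      using sum.inter_filter[of "{a. alt n a = 0}" "\<lambda>a. 1 :: complex" "\<lambda>a. (a, True) \<in> ext.neg n"] by simp
    finally show ?thesis .
  qed
  ultimately show ?thesis using True by (simp add: fs_indicator_eq[OF assms] card_roots_semidirect)
qed

text \<open>The semidirect product has order \<open>dim UNIV\<close>, so the theorem of Frobenius
  covers the root count and \<open>half_dvd_card_neg\<close> the correction. The cofactor found is
  an ordinary integer.\<close>

theorem fs_indicator_divisible:
  assumes "n > 0" "n dvd dim UNIV"
  shows "\<exists>k. algebraic_int k \<and> fs_indicator n H = of_nat n * k"
proof -
  have n: "n dvd order semidirect" using assms(2) by (simp add: order_semidirect card_carrier_eq)
  have "int n dvd int (card (ext.L.roots n))" using ext.L.frobenius[OF ext.fin n] by simp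
  moreover have "int n dvd (if even n then int (2 * card (ext.neg n)) else 0)"
    using ext.half_dvd_card_neg[OF _ n] by (auto simp del: of_nat_mult)
  ultimately have "int n dvd int (card (ext.L.roots n)) - (if even n then int (2 * card (ext.neg n)) else 0)"
    by (rule dvd_diff)
  then obtain k where k: "int (card (ext.L.roots n)) - (if even n then int (2 * card (ext.neg n)) else 0) = int n * k"
    by (rule dvdE)
  have "fs_indicator n H = of_nat n * of_int k"
    unfolding fs_indicator_int[OF assms(1)] k by simp
  then show ?thesis using algebraic_int_of_int by blast
qed

end

theorem corollary6p9:
  fixes H :: "'h::ring_1 hopf"
    and \<iota> :: "('g::{group_add,finite} \<Rightarrow> complex) \<Rightarrow> 'h"
    and \<pi> :: "'h \<Rightarrow> (bit \<Rightarrow>\<^sub>0 complex)"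
  assumes "hopf_algebra H"
    and "semisimple_ring TYPE('h)"
    and "exact_hopf_sequence dual_group_algebra \<iota> H \<pi> group_algebra"
  shows "\<forall>n>0. n dvd vector_space.dim (hscale H) UNIV \<longrightarrow>
           (\<exists>k. algebraic_int k \<and> fs_indicator n H = of_nat n * k)"
proof -
  interpret Z2_extension H \<iota> \<pi>
    by (intro Z2_extension.intro Z2_extension_axioms.intro assms)
  obtain c \<theta> \<sigma> \<tau> e' c' where g: "graded_basis H E c \<theta> \<sigma> \<tau> e' c'" by (rule graded_basis_exists)
  interpret graded_basis H E c \<theta> \<sigma> \<tau> e' c' by (rule g)
  show ?thesis using fs_indicator_divisible by blast
qed

end
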